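(* Let $E=(E^0,E^1,r,s)$ be a second countable topological graph. The map $\nu\mapsto r_*\nu$ (push-forward along the range map $r:\partial E\to E^0$) defines an affine bijection between the set of invariant measures on $\partial E$ and the set of vertex-invariant measures on $E^0$.
   Context: A topological graph $E=(E^0,E^1,r,s)$ consists of locally compact Hausdorff spaces $E^0$, $E^1$, a local homeomorphism $s:E^1\to E^0$ and a continuous map $r:E^1\to E^0$; it is second countable if $E^0$ and $E^1$ are. For $n\ge1$, $E^n$ is the set of paths $\alpha=\alpha_1\cdots\alpha_n$ of edges with $s(\alpha_i)=r(\alpha_{i+1})$, topologised as a subspace of $\prod_{i=1}^nE^1$; vertices are paths of length $0$; $|\alpha|$ is the length. $E^*=\bigsqcup_{n\ge0}E^n$ (disjoint union topology), and $E^\infty$ is the set of infinite paths $\alpha_1\alpha_2\cdots$ with $s(\alpha_i)=r(\alpha_{i+1})$, $|\alpha|=\infty$. One extends $r(\alpha)=r(\alpha_1)$, $s(\alpha)=s(\alpha_{|\alpha|})$ (finite paths), $r(v)=s(v)=v$ for vertices. $E^0_{reg}$ is the set of $v\in E^0$ having an open neighbourhood $W$ with $\overline W$ compact, $r^{-1}(\overline W)\subseteq E^1$ compact and $r(r^{-1}(W))=W$; $E^0_{sng}=E^0\setminus E^0_{reg}$; $E^*_{sng}=\{\alpha\in E^*: s(\alpha)\in E^0_{sng}\}$. As a set the boundary path space is $\partial E=E^*_{sng}\sqcup E^\infty$. For $S\subseteq E^*$, $Z(S)=\{\alpha\in\partial E: r(\alpha)\in S\text{ or }\alpha_1\cdots\alpha_n\in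 S\text{ for some }1\le n\le|\alpha|\}$. The sets $Z(U)\setminus Z(K)$ ($U\subseteq E^*$ open, $K\subseteq E^*$ compact) form a basis of a locally compact Hausdorff topology on $\partial E$. The shift $\sigma:\partial E\setminus E^0\to\partial E$ removes the first edge ($\sigma(\alpha)=s(\alpha_1)$ if $|\alpha|=1$); it is a local homeomorphism. Regular Borel measures on these (locally compact second countable Hausdorff) spaces are the Borel measures that are finite on compact sets. An invariant measure on $\partial E$ is a regular Borel measure $\nu$ with $\nu(\sigma(A))=\nu(A)$ for all Borel $A\subseteq\partial E\setminus E^0$ on which $\sigma$ is injective. For a regular Borel measure $\mu$ on $E^0$, $s^*\mu$ is the regular Borel measure on $E^1$ with $\int_{E^1}h\,\mathrm{d}s^*\mu=\int_{E^0}\sum_{e\in s^{-1}(v)}h(e)\,\mathrm{d}\mu(v)$ for $h\in C_c(E^1)$. A regular Borel measure $\mu$ on $E^0$ is vertex-invariant if $\int_{E^1}f\circ r\,\mathrm{d}s^*\mu\le\int_{E^0}f\,\mathrm{d}\mu$ for all positive $f\in C_c(E^0)$, with equality when $\mathrm{supp}(f)\subseteq E^0_{reg}$. *)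

theory Defs
  imports "HOL-Analysis.Analysis"
begin

section \<open>Topological graphs\<close>

record ('v, 'e) topgraph =
  vertices :: "'v topology"
  edges :: "'e topology"
  rng :: "'e \<Rightarrow> 'v"
  src :: "'e \<Rightarrow> 'v"

definition local_homeomorphism :: "'a topology \<Rightarrow> 'b topology \<Rightarrow> ('a \<Rightarrow> 'b) \<Rightarrow> bool" where
  "local_homeomorphism X Y f \<longleftrightarrow>
     f \<in> topspace X \<rightarrow> topspace Y \<and>
     (\<forall>x\<in>topspace X. \<exists>U. openin X U \<and> x \<in> U \<and> openin Y (f ` U) \<and>
        homeomorphic_map (subtopology X U) (subtopology Y (f ` U)) f)"

definition topological_graph :: "('v, 'e) topgraph \<Rightarrow> bool" where
  "topological_graph E \<longleftrightarrow>
     locally_compact_space (vertices E) \<and> Hausdorff_space (vertices E) \<and>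
     locally_compact_space (edges E) \<and> Hausdorff_space (edges E) \<and>
     local_homeomorphism (edges E) (vertices E) (src E) \<and>
     continuous_map (edges E) (vertices E) (rng E)"

definition second_countable_graph :: "('v, 'e) topgraph \<Rightarrow> bool" where
  "second_countable_graph E \<longleftrightarrow> second_countable (vertices E) \<and> second_countable (edges E)"

definition rng_preimage :: "('v, 'e) topgraph \<Rightarrow> 'v set \<Rightarrow> 'e set" where
  "rng_preimage E W = {e \<in> topspace (edges E). rng E e \<in> W}"

definition regular_vertices :: "('v, 'e) topgraph \<Rightarrow> 'v set" where
  "regular_vertices E = {v \<in> topspace (vertices E).
     \<exists>W. openin (vertices E) W \<and> v \<in> W \<and>
       compactin (vertices E) (vertices E closure_of W) \<and>
       compactin (edges E) (rng_preimage E (vertices E closure_of W)) \<and>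
       rng E ` rng_preimage E W = W}"

definition singular_vertices :: "('v, 'e) topgraph \<Rightarrow> 'v set" where
  "singular_vertices E = topspace (vertices E) - regular_vertices E"

section \<open>Paths\<close>

text \<open>Paths of length zero, of finite positive length, and of infinite length. The list carried
  by a finite path is never empty in the path sets below; the edge \<open>\<alpha>\<^sub>i\<close> of the usual
  one-based notation sits at position \<open>i - 1\<close>.\<close>

datatype ('v, 'e) gpath = Vertex 'v | Edges "'e list" | Infinite "nat \<Rightarrow> 'e"

definition finite_paths :: "('v, 'e) topgraph \<Rightarrow> ('v, 'e) gpath set" where
  "finite_paths E = Vertex ` topspace (vertices E) \<union>
     {Edges es | es. es \<noteq> [] \<and> set es \<subseteq> topspace (edges E) \<and>
        (\<forall>i. Suc i < length es \<longrightarrow> src E (es ! i) = rng E (es ! Suc i))}"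

definition infinite_paths :: "('v, 'e) topgraph \<Rightarrow> ('v, 'e) gpath set" where
  "infinite_paths E = {Infinite x | x. range x \<subseteq> topspace (edges E) \<and>
     (\<forall>i. src E (x i) = rng E (x (Suc i)))}"

fun path_length :: "('v, 'e) gpath \<Rightarrow> enat" where
  "path_length (Vertex v) = 0"
| "path_length (Edges es) = enat (length es)"
| "path_length (Infinite x) = \<infinity>"

fun path_range :: "('v, 'e) topgraph \<Rightarrow> ('v, 'e) gpath \<Rightarrow> 'v" where
  "path_range E (Vertex v) = v"
| "path_range E (Edges es) = rng E (hd es)"
| "path_range E (Infinite x) = rng E (x 0)"

text \<open>Infinite paths have no source; the last equation is arbitrary.\<close>

fun path_source :: "('v, 'e) topgraph \<Rightarrow> ('v, 'e) gpath \<Rightarrow> 'v" where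
  "path_source E (Vertex v) = v"
| "path_source E (Edges es) = src E (last es)"
| "path_source E (Infinite x) = undefined"

text \<open>The initial segment \<open>\<alpha>\<^sub>1\<dots>\<alpha>\<^sub>n\<close>, only used for \<open>1 \<le> n \<le> |\<alpha>|\<close>.\<close>

fun path_prefix :: "nat \<Rightarrow> ('v, 'e) gpath \<Rightarrow> ('v, 'e) gpath" where
  "path_prefix n (Vertex v) = Vertex v"
| "path_prefix n (Edges es) = Edges (take n es)"
| "path_prefix n (Infinite x) = Edges (map x [0..<n])"

text \<open>The shift is only used away from the vertices; its value there is arbitrary.\<close>

fun shift :: "('v, 'e) topgraph \<Rightarrow> ('v, 'e) gpath \<Rightarrow> ('v, 'e) gpath" where
  "shift E (Vertex v) = Vertex v"
| "shift E (Edges es) = (if length es = 1 then Vertex (src E (hd es)) else Edges (tl es))"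
| "shift E (Infinite x) = Infinite (\<lambda>i. x (Suc i))"

text \<open>The space \<open>E\<^sup>n\<close> for \<open>n \<ge> 1\<close>, as a subspace of the \<open>n\<close>-fold product of the edge space.\<close>

definition path_space :: "('v, 'e) topgraph \<Rightarrow> nat \<Rightarrow> (nat \<Rightarrow> 'e) topology" where
  "path_space E n = subtopology (product_topology (\<lambda>_. edges E) {..<n})
     {x. \<forall>i. Suc i < n \<longrightarrow> src E (x i) = rng E (x (Suc i))}"

text \<open>The disjoint union topology on the set of finite paths: a set is open iff its trace on the
  vertex space and on each \<open>E\<^sup>n\<close>, \<open>n \<ge> 1\<close>, is open.\<close>

definition finite_path_open :: "('v, 'e) topgraph \<Rightarrow> ('v, 'e) gpath set \<Rightarrow> bool" where
  "finite_path_open E U \<longleftrightarrow> U \<subseteq> finite_paths E \<and>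
     openin (vertices E) {v \<in> topspace (vertices E). Vertex v \<in> U} \<and>
     (\<forall>n\<ge>1. openin (path_space E n)
        {x \<in> topspace (path_space E n). Edges (map x [0..<n]) \<in> U})"

definition finite_path_topology :: "('v, 'e) topgraph \<Rightarrow> ('v, 'e) gpath topology" where
  "finite_path_topology E = topology (finite_path_open E)"

lemma istopology_finite_path_open: "istopology (finite_path_open E)"
  unfolding istopology_def
proof (intro conjI allI impI)
  fix S T assume S: "finite_path_open E S" and T: "finite_path_open E T"
  have 1: "{v \<in> topspace (vertices E). Vertex v \<in> S \<inter> T} =
      {v \<in> topspace (vertices E). Vertex v \<in> S} \<inter> {v \<in> topspace (vertices E). Vertex v \<in> T}"
    by blast
  have 2: "{x \<in> topspace (path_space E n). Edges (map x [0..<n]) \<in> S \<inter> T} =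
      {x \<in> topspace (path_space E n). Edges (map x [0..<n]) \<in> S} \<inter>
      {x \<in> topspace (path_space E n). Edges (map x [0..<n]) \<in> T}" for n
    by blast
  show "finite_path_open E (S \<inter> T)"
    using S T unfolding finite_path_open_def 1 2 by (auto intro: openin_Int)
next
  fix \<K> assume K: "\<forall>K\<in>\<K>. finite_path_open E K"
  have 1: "{v \<in> topspace (vertices E). Vertex v \<in> \<Union>\<K>} =
      (\<Union>K\<in>\<K>. {v \<in> topspace (vertices E). Vertex v \<in> K})"
    by blast
  have 2: "{x \<in> topspace (path_space E n). Edges (map x [0..<n]) \<in> \<Union>\<K>} =
      (\<Union>K\<in>\<K>. {x \<in> topspace (path_space E n). Edges (map x [0..<n]) \<in> K})" for n
    by blast
  show "finite_path_open E (\<Union>\<K>)"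
    using K unfolding finite_path_open_def 1 2 by (intro conjI allI impI openin_Union) auto
qed

lemma openin_finite_path_topology: "openin (finite_path_topology E) = finite_path_open E"
  unfolding finite_path_topology_def
  by (rule topology_inverse'[OF istopology_finite_path_open])

lemma topspace_finite_path_topology: "topspace (finite_path_topology E) = finite_paths E"
proof -
  have "Edges (map x [0..<n]) \<in> finite_paths E"
    if "n \<ge> 1" "x \<in> topspace (path_space E n)" for n x
    using that by (auto simp: path_space_def finite_paths_def PiE_iff)
  then have "{x \<in> topspace (path_space E n). Edges (map x [0..<n]) \<in> finite_paths E} =
      topspace (path_space E n)" if "n \<ge> 1" for n
    using that by blast
  moreover have "{v \<in> topspace (vertices E). Vertex v \<in> finite_paths E} = topspace (vertices E)"
    by (auto simp: finite_paths_def)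
  ultimately have "finite_path_open E (finite_paths E)"
    by (simp add: finite_path_open_def)
  then show ?thesis
    unfolding topspace_def openin_finite_path_topology by (auto simp: finite_path_open_def)
qed

section \<open>The boundary path space\<close>

definition boundary_paths :: "('v, 'e) topgraph \<Rightarrow> ('v, 'e) gpath set" where
  "boundary_paths E =
     {\<alpha> \<in> finite_paths E. path_source E \<alpha> \<in> singular_vertices E} \<union> infinite_paths E"

definition cylinder :: "('v, 'e) topgraph \<Rightarrow> ('v, 'e) gpath set \<Rightarrow> ('v, 'e) gpath set" where
  "cylinder E S = {\<alpha> \<in> boundary_paths E. Vertex (path_range E \<alpha>) \<in> S \<or>
     (\<exists>n\<ge>1. enat n \<le> path_length \<alpha> \<and> path_prefix n \<alpha> \<in> S)}"

definition boundary_path_space :: "('v, 'e) topgraph \<Rightarrow> ('v, 'e) gpath topology" where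
  "boundary_path_space E = topology_generated_by {cylinder E U - cylinder E K | U K.
     openin (finite_path_topology E) U \<and> compactin (finite_path_topology E) K}"

lemma topspace_boundary_path_space: "topspace (boundary_path_space E) = boundary_paths E"
proof -
  have r: "Vertex (path_range E \<alpha>) \<in> finite_paths E \<or>
      (\<exists>n\<ge>1. enat n \<le> path_length \<alpha> \<and> path_prefix n \<alpha> \<in> finite_paths E)"
    if "\<alpha> \<in> boundary_paths E" for \<alpha>
  proof (cases \<alpha>)
    case (Vertex v)
    then show ?thesis
      using that by (auto simp: boundary_paths_def finite_paths_def infinite_paths_def)
  next
    case (Edges es)
    then have "es \<noteq> []" "Edges es \<in> finite_paths E"
      using that by (auto simp: boundary_paths_def finite_paths_def infinite_paths_def)
    then show ?thesis
      using Edges by (intro disjI2 exI[of _ "length es"]) (auto simp: Suc_le_eq)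
  next
    case (Infinite x)
    then show ?thesis
      using that
      by (intro disjI2 exI[of _ 1])
         (auto simp: boundary_paths_def finite_paths_def infinite_paths_def)
  qed
  have "cylinder E (finite_paths E) - cylinder E {} = boundary_paths E"
    using r by (auto simp: cylinder_def)
  moreover have "openin (finite_path_topology E) (finite_paths E)"
    by (metis openin_topspace topspace_finite_path_topology)
  ultimately have "boundary_paths E \<in> {cylinder E U - cylinder E K | U K.
      openin (finite_path_topology E) U \<and> compactin (finite_path_topology E) K}"
    by (metis (mono_tags, lifting) compactin_empty mem_Collect_eq)
  then show ?thesis
    unfolding boundary_path_space_def topology_generated_by_topspace
    by (auto simp: cylinder_def)
qed

section \<open>Regular Borel measures\<close>

definition borel_of :: "'a topology \<Rightarrow> 'a measure" where
  "borel_of X = sigma (topspace X) {U. openin X U}"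

text \<open>On locally compact second countable Hausdorff spaces these are the regular Borel measures.\<close>

definition regular_borel_measures :: "'a topology \<Rightarrow> 'a measure set" where
  "regular_borel_measures X =
     {M. sets M = sets (borel_of X) \<and> (\<forall>K. compactin X K \<longrightarrow> emeasure M K < \<infinity>)}"

definition supp :: "'a topology \<Rightarrow> ('a \<Rightarrow> real) \<Rightarrow> 'a set" where
  "supp X f = X closure_of {x \<in> topspace X. f x \<noteq> 0}"

definition Cc :: "'a topology \<Rightarrow> ('a \<Rightarrow> real) set" where
  "Cc X = {f. continuous_map X euclideanreal f \<and> compactin X (supp X f)}"

definition invariant_measures :: "('v, 'e) topgraph \<Rightarrow> ('v, 'e) gpath measure set" where
  "invariant_measures E = {\<nu> \<in> regular_borel_measures (boundary_path_space E).
     \<forall>A\<in>sets (borel_of (boundary_path_space E)).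
       A \<subseteq> boundary_paths E - range Vertex \<longrightarrow> inj_on (shift E) A \<longrightarrow>
         emeasure \<nu> (shift E ` A) = emeasure \<nu> A}"

text \<open>The sum over a fibre has only finitely many nonzero terms, because fibres of a local
  homeomorphism are closed and discrete and \<open>h\<close> has compact support.\<close>

definition src_pullback :: "('v, 'e) topgraph \<Rightarrow> 'v measure \<Rightarrow> 'e measure" where
  "src_pullback E \<mu> = (THE M. M \<in> regular_borel_measures (edges E) \<and>
     (\<forall>h\<in>Cc (edges E). (\<integral>e. h e \<partial>M) =
        (\<integral>v. (\<Sum>\<^sub>\<infinity>e\<in>{e \<in> topspace (edges E). src E e = v}. h e) \<partial>\<mu>)))"

text \<open>Integrals of positive functions are taken in \<^typ>\<open>ennreal\<close>, since \<open>f \<circ> r\<close> need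
  not have compact support.\<close>

definition vertex_invariant_measures :: "('v, 'e) topgraph \<Rightarrow> 'v measure set" where
  "vertex_invariant_measures E = {\<mu> \<in> regular_borel_measures (vertices E).
     \<forall>f\<in>Cc (vertices E). (\<forall>v\<in>topspace (vertices E). 0 \<le> f v) \<longrightarrow>
       (\<integral>\<^sup>+e. ennreal (f (rng E e)) \<partial>src_pullback E \<mu>) \<le> (\<integral>\<^sup>+v. ennreal (f v) \<partial>\<mu>) \<and>
       (supp (vertices E) f \<subseteq> regular_vertices E \<longrightarrow>
         (\<integral>\<^sup>+e. ennreal (f (rng E e)) \<partial>src_pullback E \<mu>) = (\<integral>\<^sup>+v. ennreal (f v) \<partial>\<mu>))}"

section \<open>Affine bijections between sets of measures\<close>

text \<open>The measure \<open>t M + (1 - t) N\<close>, for measures \<open>M\<close> and \<open>N\<close> on the same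
  \<open>\<sigma>\<close>-algebra and \<open>0 \<le> t \<le> 1\<close>.\<close>

definition convex_comb :: "real \<Rightarrow> 'a measure \<Rightarrow> 'a measure \<Rightarrow> 'a measure" where
  "convex_comb t M N = measure_of (space M) (sets M)
     (\<lambda>A. ennreal t * emeasure M A + ennreal (1 - t) * emeasure N A)"

lemma sets_convex_comb: "sets (convex_comb t M N) = sets M"
  by (simp add: convex_comb_def)

lemma emeasure_convex_comb:
  assumes "sets N = sets M" "A \<in> sets M"
  shows "emeasure (convex_comb t M N) A =
    ennreal t * emeasure M A + ennreal (1 - t) * emeasure N A"
proof -
  let ?\<mu> = "\<lambda>A. ennreal t * emeasure M A + ennreal (1 - t) * emeasure N A"
  have "countably_additive (sets M) ?\<mu>"
  proof (rule countably_additiveI)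
    fix B :: "nat \<Rightarrow> 'a set"
    assume B: "range B \<subseteq> sets M" "disjoint_family B" "\<Union> (range B) \<in> sets M"
    then have "(\<Sum>i. ?\<mu> (B i)) =
        (\<Sum>i. ennreal t * emeasure M (B i)) + (\<Sum>i. ennreal (1 - t) * emeasure N (B i))"
      by (intro suminf_add[symmetric]) auto
    also have "\<dots> = ?\<mu> (\<Union> (range B))"
      using B assms(1) by (simp add: ennreal_suminf_cmult suminf_emeasure)
    finally show "(\<Sum>i. ?\<mu> (B i)) = ?\<mu> (\<Union> (range B))" .
  qed
  moreover have "positive (sets M) ?\<mu>"
    by (simp add: positive_def)
  ultimately show ?thesis
    using assms(2) unfolding convex_comb_def
    by (intro emeasure_measure_of_sigma sets.sigma_algebra_axioms)
qed

text \<open>Convexity of \<open>D\<close> follows from the conditions below.\<close>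

definition affine_bijection ::
    "('a measure \<Rightarrow> 'b measure) \<Rightarrow> 'a measure set \<Rightarrow> 'b measure set \<Rightarrow> bool" where
  "affine_bijection F C D \<longleftrightarrow> bij_betw F C D \<and>
     (\<forall>M\<in>C. \<forall>N\<in>C. \<forall>t\<in>{0..1}.
        convex_comb t M N \<in> C \<and> F (convex_comb t M N) = convex_comb t (F M) (F N))"

end

theory Submission
  imports Defs "HOL-Probability.Projective_Limit"
begin

text \<open>Write \<open>r\<close> and \<open>s\<close> for the range and source maps, \<open>\<sigma>\<close> for the shift, and \<open>T \<mu>\<close> for the
  push-forward along \<open>r\<close> of the pull-back \<open>s\<^sup>*\<mu>\<close> (below: \<open>edge_push\<close>). Approximating open sets from
  inside by compactly supported functions shows that \<open>\<mu>\<close> is vertex-invariant exactly when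
  \<open>T \<mu> \<le> \<mu>\<close> as measures, with equality on the open set of regular vertices.

  To see that invariant measures push forward to vertex-invariant ones, cut the edge space into
  countably many Borel pieces on which \<open>s\<close> is injective. If \<open>A\<close> lies
  in one piece, then \<open>\<sigma>\<close> maps the boundary paths with first edge in
  \<open>A\<close> bijectively onto those with range in \<open>s(A)\<close>. Hence, for an
  invariant \<open>\<nu>\<close> with push-forward \<open>\<mu>\<close>, the measure
  \<open>s\<^sup>*\<mu>\<close> is the distribution of the first edge under
  \<open>\<nu>\<close>, and \<open>T \<mu>\<close> is the part of \<open>\<mu>\<close> that
  comes from paths of positive length. The rest comes from the paths of length zero, which are the
  singular vertices, and this is vertex invariance (\<open>push_vertex_invariant\<close>). That
  \<open>\<mu>\<close> is finite on compact sets amounts to compactness of the set of boundary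
  paths whose range lies in a given compact set (\<open>compactin_range_preimage\<close>).

  The push-forward determines an invariant measure. Indeed, the cylinder sets that prescribe Borel
  conditions on the range and on finitely many initial edges are closed under intersections and
  generate the Borel sets. Invariance expresses the measure of a cylinder with
  \<open>n + 1\<close> edge conditions through cylinders with \<open>n\<close> such conditions
  (\<open>emeasure_cyl_Suc\<close>), and ultimately through the push-forward.

  Every vertex-invariant measure \<open>\<mu>\<close> arises in this way. Let
  \<open>\<Lambda> = \<mu> - T \<mu>\<close>, which vanishes on regular vertices. Code a path by the sequence of
  its edges, a finite one being continued by endless repetition of its source. On measures on
  sequences consider the operator that puts \<open>\<Lambda>\<close> on the constant vertex
  sequences and adds the image of the given measure under prepending an edge in all possible ways
  (\<open>step\<close>). Started at \<open>\<mu>\<close>, viewed on the constant sequences, its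
  iterates all have range distribution \<open>T \<mu> + \<Lambda> = \<mu>\<close>, and the
  first \<open>k\<close> coordinates have the same law from the \<open>k\<close>-th iterate on.
  Kolmogorov's extension theorem therefore yields a fixed point
  (\<open>stationary_measure_exists\<close>). It is carried by the codes of boundary paths,
  because the defect \<open>\<Lambda>\<close> lives on singular vertices, and the fixed point
  equation is the invariance of the decoded measure (\<open>push_surj\<close>).

  That the bijection is affine is clear, because taking push-forwards is.\<close>

section \<open>Borel measures on locally compact second countable Hausdorff spaces\<close>

lemma space_borel_of [simp]: "space (borel_of X) = topspace X"
  unfolding borel_of_def by (rule space_measure_of) (auto dest: openin_subset)

lemma sets_borel_of: "sets (borel_of X) = sigma_sets (topspace X) {U. openin X U}"
  unfolding borel_of_def by (rule sets_measure_of) (auto dest: openin_subset)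

lemma openin_borel_of: "openin X U \<Longrightarrow> U \<in> sets (borel_of X)"
  by (simp add: sets_borel_of)

lemma closedin_borel_of:
  assumes "closedin X C" shows "C \<in> sets (borel_of X)"
proof -
  have "topspace X - (topspace X - C) \<in> sets (borel_of X)"
    using assms openin_borel_of[of X "topspace X - C"] sets.compl_sets[of _ "borel_of X"] by auto
  moreover have "topspace X - (topspace X - C) = C"
    using closedin_subset[OF assms] by auto
  ultimately show ?thesis by simp
qed

lemma borel_of_euclidean: "borel_of euclidean = borel"
  by (simp add: borel_of_def borel_def)

lemma continuous_map_borel_of_measurable:
  assumes "continuous_map X Y f" shows "f \<in> borel_of X \<rightarrow>\<^sub>M borel_of Y"
proof (rule measurable_sigma_sets[OF sets_borel_of])
  show "f \<in> space (borel_of X) \<rightarrow> topspace Y"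
    using assms by (auto simp: continuous_map_def)
  show "f -` A \<inter> space (borel_of X) \<in> sets (borel_of X)" if "A \<in> {U. openin Y U}" for A
  proof -
    have "f -` A \<inter> space (borel_of X) = {x \<in> topspace X. f x \<in> A}" by auto
    then show ?thesis
      using that assms by (auto intro!: openin_borel_of simp: continuous_map_def)
  qed
qed (auto dest: openin_subset)

lemma regular_borel_measures_sets:
  "M \<in> regular_borel_measures X \<Longrightarrow> sets M = sets (borel_of X)"
  by (simp add: regular_borel_measures_def)

lemma regular_borel_measures_space:
  "M \<in> regular_borel_measures X \<Longrightarrow> space M = topspace X"
  by (metis regular_borel_measures_sets sets_eq_imp_space_eq space_borel_of)

lemma regular_borel_measures_compact:
  "M \<in> regular_borel_measures X \<Longrightarrow> compactin X K \<Longrightarrow> emeasure M K < \<infinity>"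
  by (simp add: regular_borel_measures_def)

locale lch_space =
  fixes X :: "'a topology"
  assumes lc: "locally_compact_space X" and hd: "Hausdorff_space X" and sc: "second_countable X"
begin

text \<open>Regularity of the space makes room for a compact set between a point and an open
  neighbourhood, and a basic open set that fits into it has compact closure.\<close>

lemma compact_base_exists:
  "\<exists>B :: nat \<Rightarrow> 'a set. (\<forall>i. openin X (B i) \<and> compactin X (X closure_of B i)) \<and>
     (\<forall>U x. openin X U \<longrightarrow> x \<in> U \<longrightarrow> (\<exists>i. x \<in> B i \<and> X closure_of B i \<subseteq> U))"
proof -
  obtain \<B> where \<B>: "countable \<B>" "\<forall>V\<in>\<B>. openin X V"
    and *: "\<forall>U x. openin X U \<and> x \<in> U \<longrightarrow> (\<exists>V\<in>\<B>. x \<in> V \<and> V \<subseteq> U)"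
    using sc unfolding second_countable_def by blast
  define \<C> where "\<C> = insert {} {V \<in> \<B>. compactin X (X closure_of V)}"
  have "countable \<C>" "\<C> \<noteq> {}" using \<B> by (auto simp: \<C>_def)
  then obtain B :: "nat \<Rightarrow> 'a set" where B: "range B = \<C>"
    using range_from_nat_into[of \<C>] by metis
  have "openin X V \<and> compactin X (X closure_of V)" if "V \<in> \<C>" for V
    using that \<B> by (auto simp: \<C>_def)
  moreover have "\<exists>V\<in>\<C>. x \<in> V \<and> X closure_of V \<subseteq> U" if U: "openin X U" "x \<in> U" for U x
  proof -
    have "neighbourhood_base_of (compactin X) X"
      using lc hd locally_compact_space_neighbourhood_base by blast
    then obtain W L where WL: "openin X W" "compactin X L" "x \<in> W" "W \<subseteq> L" "L \<subseteq> U"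
      using U unfolding neighbourhood_base_of by (metis (no_types, lifting))
    then obtain V where V: "V \<in> \<B>" "x \<in> V" "V \<subseteq> W" using * by blast
    have L: "closedin X L" using WL hd compactin_imp_closedin by blast
    then have cl: "X closure_of V \<subseteq> L"
      using V WL by (meson closure_of_minimal subset_trans)
    then have cp: "compactin X (X closure_of V)"
      by (rule closed_compactin[OF WL(2)]) simp
    have "V \<in> \<C>" using V cp by (simp add: \<C>_def)
    then show ?thesis using V(2) cl WL(5) by (meson subset_trans)
  qed
  ultimately show ?thesis using B by (intro exI[of _ B]) (metis imageE rangeI)
qed

definition cbase :: "nat \<Rightarrow> 'a set" where
  "cbase = (SOME B. (\<forall>i. openin X (B i) \<and> compactin X (X closure_of B i)) \<and>
     (\<forall>U x. openin X U \<longrightarrow> x \<in> U \<longrightarrow> (\<exists>i. x \<in> B i \<and> X closure_of B i \<subseteq> U)))"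

lemma cbase_open: "openin X (cbase i)"
  and cbase_compact: "compactin X (X closure_of cbase i)"
  and cbase_nhd: "openin X U \<Longrightarrow> x \<in> U \<Longrightarrow> \<exists>i. x \<in> cbase i \<and> X closure_of cbase i \<subseteq> U"
  using someI_ex[OF compact_base_exists, folded cbase_def] by blast+

lemma cbase_subset_closure: "cbase i \<subseteq> X closure_of cbase i"
  using cbase_open closure_of_subset openin_subset by metis

lemma compactin_borel_of: "compactin X K \<Longrightarrow> K \<in> sets (borel_of X)"
  using hd compactin_imp_closedin closedin_borel_of by blast

text \<open>For open \<open>U\<close> these compact sets increase to \<open>U\<close>, and every compact subset of \<open>U\<close> is contained in
  one of them.\<close>

definition exhaust :: "'a set \<Rightarrow> nat \<Rightarrow> 'a set" where
  "exhaust U k = (\<Union>i\<in>{i. i \<le> k \<and> X closure_of cbase i \<subseteq> U}. X closure_of cbase i)"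

lemma exhaust_compact: "compactin X (exhaust U k)"
  unfolding exhaust_def by (rule compactin_Union) (auto intro: cbase_compact)

lemma in_exhaust_iff:
  "x \<in> exhaust U k \<longleftrightarrow> (\<exists>i\<le>k. X closure_of cbase i \<subseteq> U \<and> x \<in> X closure_of cbase i)"
  unfolding exhaust_def by auto

lemma exhaust_mono: "mono (exhaust U)"
  by (rule monoI, rule subsetI, unfold in_exhaust_iff) (meson order_trans)

lemma exhaust_subset: "exhaust U k \<subseteq> U"
  by (auto simp: in_exhaust_iff)

lemma exhaust_Union:
  assumes "openin X U" shows "(\<Union>k. exhaust U k) = U"
proof -
  have "\<exists>k. x \<in> exhaust U k" if "x \<in> U" for x
    unfolding in_exhaust_iff using cbase_nhd[OF assms that] cbase_subset_closure by (metis order_refl subsetD)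
  then show ?thesis using exhaust_subset[of U] by (meson UN_I UNIV_I UN_least subsetI subset_antisym)
qed

lemma compact_subset_cbase:
  assumes "openin X U" "compactin X K" "K \<subseteq> U"
  obtains k where "K \<subseteq> (\<Union>i\<in>{i. i \<le> k \<and> X closure_of cbase i \<subseteq> U}. cbase i)"
proof -
  let ?\<U> = "cbase ` {i. X closure_of cbase i \<subseteq> U}"
  have "K \<subseteq> \<Union> ?\<U>" using cbase_nhd[OF assms(1)] assms(3) by blast
  then have "\<exists>\<F>. finite \<F> \<and> \<F> \<subseteq> ?\<U> \<and> K \<subseteq> \<Union>\<F>"
    using assms(2) cbase_open unfolding compactin_def by (metis (no_types, lifting) imageE)
  then obtain \<F> where \<F>: "finite \<F>" "\<F> \<subseteq> ?\<U>" "K \<subseteq> \<Union>\<F>" by blast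
  then obtain I where I: "finite I" "I \<subseteq> {i. X closure_of cbase i \<subseteq> U}" "K \<subseteq> \<Union> (cbase ` I)"
    using finite_subset_image[OF \<F>(1,2)] by metis
  then obtain k where "\<forall>i\<in>I. i \<le> k" using finite_nat_set_iff_bounded_le by auto
  with I show thesis by (intro that[of k]) fastforce
qed

lemma compact_subset_exhaust:
  assumes "openin X U" "compactin X K" "K \<subseteq> U"
  obtains k where "K \<subseteq> exhaust U k"
proof -
  obtain k where "K \<subseteq> (\<Union>i\<in>{i. i \<le> k \<and> X closure_of cbase i \<subseteq> U}. cbase i)"
    using compact_subset_cbase[OF assms] .
  also have "\<dots> \<subseteq> exhaust U k"
    unfolding exhaust_def using cbase_subset_closure by (rule UN_mono[OF subset_refl])
  finally show thesis using that by blast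
qed

lemma regular_borel_measure_sigma_finite:
  assumes "M \<in> regular_borel_measures X" shows "sigma_finite_measure M"
proof
  show "\<exists>A. countable A \<and> A \<subseteq> sets M \<and> \<Union>A = space M \<and> (\<forall>a\<in>A. emeasure M a \<noteq> \<infinity>)"
  proof (intro exI[of _ "range (exhaust (topspace X))"] conjI ballI)
    show "\<Union> (range (exhaust (topspace X))) = space M"
      by (simp add: exhaust_Union regular_borel_measures_space[OF assms])
    show "range (exhaust (topspace X)) \<subseteq> sets M"
      using assms exhaust_compact compactin_borel_of by (auto simp: regular_borel_measures_sets)
    show "emeasure M a \<noteq> \<infinity>" if "a \<in> range (exhaust (topspace X))" for a
      using that regular_borel_measures_compact[OF assms exhaust_compact] by (auto simp: less_top)
  qed simp
qed

lemma completely_regular: "completely_regular_space X"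
proof -
  have "regular_space X" using lc hd locally_compact_Hausdorff_imp_regular_space by blast
  then have "hereditarily normal_space X"
    using sc regular_second_countable_imp_hereditarily_normal_space by blast
  then have "normal_space X" unfolding hereditarily_def by (metis order_refl subtopology_topspace)
  then show ?thesis
    using hd normal_imp_completely_regular_space Hausdorff_imp_t1_space by blast
qed

text \<open>Finitely many basic sets with compact closure inside \<open>U\<close> cover the compact set \<open>K\<close>; a Urysohn
  function that vanishes off their union has its support in the union of the closures.\<close>

lemma Urysohn_Cc:
  assumes "compactin X K" "openin X U" "K \<subseteq> U"
  obtains f where "f \<in> Cc X" "\<And>x. x \<in> topspace X \<Longrightarrow> 0 \<le> f x \<and> f x \<le> 1"
    "\<And>x. x \<in> K \<Longrightarrow> f x = 1" "supp X f \<subseteq> U"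
proof -
  obtain k where k: "K \<subseteq> (\<Union>i\<in>{i. i \<le> k \<and> X closure_of cbase i \<subseteq> U}. cbase i)" (is "_ \<subseteq> ?W")
    using compact_subset_cbase[OF assms(2,1,3)] .
  have "openin X ?W" using cbase_open by blast
  then have "closedin X (topspace X - ?W)" by blast
  moreover have "disjnt K (topspace X - ?W)" using k by (auto simp: disjnt_def)
  ultimately obtain f where f: "continuous_map X (top_of_set {0..1::real}) f"
    "f ` (topspace X - ?W) \<subseteq> {0}" "f ` K \<subseteq> {1}"
    by (rule Urysohn_completely_regular_compact_closed[OF zero_le_one completely_regular assms(1)])
  have "{x \<in> topspace X. f x \<noteq> 0} \<subseteq> exhaust U k"
  proof
    fix x assume "x \<in> {x \<in> topspace X. f x \<noteq> 0}"
    then have x: "x \<in> topspace X" "f x \<noteq> 0" by auto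
    have "x \<in> ?W"
    proof (rule ccontr)
      assume "x \<notin> ?W"
      then have "f x \<in> f ` (topspace X - ?W)" using x(1) by (intro imageI) simp
      then have "f x \<in> {0}" by (rule subsetD[OF f(2)])
      with x(2) show False by simp
    qed
    then obtain i where "i \<le> k" "X closure_of cbase i \<subseteq> U" "x \<in> cbase i" by auto
    then show "x \<in> exhaust U k" unfolding in_exhaust_iff using cbase_subset_closure[of i] by blast
  qed
  then have "supp X f \<subseteq> exhaust U k"
    unfolding supp_def by (rule closure_of_minimal[OF _ compactin_imp_closedin[OF hd exhaust_compact]])
  moreover have "closedin X (supp X f)" by (simp add: supp_def)
  ultimately have "compactin X (supp X f)" "supp X f \<subseteq> U"
    using closed_compactin[OF exhaust_compact] exhaust_subset[of U k] by auto
  then show thesis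
    using f by (intro that[of f]) (auto simp: Cc_def continuous_map_in_subtopology Pi_iff)
qed

lemma Cc_measurable: "f \<in> Cc X \<Longrightarrow> f \<in> borel_measurable (borel_of X)"
  using continuous_map_borel_of_measurable[of X euclideanreal f]
  by (simp add: Cc_def borel_of_euclidean)

text \<open>A Urysohn function squeezed between the indicators of a compact set \<open>K \<subseteq> U\<close> and of \<open>U\<close> bounds the
  first measure of \<open>K\<close> by the second measure of \<open>U\<close>, and \<open>U\<close> is an increasing union of compact sets.\<close>

lemma open_le_if_Cc_le:
  assumes sets: "sets M = sets (borel_of X)" "sets N = sets (borel_of X)"
    and le: "\<And>f. f \<in> Cc X \<Longrightarrow> (\<And>x. x \<in> topspace X \<Longrightarrow> 0 \<le> f x) \<Longrightarrow> supp X f \<subseteq> U \<Longrightarrow>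
        (\<integral>\<^sup>+x. ennreal (f x) \<partial>M) \<le> (\<integral>\<^sup>+x. ennreal (f x) \<partial>N)"
    and U: "openin X U"
  shows "emeasure M U \<le> emeasure N U"
proof -
  have sp: "space M = topspace X" "space N = topspace X"
    using sets by (metis sets_eq_imp_space_eq space_borel_of)+
  have "emeasure M (exhaust U k) \<le> emeasure N U" for k
  proof -
    obtain f where f: "f \<in> Cc X" "\<And>x. x \<in> topspace X \<Longrightarrow> 0 \<le> f x \<and> f x \<le> 1"
      "\<And>x. x \<in> exhaust U k \<Longrightarrow> f x = 1" "supp X f \<subseteq> U"
      using Urysohn_Cc[OF exhaust_compact U exhaust_subset] by metis
    have s: "exhaust U k \<in> sets M" using sets exhaust_compact compactin_borel_of by blast
    have "emeasure M (exhaust U k) = (\<integral>\<^sup>+x. indicator (exhaust U k) x \<partial>M)" using s by simp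
    also have "\<dots> \<le> (\<integral>\<^sup>+x. ennreal (f x) \<partial>M)"
      using f by (intro nn_integral_mono) (auto simp: indicator_def)
    also have "\<dots> \<le> (\<integral>\<^sup>+x. ennreal (f x) \<partial>N)" using f by (intro le) auto
    also have "\<dots> \<le> (\<integral>\<^sup>+x. indicator U x \<partial>N)"
    proof (rule nn_integral_mono)
      fix x assume "x \<in> space N"
      then have x: "x \<in> topspace X" using sp by simp
      have "x \<in> U" if "f x \<noteq> 0"
        using that f(4) x closure_of_subset[of "{x \<in> topspace X. f x \<noteq> 0}" X]
        unfolding supp_def by auto
      then show "ennreal (f x) \<le> indicator U x"
        using f(2)[OF x] by (cases "f x = 0") auto
    qed
    also have "\<dots> = emeasure N U" using U sets openin_borel_of[of X U] by simp
    finally show ?thesis .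
  qed
  then have "(SUP k. emeasure M (exhaust U k)) \<le> emeasure N U" by (rule SUP_least)
  also have "(SUP k. emeasure M (exhaust U k)) = emeasure M (\<Union>k. exhaust U k)"
    using exhaust_mono exhaust_compact compactin_borel_of sets
    by (intro SUP_emeasure_incseq) auto
  finally show ?thesis using exhaust_Union[OF U] by simp
qed

lemma Int_stable_openin: "Int_stable {U. openin X U}"
  by (auto simp: Int_stable_def)

lemma regular_borel_measures_eqI_open:
  assumes M: "M \<in> regular_borel_measures X" and N: "N \<in> regular_borel_measures X"
    and eq: "\<And>U. openin X U \<Longrightarrow> emeasure M U = emeasure N U"
  shows "M = N"
proof (rule measure_eqI_generator_eq_countable[OF Int_stable_openin])
  show "{U. openin X U} \<subseteq> Pow (topspace X)" by (auto dest: openin_subset)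
  show "range cbase \<subseteq> {U. openin X U}" using cbase_open by auto
  show "\<Union> (range cbase) = topspace X"
  proof
    show "\<Union> (range cbase) \<subseteq> topspace X" using cbase_open openin_subset by (metis UN_least)
    show "topspace X \<subseteq> \<Union> (range cbase)" using cbase_nhd[OF openin_topspace] by blast
  qed
  show "emeasure M a \<noteq> \<infinity>" if "a \<in> range cbase" for a
  proof -
    obtain i where i: "a = cbase i" using \<open>a \<in> range cbase\<close> by blast
    then have "emeasure M a \<le> emeasure M (X closure_of cbase i)"
      using cbase_subset_closure[of i] cbase_compact[of i] compactin_borel_of M
      by (intro emeasure_mono) (auto simp: regular_borel_measures_sets)
    also have "\<dots> < \<infinity>" using regular_borel_measures_compact[OF M cbase_compact] .
    finally show ?thesis by simp
  qed
qed (use M N eq in \<open>auto simp: regular_borel_measures_sets sets_borel_of\<close>)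

lemma Cc_bounded:
  assumes "f \<in> Cc X"
  obtains B where "\<And>x. x \<in> topspace X \<Longrightarrow> \<bar>f x\<bar> \<le> B * indicator (supp X f) x"
proof -
  have "compact (f ` supp X f)"
    using assms image_compactin[of X "supp X f" euclideanreal f] by (auto simp: Cc_def)
  then obtain B where B: "\<And>x. x \<in> supp X f \<Longrightarrow> \<bar>f x\<bar> \<le> B"
    using compact_imp_bounded[of "f ` supp X f"] unfolding bounded_iff real_norm_def by blast
  have "f x = 0" if "x \<in> topspace X" "x \<notin> supp X f" for x
    using that closure_of_subset[of "{x \<in> topspace X. f x \<noteq> 0}" X] unfolding supp_def by auto
  then show thesis using B by (intro that[of B]) (auto simp: indicator_def)
qed

lemma Cc_integrable:
  assumes f: "f \<in> Cc X" and M: "M \<in> regular_borel_measures X"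
  shows "integrable M f"
proof -
  obtain B where B: "\<And>x. x \<in> topspace X \<Longrightarrow> \<bar>f x\<bar> \<le> B * indicator (supp X f) x"
    using Cc_bounded[OF f] by metis
  have cp: "compactin X (supp X f)" using f by (simp add: Cc_def)
  have "integrable M (\<lambda>x. B * indicator (supp X f) x :: real)"
    using cp compactin_borel_of regular_borel_measures_compact[OF M cp]
    by (auto simp: regular_borel_measures_sets[OF M])
  then show ?thesis
    by (rule Bochner_Integration.integrable_bound)
       (use Cc_measurable[OF f] B in \<open>auto simp: regular_borel_measures_sets[OF M]
          regular_borel_measures_space[OF M] measurable_cong_sets[OF regular_borel_measures_sets[OF M] refl]
          intro!: AE_I2 intro: order_trans[OF _ abs_ge_self]\<close>)
qed

lemma regular_borel_measures_eqI_Cc: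
  assumes M: "M \<in> regular_borel_measures X" and N: "N \<in> regular_borel_measures X"
    and eq: "\<And>f. f \<in> Cc X \<Longrightarrow> (\<integral>x. f x \<partial>M) = (\<integral>x. f x \<partial>N)"
  shows "M = N"
proof -
  have nn: "(\<integral>\<^sup>+x. ennreal (f x) \<partial>M) = (\<integral>\<^sup>+x. ennreal (f x) \<partial>N)"
    if "f \<in> Cc X" "\<And>x. x \<in> topspace X \<Longrightarrow> 0 \<le> f x" for f
    using that Cc_integrable[OF that(1)] M N eq[OF that(1)]
    by (subst (1 2) nn_integral_eq_integral) (auto simp: regular_borel_measures_space intro!: AE_I2)
  show ?thesis
    using M N nn
    by (intro regular_borel_measures_eqI_open[OF M N] antisym open_le_if_Cc_le)
       (auto simp: regular_borel_measures_sets)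
qed

text \<open>Urysohn functions for the pairs of basic sets with \<open>closure B\<^sub>i \<subseteq> B\<^sub>j\<close> separate the points.\<close>

lemma separating_sequence_exists:
  "\<exists>\<phi> :: 'a \<Rightarrow> nat \<Rightarrow> real. continuous_map X euclidean \<phi> \<and> inj_on \<phi> (topspace X)"
proof -
  have "\<exists>f. continuous_map X euclideanreal f \<and>
      (\<forall>x\<in>cbase i. f x = 1) \<and> (\<forall>x\<in>topspace X - cbase j. f x = 0)"
    if ij: "X closure_of cbase i \<subseteq> cbase j" for i j
  proof -
    obtain f where f: "f \<in> Cc X" "\<And>x. x \<in> X closure_of cbase i \<Longrightarrow> f x = 1" "supp X f \<subseteq> cbase j"
      using Urysohn_Cc[OF cbase_compact[of i] cbase_open[of j] ij] by metis
    have "f x = 0" if "x \<in> topspace X - cbase j" for x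
      using that f(3) closure_of_subset[of "{x \<in> topspace X. f x \<noteq> 0}" X] unfolding supp_def by auto
    then show ?thesis
      using f cbase_subset_closure[of i] by (intro exI[of _ f]) (auto simp: Cc_def)
  qed
  then obtain f where f: "\<And>i j. X closure_of cbase i \<subseteq> cbase j \<Longrightarrow>
      continuous_map X euclideanreal (f i j) \<and> (\<forall>x\<in>cbase i. f i j x = 1) \<and>
      (\<forall>x\<in>topspace X - cbase j. f i j x = 0)"
    by metis
  define g where "g i j = (if X closure_of cbase i \<subseteq> cbase j then f i j else (\<lambda>_. 0))" for i j
  define \<phi> where "\<phi> x n = g (fst (prod_decode n)) (snd (prod_decode n)) x" for x n
  have "continuous_map X euclideanreal (g i j)" for i j
    using f[of i j] by (auto simp: g_def)
  then have "continuous_map X (product_topology (\<lambda>_. euclideanreal) UNIV) \<phi>"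
    by (auto simp: continuous_map_componentwise_UNIV \<phi>_def)
  then have "continuous_map X euclidean \<phi>"
    by (simp only: euclidean_product_topology)
  moreover have "inj_on \<phi> (topspace X)"
  proof (rule inj_onI, rule ccontr)
    fix x y assume xy: "x \<in> topspace X" "y \<in> topspace X" "\<phi> x = \<phi> y" "x \<noteq> y"
    then obtain U where U: "openin X U" "x \<in> U" "y \<notin> U"
      using hd Hausdorff_space_def by (metis disjnt_iff)
    then obtain j where j: "x \<in> cbase j" "X closure_of cbase j \<subseteq> U" using cbase_nhd by blast
    then obtain i where i: "x \<in> cbase i" "X closure_of cbase i \<subseteq> cbase j"
      using cbase_nhd cbase_open by blast
    have "y \<notin> cbase j" using j U cbase_subset_closure[of j] by blast
    then have "\<phi> x (prod_encode (i, j)) = 1" "\<phi> y (prod_encode (i, j)) = 0"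
      using f[OF i(2)] i xy(1,2) by (auto simp: \<phi>_def g_def)
    with xy show False by simp
  qed
  ultimately show ?thesis by blast
qed

text \<open>This injection carries Borel measures to the Polish space \<^typ>\<open>nat \<Rightarrow> real\<close>, where finite measures
  are outer regular and Kolmogorov's theorem holds.\<close>

definition emb :: "'a \<Rightarrow> nat \<Rightarrow> real" where
  "emb = (SOME \<phi>. continuous_map X euclidean \<phi> \<and> inj_on \<phi> (topspace X))"

lemma emb_continuous: "continuous_map X euclidean emb" and emb_inj: "inj_on emb (topspace X)"
  using someI_ex[OF separating_sequence_exists, folded emb_def] by auto

lemma emb_measurable [measurable]: "emb \<in> borel_measurable (borel_of X)"
  using continuous_map_borel_of_measurable[OF emb_continuous] by (simp add: borel_of_euclidean)

text \<open>The space is \<open>\<sigma>\<close>-compact, so a closed set is a countable union of compact sets, and so is its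
  continuous image. Injectivity lets complements pass through the image.\<close>

lemma emb_image_borel:
  assumes "A \<in> sets (borel_of X)" shows "emb ` A \<in> sets borel"
proof -
  have cl: "emb ` C \<in> sets borel" if C: "closedin X C" for C
  proof -
    have "C = (\<Union>k. exhaust (topspace X) k \<inter> C)"
      using exhaust_Union[OF openin_topspace] closedin_subset[OF C] by blast
    then have "emb ` C = (\<Union>k. emb ` (exhaust (topspace X) k \<inter> C))" by (metis image_UN)
    moreover have "compact (emb ` (exhaust (topspace X) k \<inter> C))" for k
      using image_compactin[OF compact_Int_closedin[OF exhaust_compact C] emb_continuous] by simp
    ultimately show ?thesis by (metis (no_types, lifting) borel_compact sets.countable_UN image_subsetI)
  qed
  have "A \<in> sigma_sets (topspace X) {U. openin X U}" using assms by (simp add: sets_borel_of)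
  then show ?thesis
  proof induction
    case (Basic U)
    then have "emb ` (topspace X - U) \<in> sets borel" by (intro cl) auto
    moreover have "emb ` U = emb ` topspace X - emb ` (topspace X - U)"
      using emb_inj Basic openin_subset[of X U] by (auto simp: inj_on_def)
    ultimately show ?case using cl[OF closedin_topspace] by auto
  next
    case (Compl A)
    then have "A \<subseteq> topspace X"
      by (metis sets.sets_into_space sets_borel_of space_borel_of)
    then have "emb ` (topspace X - A) = emb ` topspace X - emb ` A"
      using emb_inj by (auto simp: inj_on_def)
    then show ?case using cl[OF closedin_topspace] Compl by auto
  next
    case (Union A)
    then show ?case by (auto simp: image_UN)
  qed auto
qed

text \<open>An inequality between measures does not pass from open sets to Borel sets by a Dynkin argument;
  it does by outer regularity of the larger measure. That measure is transported by \<^term>\<open>emb\<close>, on an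
  open set of finite measure, to a finite measure on a Polish space.\<close>

lemma borel_le_if_open_le:
  assumes sets: "sets M = sets (borel_of X)" and N: "N \<in> regular_borel_measures X"
    and le: "\<And>U. openin X U \<Longrightarrow> emeasure M U \<le> emeasure N U"
    and B: "B \<in> sets (borel_of X)"
  shows "emeasure M B \<le> emeasure N B"
proof -
  have sN: "sets N = sets (borel_of X)" using N by (simp add: regular_borel_measures_sets)
  have *: "emeasure M C \<le> emeasure N C" if C: "C \<in> sets (borel_of X)" "C \<subseteq> O'" and
    O': "openin X O'" "emeasure N O' < \<infinity>" for C O'
  proof -
    have O'b: "O' \<in> sets N" using O' openin_borel_of sN by blast
    have sp: "space (restrict_space N O') = O'"
      using O'b by (simp add: space_restrict_space sets.Int_space_eq2)
    have [measurable]: "emb \<in> borel_measurable (restrict_space N O')"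
      using emb_measurable sN by (simp add: measurable_restrict_space1 measurable_cong_sets[OF sN refl])
    define D where "D = distr (restrict_space N O') borel emb"
    have D: "emeasure D A = emeasure N (emb -` A \<inter> O')" if "A \<in> sets borel" for A
      unfolding D_def using that O'b sp
      by (subst emeasure_distr) (auto simp: emeasure_restrict_space sets.Int_space_eq2)
    have Cb: "emb ` C \<in> sets borel" using emb_image_borel C by blast
    have "emeasure M C \<le> emeasure D U" if U: "emb ` C \<subseteq> U" "open U" for U
    proof -
      have op: "openin X ({x \<in> topspace X. emb x \<in> U} \<inter> O')"
        using emb_continuous U(2) O'(1) unfolding continuous_map_def by (auto intro: openin_Int)
      have eq: "{x \<in> topspace X. emb x \<in> U} \<inter> O' = emb -` U \<inter> O'"
        using openin_subset[OF O'(1)] by auto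
      have "emeasure M C \<le> emeasure M (emb -` U \<inter> O')"
        using op U C openin_borel_of[OF op] by (intro emeasure_mono) (auto simp: eq sets)
      also have "\<dots> \<le> emeasure N (emb -` U \<inter> O')" using le[OF op] by (simp add: eq)
      finally show ?thesis using U by (simp add: D)
    qed
    moreover have "emeasure D (emb ` C) = (INF U\<in>{U. emb ` C \<subseteq> U \<and> open U}. emeasure D U)"
    proof (rule outer_regular)
      show "sets D = sets borel" by (simp add: D_def)
      show "emeasure D (space D) \<noteq> \<infinity>"
        using O'(2) D[of UNIV] by (simp add: D_def less_top)
    qed (rule Cb)
    ultimately have "emeasure M C \<le> emeasure D (emb ` C)" by (auto intro: INF_greatest)
    also have "emb -` (emb ` C) \<inter> O' = C"
      using C(2) openin_subset[OF O'(1)] emb_inj unfolding inj_on_def by blast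
    then have "emeasure D (emb ` C) = emeasure N C" using Cb by (simp add: D)
    finally show ?thesis .
  qed
  define W where "W k = (\<Union>i\<le>k. cbase i)" for k
  have W: "openin X (W k)" for k unfolding W_def using cbase_open by blast
  have fin: "emeasure N (W k) < \<infinity>" for k
  proof -
    have cp: "compactin X (\<Union>i\<le>k. X closure_of cbase i)"
      by (rule compactin_Union) (auto intro: cbase_compact)
    have "emeasure N (W k) \<le> emeasure N (\<Union>i\<le>k. X closure_of cbase i)"
      using compactin_borel_of[OF cp] cbase_subset_closure sN unfolding W_def
      by (intro emeasure_mono UN_mono) simp_all
    also have "\<dots> < \<infinity>" using regular_borel_measures_compact[OF N cp] .
    finally show ?thesis .
  qed
  have BU: "(\<Union>k. B \<inter> W k) = B"
  proof -
    have "x \<in> (\<Union>k. W k)" if "x \<in> B" for x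
      using sets.sets_into_space[OF B] that cbase_nhd[OF openin_topspace, of x] by (auto simp: W_def)
    then show ?thesis by blast
  qed
  have BW: "B \<inter> W k \<in> sets (borel_of X)" for k using B W openin_borel_of by blast
  have inc: "incseq (\<lambda>k. B \<inter> W k)" by (rule monoI) (force simp: W_def)
  have "emeasure M B = (SUP k. emeasure M (B \<inter> W k))"
    using SUP_emeasure_incseq[of "\<lambda>k. B \<inter> W k" M] BW inc by (simp only: BU sets image_subset_iff) simp
  also have "\<dots> \<le> (SUP k. emeasure N (B \<inter> W k))"
    using *[OF BW _ W fin] by (intro SUP_mono) auto
  also have "\<dots> = emeasure N B"
    using SUP_emeasure_incseq[of "\<lambda>k. B \<inter> W k" N] BW inc by (simp only: BU sN image_subset_iff) simp
  finally show ?thesis .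
qed

end

section \<open>Sums of sequences of measures\<close>

definition msum :: "(nat \<Rightarrow> 'a measure) \<Rightarrow> 'a measure" where
  "msum M = measure_of (space (M 0)) (sets (M 0)) (\<lambda>A. \<Sum>i. emeasure (M i) A)"

lemma sets_msum [simp]: "sets (msum M) = sets (M 0)"
  by (simp add: msum_def)

lemma space_msum [simp]: "space (msum M) = space (M 0)"
  by (simp add: msum_def)

lemma ennreal_suminf_swap: "(\<Sum>i. \<Sum>j. f i j) = (\<Sum>j. \<Sum>i. f i j :: ennreal)"
proof -
  have "(\<Sum>i. \<Sum>j. f i j) = (\<integral>\<^sup>+i. (\<Sum>j. f i j) \<partial>count_space UNIV)"
    by (simp add: nn_integral_count_space_nat)
  also have "\<dots> = (\<Sum>j. \<integral>\<^sup>+i. f i j \<partial>count_space UNIV)"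
    by (rule nn_integral_suminf) simp
  finally show ?thesis by (simp add: nn_integral_count_space_nat)
qed

lemma emeasure_msum:
  assumes sets: "\<And>i. sets (M i) = sets (M 0)" and A: "A \<in> sets (M 0)"
  shows "emeasure (msum M) A = (\<Sum>i. emeasure (M i) A)"
proof -
  have "countably_additive (sets (M 0)) (\<lambda>A. \<Sum>i. emeasure (M i) A)"
  proof (rule countably_additiveI)
    fix B :: "nat \<Rightarrow> 'a set"
    assume B: "range B \<subseteq> sets (M 0)" "disjoint_family B" "\<Union> (range B) \<in> sets (M 0)"
    have "(\<Sum>n. \<Sum>i. emeasure (M i) (B n)) = (\<Sum>i. \<Sum>n. emeasure (M i) (B n))"
      by (rule ennreal_suminf_swap)
    also have "\<dots> = (\<Sum>i. emeasure (M i) (\<Union> (range B)))"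
      using B sets by (intro suminf_cong suminf_emeasure) auto
    finally show "(\<Sum>n. \<Sum>i. emeasure (M i) (B n)) = (\<Sum>i. emeasure (M i) (\<Union> (range B)))" .
  qed
  moreover have "positive (sets (M 0)) (\<lambda>A. \<Sum>i. emeasure (M i) A)"
    by (simp add: positive_def)
  ultimately show ?thesis
    using A unfolding msum_def by (intro emeasure_measure_of_sigma sets.sigma_algebra_axioms)
qed

section \<open>Pulling back measures along local homeomorphisms\<close>

locale local_homeo = X: lch_space X + Y: lch_space Y
  for X :: "'e topology" and Y :: "'v topology" +
  fixes s :: "'e \<Rightarrow> 'v"
  assumes local_homeo: "local_homeomorphism X Y s"
begin

text \<open>Openness of the images of all open subsets, not just of the whole set, makes this property pass to
  smaller open sets.\<close>

definition chart :: "'e set \<Rightarrow> bool" where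
  "chart U \<longleftrightarrow> openin X U \<and> inj_on s U \<and> (\<forall>O'. openin X O' \<longrightarrow> O' \<subseteq> U \<longrightarrow> openin Y (s ` O'))"

lemma chart_exists:
  assumes "x \<in> topspace X" obtains U where "chart U" "x \<in> U"
proof -
  obtain U where U: "openin X U" "x \<in> U" "openin Y (s ` U)"
    "homeomorphic_map (subtopology X U) (subtopology Y (s ` U)) s"
    using local_homeo assms unfolding local_homeomorphism_def by metis
  have "inj_on s U"
    using homeomorphic_imp_injective_map[OF U(4)] openin_subset[OF U(1)]
    by (simp add: inf_absorb2)
  moreover have "openin Y (s ` O')" if "openin X O'" "O' \<subseteq> U" for O'
  proof -
    have "openin (subtopology X U) O'" using that by (simp add: openin_subset_topspace_eq openin_open_subtopology U)
    then have "openin (subtopology Y (s ` U)) (s ` O')"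
      using homeomorphic_imp_open_map[OF U(4)] by (simp add: open_map_def)
    then show ?thesis using U(3) openin_trans_full by blast
  qed
  ultimately show thesis using U that[of U] by (auto simp: chart_def)
qed

lemma s_in: "x \<in> topspace X \<Longrightarrow> s x \<in> topspace Y"
  using local_homeo by (auto simp: local_homeomorphism_def)

lemma s_continuous: "continuous_map X Y s"
proof -
  have nhd: "\<exists>U. openin X U \<and> x \<in> U \<and> (\<forall>y\<in>U. s y \<in> W)"
    if x: "x \<in> topspace X" and W: "openin Y W" "s x \<in> W" for x W
  proof -
    obtain U where U: "openin X U" "x \<in> U" "openin Y (s ` U)"
      "homeomorphic_map (subtopology X U) (subtopology Y (s ` U)) s"
      using local_homeo x unfolding local_homeomorphism_def by metis
    have "continuous_map (subtopology X U) Y s"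
      using homeomorphic_imp_continuous_map[OF U(4)] continuous_map_into_fulltopology by blast
    then have "openin (subtopology X U) {y \<in> topspace (subtopology X U). s y \<in> W}"
      using W(1) unfolding continuous_map_def by blast
    then have "openin X {y \<in> topspace (subtopology X U). s y \<in> W}"
      using U(1) openin_trans_full by blast
    then show ?thesis using U(2) W x by (intro exI[of _ "{y \<in> topspace (subtopology X U). s y \<in> W}"]) auto
  qed
  have "openin X {x \<in> topspace X. s x \<in> W}" if W: "openin Y W" for W
  proof (subst openin_subopen, intro ballI)
    fix x assume "x \<in> {x \<in> topspace X. s x \<in> W}"
    then obtain U where "openin X U" "x \<in> U" "\<forall>y\<in>U. s y \<in> W"
      using nhd[of x W] W by auto
    then show "\<exists>T. openin X T \<and> x \<in> T \<and> T \<subseteq> {x \<in> topspace X. s x \<in> W}"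
      using openin_subset by (intro exI[of _ U]) auto
  qed
  then show ?thesis using s_in by (auto simp: continuous_map_def)
qed

definition chart_seq :: "nat \<Rightarrow> 'e set" where
  "chart_seq i = (if \<exists>U. chart U \<and> X closure_of X.cbase i \<subseteq> U then X.cbase i else {})"

text \<open>Disjoint Borel sets that cover the space and on each of which \<open>s\<close> is a Borel isomorphism onto its
  image. They reduce every statement about \<open>s\<close> to a countable sum of statements about injective
  maps.\<close>

definition piece :: "nat \<Rightarrow> 'e set" where
  "piece = disjointed chart_seq"

lemma chart_seq_open: "openin X (chart_seq i)"
  using X.cbase_open by (simp add: chart_seq_def)

lemma piece_measurable [measurable]: "piece i \<in> sets (borel_of X)"
  using sets.range_disjointed_sets[of chart_seq "borel_of X"] chart_seq_open openin_borel_of[of X]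
  by (auto simp: piece_def)

lemma piece_disjoint: "disjoint_family piece"
  by (simp add: piece_def disjoint_family_disjointed)

lemma piece_unique: "x \<in> piece i \<Longrightarrow> x \<in> piece j \<Longrightarrow> i = j"
  using piece_disjoint by (auto simp: disjoint_family_on_def)

lemma chart_seq_cover: "(\<Union>i. chart_seq i) = topspace X"
proof
  show "(\<Union>i. chart_seq i) \<subseteq> topspace X" using openin_subset[OF chart_seq_open] by blast
  show "topspace X \<subseteq> (\<Union>i. chart_seq i)"
  proof
    fix x assume "x \<in> topspace X"
    then obtain U where U: "chart U" "x \<in> U" by (rule chart_exists)
    then obtain i where "x \<in> X.cbase i" "X closure_of X.cbase i \<subseteq> U"
      using X.cbase_nhd[of U x] by (auto simp: chart_def)
    then have "x \<in> chart_seq i" using U by (auto simp: chart_seq_def)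
    then show "x \<in> (\<Union>i. chart_seq i)" by blast
  qed
qed

lemma piece_cover: "(\<Union>i. piece i) = topspace X"
  using chart_seq_cover by (simp add: piece_def UN_disjointed_eq)

lemma piece_in: "x \<in> piece i \<Longrightarrow> x \<in> topspace X"
  using piece_cover by blast

lemma inj_on_piece: "inj_on s (piece i)"
proof -
  have "inj_on s (chart_seq i)"
    using X.cbase_subset_closure[of i] by (auto simp: chart_seq_def chart_def intro: inj_on_subset)
  then show ?thesis
    using disjointed_subset[of chart_seq i] by (auto simp: piece_def intro: inj_on_subset)
qed

text \<open>Injectivity makes images commute with complements, so that the sets with Borel image form a
  \<open>\<sigma>\<close>-algebra, which contains the open sets.\<close>

lemma image_chart_seq_measurable:
  assumes "A \<in> sets (borel_of X)" shows "s ` (A \<inter> chart_seq i) \<in> sets (borel_of Y)"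
proof -
  have inj: "inj_on s (chart_seq i)"
    using X.cbase_subset_closure[of i] by (auto simp: chart_seq_def chart_def intro: inj_on_subset)
  have op: "openin Y (s ` O')" if "openin X O'" "O' \<subseteq> chart_seq i" for O'
    using that X.cbase_subset_closure[of i] unfolding chart_seq_def chart_def
    by (smt (verit, ccfv_SIG) dual_order.trans image_empty openin_empty subset_empty)
  have "A \<in> sigma_sets (topspace X) {U. openin X U}" using assms by (simp add: sets_borel_of)
  then show ?thesis
  proof induction
    case (Basic U)
    then have "openin Y (s ` (U \<inter> chart_seq i))" using chart_seq_open by (intro op) auto
    then show ?case by (rule openin_borel_of)
  next
    case (Compl A)
    have "s ` ((topspace X - A) \<inter> chart_seq i) = s ` chart_seq i - s ` (A \<inter> chart_seq i)"
      using inj openin_subset[OF chart_seq_open[of i]] unfolding inj_on_def by blast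
    moreover have "s ` chart_seq i \<in> sets (borel_of Y)"
      using op[OF chart_seq_open] by (intro openin_borel_of) auto
    ultimately show ?case using Compl by auto
  next
    case (Union A)
    have "s ` ((\<Union>n. A n) \<inter> chart_seq i) = (\<Union>n. s ` (A n \<inter> chart_seq i))" by auto
    then show ?case using Union by auto
  qed auto
qed

lemma image_piece_measurable:
  assumes "A \<in> sets (borel_of X)" shows "s ` (A \<inter> piece i) \<in> sets (borel_of Y)"
proof -
  have "A \<inter> piece i = (A \<inter> piece i) \<inter> chart_seq i"
    using disjointed_subset[of chart_seq i] by (auto simp: piece_def)
  then show ?thesis
    using image_chart_seq_measurable[of "A \<inter> piece i" i] assms by (simp add: sets.Int)
qed

lemma s_piece_measurable [measurable]: "s ` piece i \<in> sets (borel_of Y)"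
  using image_piece_measurable[OF piece_measurable, of i i] by simp

text \<open>The inverse branch of \<open>s\<close> with values in the \<open>i\<close>-th piece.\<close>

definition branch :: "nat \<Rightarrow> 'v \<Rightarrow> 'e" where
  "branch i = inv_into (piece i) s"

lemma branch_in: "v \<in> s ` piece i \<Longrightarrow> branch i v \<in> piece i"
  and s_branch: "v \<in> s ` piece i \<Longrightarrow> s (branch i v) = v"
  and branch_s: "e \<in> piece i \<Longrightarrow> branch i (s e) = e"
  using inj_on_piece by (auto simp: branch_def inv_into_into f_inv_into_f)

lemma branch_vimage: "{v \<in> s ` piece i. branch i v \<in> A} = s ` (A \<inter> piece i)"
proof safe
  fix e assume "e \<in> piece i" "branch i (s e) \<in> A"
  then show "s e \<in> s ` (A \<inter> piece i)" by (simp add: branch_s)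
qed (auto simp: branch_s)

lemma branch_measurable:
  "sets M = sets (borel_of Y) \<Longrightarrow> branch i \<in> restrict_space M (s ` piece i) \<rightarrow>\<^sub>M borel_of X"
proof (rule measurableI)
  assume M: "sets M = sets (borel_of Y)"
  have sp: "space (restrict_space M (s ` piece i)) = s ` piece i"
    using M s_piece_measurable[of i] sets.sets_into_space by (fastforce simp: space_restrict_space)
  show "branch i v \<in> space (borel_of X)" if "v \<in> space (restrict_space M (s ` piece i))" for v
    using that branch_in piece_in unfolding sp by auto
  show "branch i -` A \<inter> space (restrict_space M (s ` piece i)) \<in> sets (restrict_space M (s ` piece i))"
    if "A \<in> sets (borel_of X)" for A
  proof -
    have "branch i -` A \<inter> space (restrict_space M (s ` piece i)) = s ` (A \<inter> piece i)"
      unfolding sp using branch_vimage[of i A] by auto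
    moreover have "s ` piece i \<inter> space M \<in> sets M" using M s_piece_measurable[of i] by (simp add: sets.Int)
    ultimately show ?thesis
      using M image_piece_measurable[OF that] by (auto simp: sets_restrict_space_iff)
  qed
qed

text \<open>Its mass on a subset of one piece is the measure of the image under \<open>s\<close>; in terms of functions
  this is integration of the sums over the fibres of \<open>s\<close> (\<open>integral_pullback\<close>).\<close>

definition pullback :: "'v measure \<Rightarrow> 'e measure" where
  "pullback \<mu> = msum (\<lambda>i. distr (restrict_space \<mu> (s ` piece i)) (borel_of X) (branch i))"

lemma sets_pullback [simp]: "sets (pullback \<mu>) = sets (borel_of X)"
  and space_pullback [simp]: "space (pullback \<mu>) = topspace X"
  by (simp_all add: pullback_def)

lemma emeasure_pullback:
  assumes \<mu>: "sets \<mu> = sets (borel_of Y)" and A: "A \<in> sets (borel_of X)"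
  shows "emeasure (pullback \<mu>) A = (\<Sum>i. emeasure \<mu> (s ` (A \<inter> piece i)))"
proof -
  have "emeasure (distr (restrict_space \<mu> (s ` piece i)) (borel_of X) (branch i)) A =
      emeasure \<mu> (s ` (A \<inter> piece i))" for i
  proof -
    have sm: "s ` piece i \<inter> space \<mu> \<in> sets \<mu>" using \<mu> s_piece_measurable[of i] by (simp add: sets.Int)
    have sp: "space (restrict_space \<mu> (s ` piece i)) = s ` piece i"
      using \<mu> s_piece_measurable[of i] sets.sets_into_space by (fastforce simp: space_restrict_space)
    have "branch i -` A \<inter> s ` piece i = s ` (A \<inter> piece i)" using branch_vimage[of i A] by auto
    then show ?thesis
      using A by (subst emeasure_distr[OF branch_measurable[OF \<mu>] A], unfold sp)
        (auto intro!: emeasure_restrict_space[OF sm])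
  qed
  then show ?thesis using A unfolding pullback_def by (subst emeasure_msum) auto
qed

lemma emeasure_pullback_subset_piece:
  assumes \<mu>: "sets \<mu> = sets (borel_of Y)" and A: "A \<in> sets (borel_of X)" "A \<subseteq> piece i"
  shows "emeasure (pullback \<mu>) A = emeasure \<mu> (s ` A)"
proof -
  have "emeasure \<mu> (s ` (A \<inter> piece j)) = (if j = i then emeasure \<mu> (s ` A) else 0)" for j
  proof -
    have "A \<inter> piece j = (if j = i then A else {})" using A(2) piece_unique by auto
    then show ?thesis by simp
  qed
  then have "emeasure (pullback \<mu>) A = (\<Sum>j. if j = i then emeasure \<mu> (s ` A) else 0)"
    by (simp only: emeasure_pullback[OF \<mu> A(1)])
  also have "\<dots> = emeasure \<mu> (s ` A)"
    using suminf_finite[of "{i}" "\<lambda>j. if j = i then emeasure \<mu> (s ` A) else 0"] by simp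
  finally show ?thesis .
qed

lemma compact_subset_pieces:
  assumes "compactin X K" obtains k where "K \<subseteq> (\<Union>i\<le>k. piece i)"
proof -
  have "K \<subseteq> \<Union> (range chart_seq)" using chart_seq_cover compactin_subset_topspace[OF assms] by simp
  moreover have "\<forall>U\<in>range chart_seq. openin X U" using chart_seq_open by auto
  ultimately obtain \<F> where \<F>: "finite \<F>" "\<F> \<subseteq> range chart_seq" "K \<subseteq> \<Union>\<F>"
    using assms unfolding compactin_def by metis
  then obtain I where I: "finite I" "K \<subseteq> \<Union> (chart_seq ` I)"
    using finite_subset_image[OF \<F>(1,2)] by metis
  then obtain k where k: "\<forall>i\<in>I. i \<le> k" using finite_nat_set_iff_bounded_le by auto
  have "K \<subseteq> (\<Union>i\<in>{0..<Suc k}. chart_seq i)" using I k by fastforce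
  also have "\<dots> = (\<Union>i\<in>{0..<Suc k}. piece i)" by (simp add: piece_def finite_UN_disjointed_eq)
  also have "\<dots> = (\<Union>i\<le>k. piece i)" by (simp add: atLeast0LessThan lessThan_Suc_atMost)
  finally show thesis using that by blast
qed

lemma pullback_regular:
  assumes \<mu>: "\<mu> \<in> regular_borel_measures Y" shows "pullback \<mu> \<in> regular_borel_measures X"
proof -
  note s\<mu> = regular_borel_measures_sets[OF \<mu>]
  have fin: "emeasure (pullback \<mu>) (K \<inter> piece i) < \<infinity>" if K: "compactin X K" for K i
  proof -
    have "emeasure (pullback \<mu>) (K \<inter> piece i) = emeasure \<mu> (s ` (K \<inter> piece i))"
      using X.compactin_borel_of[OF K] by (intro emeasure_pullback_subset_piece[OF s\<mu>]) auto
    also have "\<dots> \<le> emeasure \<mu> (s ` K)"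
      using Y.compactin_borel_of[OF image_compactin[OF K s_continuous]] s\<mu> by (intro emeasure_mono) auto
    also have "\<dots> < \<infinity>"
      using regular_borel_measures_compact[OF \<mu> image_compactin[OF K s_continuous]] .
    finally show ?thesis .
  qed
  have "emeasure (pullback \<mu>) K < \<infinity>" if K: "compactin X K" for K
  proof -
    obtain k where k: "K \<subseteq> (\<Union>i\<le>k. piece i)" using compact_subset_pieces[OF K] .
    have "emeasure (pullback \<mu>) K \<le> emeasure (pullback \<mu>) (\<Union>i\<le>k. K \<inter> piece i)"
      using k X.compactin_borel_of[OF K] by (intro emeasure_mono) auto
    also have "\<dots> \<le> (\<Sum>i\<le>k. emeasure (pullback \<mu>) (K \<inter> piece i))"
      using X.compactin_borel_of[OF K] by (intro emeasure_subadditive_finite) auto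
    also have "\<dots> < \<infinity>" using fin[OF K] by (simp add: less_top[symmetric])
    finally show ?thesis .
  qed
  then show ?thesis by (simp add: regular_borel_measures_def)
qed

lemma restrict_pullback:
  assumes \<mu>: "sets \<mu> = sets (borel_of Y)"
  shows "distr (restrict_space \<mu> (s ` piece i)) (restrict_space (borel_of X) (piece i)) (branch i) =
    restrict_space (pullback \<mu>) (piece i)"
proof -
  have sm: "s ` piece i \<inter> space \<mu> \<in> sets \<mu>" using \<mu> s_piece_measurable[of i] by (simp add: sets.Int)
  have sp: "space (restrict_space \<mu> (s ` piece i)) = s ` piece i"
    using \<mu> s_piece_measurable[of i] sets.sets_into_space by (fastforce simp: space_restrict_space)
  have pm: "piece i \<inter> topspace X \<in> sets (borel_of X)" by (metis piece_measurable sets.Int_space_eq2 space_borel_of)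
  have m: "branch i \<in> restrict_space \<mu> (s ` piece i) \<rightarrow>\<^sub>M restrict_space (borel_of X) (piece i)"
    using branch_measurable[OF \<mu>] branch_in sp by (intro measurable_restrict_space2) auto
  show ?thesis
  proof (rule measure_eqI)
    show "sets (distr (restrict_space \<mu> (s ` piece i)) (restrict_space (borel_of X) (piece i)) (branch i)) =
      sets (restrict_space (pullback \<mu>) (piece i))"
      by (simp only: sets_distr) (rule restrict_space_sets_cong[OF refl], simp)
    fix A assume "A \<in> sets (distr (restrict_space \<mu> (s ` piece i)) (restrict_space (borel_of X) (piece i)) (branch i))"
    then have A': "A \<in> sets (restrict_space (borel_of X) (piece i))" by simp
    then have A: "A \<in> sets (borel_of X)" "A \<subseteq> piece i" using pm by (auto simp: sets_restrict_space_iff)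
    have "branch i -` A \<inter> s ` piece i = s ` A" using branch_vimage[of i A] A(2) by (auto simp: inf_absorb1)
    then have "emeasure (distr (restrict_space \<mu> (s ` piece i)) (restrict_space (borel_of X) (piece i)) (branch i)) A =
        emeasure \<mu> (s ` A)"
      using A by (subst emeasure_distr[OF m A'], unfold sp) (auto intro!: emeasure_restrict_space[OF sm])
    also have "\<dots> = emeasure (restrict_space (pullback \<mu>) (piece i)) A"
      using A pm by (simp add: emeasure_restrict_space emeasure_pullback_subset_piece[OF \<mu>])
    finally show "emeasure (distr (restrict_space \<mu> (s ` piece i)) (restrict_space (borel_of X) (piece i)) (branch i)) A =
      emeasure (restrict_space (pullback \<mu>) (piece i)) A" .
  qed
qed

text \<open>A compact support meets only finitely many pieces, so the sum over a fibre is a sum over finitely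
  many branches, each of which transforms the integral over one piece.\<close>

lemma integral_pullback:
  assumes \<mu>: "\<mu> \<in> regular_borel_measures Y" and h: "h \<in> Cc X"
  shows "(\<integral>e. h e \<partial>pullback \<mu>) = (\<integral>v. (\<Sum>\<^sub>\<infinity>e\<in>{e \<in> topspace X. s e = v}. h e) \<partial>\<mu>)"
proof -
  note s\<mu> = regular_borel_measures_sets[OF \<mu>]
  have sp\<mu>: "space \<mu> = topspace Y" using \<mu> by (rule regular_borel_measures_space)
  obtain k where k: "supp X h \<subseteq> (\<Union>i\<le>k. piece i)"
    using compact_subset_pieces h by (auto simp: Cc_def)
  have h0: "h x = 0" if "x \<in> topspace X" "x \<notin> (\<Union>i\<le>k. piece i)" for x
    using that k closure_of_subset[of "{x \<in> topspace X. h x \<noteq> 0}" X] unfolding supp_def by auto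
  have hm: "h \<in> borel_measurable (borel_of X)" using h by (rule X.Cc_measurable)
  have hi: "integrable (pullback \<mu>) h" using X.Cc_integrable[OF h pullback_regular[OF \<mu>]] .
  have pm: "piece i \<inter> space (pullback \<mu>) \<in> sets (pullback \<mu>)" for i
    by (metis piece_measurable sets.Int_space_eq2 space_borel_of space_pullback sets_pullback)
  have sm: "s ` piece i \<inter> space \<mu> \<in> sets \<mu>" for i using s\<mu> s_piece_measurable[of i] by (simp add: sets.Int)
  have part: "integrable \<mu> (\<lambda>v. indicator (s ` piece i) v *\<^sub>R h (branch i v)) \<and>
      (\<integral>v. indicator (s ` piece i) v *\<^sub>R h (branch i v) \<partial>\<mu>) =
      (\<integral>e. indicator (piece i) e *\<^sub>R h e \<partial>pullback \<mu>)" for i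
  proof -
    have m: "branch i \<in> restrict_space \<mu> (s ` piece i) \<rightarrow>\<^sub>M restrict_space (borel_of X) (piece i)"
      using branch_measurable[OF s\<mu>] branch_in s\<mu> s_piece_measurable[of i] sets.sets_into_space
      by (intro measurable_restrict_space2) (auto simp: space_restrict_space)
    have hm': "h \<in> borel_measurable (restrict_space (borel_of X) (piece i))"
      using hm by (rule measurable_restrict_space1)
    have "integrable (pullback \<mu>) (\<lambda>e. indicator (piece i) e *\<^sub>R h e)"
      using hi by (intro integrable_mult_indicator) auto
    then have "integrable (restrict_space (pullback \<mu>) (piece i)) h"
      using integrable_restrict_space[OF pm] by blast
    then have "integrable (restrict_space \<mu> (s ` piece i)) (\<lambda>v. h (branch i v))"
      unfolding restrict_pullback[OF s\<mu>, symmetric] using integrable_distr_eq[OF m hm'] by blast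
    then have 1: "integrable \<mu> (\<lambda>v. indicator (s ` piece i) v *\<^sub>R h (branch i v))"
      by (rule integrable_restrict_space[OF sm, THEN iffD1])
    have "(\<integral>e. indicator (piece i) e *\<^sub>R h e \<partial>pullback \<mu>) = (\<integral>e. h e \<partial>restrict_space (pullback \<mu>) (piece i))"
      by (rule integral_restrict_space[OF pm, symmetric])
    also have "\<dots> = (\<integral>v. h (branch i v) \<partial>restrict_space \<mu> (s ` piece i))"
      unfolding restrict_pullback[OF s\<mu>, symmetric] by (rule integral_distr[OF m hm'])
    also have "\<dots> = (\<integral>v. indicator (s ` piece i) v *\<^sub>R h (branch i v) \<partial>\<mu>)"
      by (rule integral_restrict_space[OF sm])
    finally show ?thesis using 1 by simp
  qed
  have fib: "(\<Sum>\<^sub>\<infinity>e\<in>{e \<in> topspace X. s e = v}. h e) =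
      (\<Sum>i\<le>k. indicator (s ` piece i) v *\<^sub>R h (branch i v))" for v
  proof -
    let ?I = "{i. i \<le> k \<and> v \<in> s ` piece i}"
    have "(\<Sum>\<^sub>\<infinity>e\<in>{e \<in> topspace X. s e = v}. h e) = infsum h ((\<lambda>i. branch i v) ` ?I)"
    proof (rule infsum_cong_neutral)
      fix e assume e: "e \<in> {e \<in> topspace X. s e = v} - (\<lambda>i. branch i v) ` ?I"
      have "e \<notin> (\<Union>i\<le>k. piece i)"
      proof
        assume "e \<in> (\<Union>i\<le>k. piece i)"
        then obtain i where "i \<le> k" "e \<in> piece i" by auto
        then have "e \<in> (\<lambda>i. branch i v) ` ?I" using e branch_s[of e i] by (intro image_eqI[of _ _ i]) force+
        with e show False by simp
      qed
      then show "h e = 0" using h0 e by auto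
    next
      fix e assume "e \<in> (\<lambda>i. branch i v) ` ?I - {e \<in> topspace X. s e = v}"
      then obtain i where i: "v \<in> s ` piece i" "e = branch i v" "e \<notin> {e \<in> topspace X. s e = v}" by auto
      then show "h e = 0" using branch_in[OF i(1)] s_branch[OF i(1)] piece_in by auto
    qed auto
    also have "\<dots> = sum h ((\<lambda>i. branch i v) ` ?I)" by (rule infsum_finite) simp
    also have "\<dots> = (\<Sum>i\<in>?I. h (branch i v))"
    proof (rule sum.reindex_cong[OF _ refl refl])
      show "inj_on (\<lambda>i. branch i v) ?I"
        using branch_in piece_unique by (auto simp: inj_on_def) (metis imageI branch_in piece_unique)
    qed
    also have "\<dots> = (\<Sum>i\<le>k. indicator (s ` piece i) v *\<^sub>R h (branch i v))"
      by (intro sum.mono_neutral_cong_left) auto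
    finally show ?thesis .
  qed
  have "(\<integral>e. h e \<partial>pullback \<mu>) = (\<integral>e. (\<Sum>i\<le>k. indicator (piece i) e *\<^sub>R h e) \<partial>pullback \<mu>)"
  proof (rule Bochner_Integration.integral_cong[OF refl])
    fix e assume e: "e \<in> space (pullback \<mu>)"
    show "h e = (\<Sum>i\<le>k. indicator (piece i) e *\<^sub>R h e)"
    proof (cases "e \<in> (\<Union>i\<le>k. piece i)")
      case True
      then obtain i where i: "i \<le> k" "e \<in> piece i" by auto
      then have "(\<Sum>j\<le>k. indicator (piece j) e *\<^sub>R h e) = (\<Sum>j\<in>{i}. indicator (piece j) e *\<^sub>R h e)"
        using piece_unique by (intro sum.mono_neutral_right) (auto simp: indicator_def)
      then show ?thesis using i by simp
    next
      case False
      then show ?thesis using h0[of e] e by simp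
    qed
  qed
  also have "\<dots> = (\<Sum>i\<le>k. \<integral>e. indicator (piece i) e *\<^sub>R h e \<partial>pullback \<mu>)"
    using hi by (intro Bochner_Integration.integral_sum integrable_mult_indicator) auto
  also have "\<dots> = (\<Sum>i\<le>k. \<integral>v. indicator (s ` piece i) v *\<^sub>R h (branch i v) \<partial>\<mu>)"
    using part by simp
  also have "\<dots> = (\<integral>v. (\<Sum>i\<le>k. indicator (s ` piece i) v *\<^sub>R h (branch i v)) \<partial>\<mu>)"
    using part by (intro Bochner_Integration.integral_sum[symmetric]) auto
  finally show ?thesis by (simp only: fib)
qed

end

section \<open>Boundary paths\<close>

text \<open>Positions count from zero; past the end of a finite path the value is arbitrary.\<close>

fun path_edge :: "('v, 'e) gpath \<Rightarrow> nat \<Rightarrow> 'e" where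
  "path_edge (Vertex v) i = undefined"
| "path_edge (Edges es) i = es ! i"
| "path_edge (Infinite x) i = x i"

lemma path_edge_eqs: "path_edge (Edges es) = (!) es" "path_edge (Infinite x) = x"
  by (rule ext, simp)+

text \<open>Right inverse to the shift, for edges whose source is the range of the path.\<close>

fun prepend :: "'e \<Rightarrow> ('v, 'e) gpath \<Rightarrow> ('v, 'e) gpath" where
  "prepend e (Vertex v) = Edges [e]"
| "prepend e (Edges es) = Edges (e # es)"
| "prepend e (Infinite x) = Infinite (case_nat e x)"

text \<open>The vertex reached after \<open>n\<close> edges, for a path with range \<open>v\<close> and edges \<open>x\<close>. It lets paths of length
  zero take part in uniform statements.\<close>

definition vertex_at :: "('v, 'e) topgraph \<Rightarrow> 'v \<Rightarrow> (nat \<Rightarrow> 'e) \<Rightarrow> nat \<Rightarrow> 'v" where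
  "vertex_at E v x n = (case n of 0 \<Rightarrow> v | Suc m \<Rightarrow> src E (x m))"

lemma vertex_at_simps [simp]: "vertex_at E v x 0 = v" "vertex_at E v x (Suc m) = src E (x m)"
  by (simp_all add: vertex_at_def)

text \<open>Coordinates of boundary paths: a boundary path is the same as a length, a range vertex and a
  sequence of edges subject to this condition. Finite and infinite paths then need no separate
  treatment. From position \<open>n\<close> on the values of \<open>x\<close> are arbitrary.\<close>

definition path_data :: "('v, 'e) topgraph \<Rightarrow> enat \<Rightarrow> 'v \<Rightarrow> (nat \<Rightarrow> 'e) \<Rightarrow> bool" where
  "path_data E n v x \<longleftrightarrow> v \<in> topspace (vertices E) \<and>
     (\<forall>i. enat i < n \<longrightarrow> x i \<in> topspace (edges E) \<and> rng E (x i) = vertex_at E v x i) \<and>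
     (\<forall>i. n = enat i \<longrightarrow> vertex_at E v x i \<in> singular_vertices E)"

lemma boundary_pathE:
  assumes "\<alpha> \<in> boundary_paths E"
  obtains (Vertex) v where "\<alpha> = Vertex v" "v \<in> singular_vertices E"
  | (Edges) es where "\<alpha> = Edges es" "es \<noteq> []" "set es \<subseteq> topspace (edges E)"
      "\<And>i. Suc i < length es \<Longrightarrow> src E (es ! i) = rng E (es ! Suc i)" "src E (last es) \<in> singular_vertices E"
  | (Infinite) x where "\<alpha> = Infinite x" "range x \<subseteq> topspace (edges E)"
      "\<And>i. src E (x i) = rng E (x (Suc i))"
  using assms unfolding boundary_paths_def finite_paths_def infinite_paths_def by auto

locale sc_graph =
  fixes E :: "('v, 'e) topgraph"
  assumes graph: "topological_graph E" and sc: "second_countable_graph E"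

sublocale sc_graph \<subseteq> local_homeo "edges E" "vertices E" "src E"
  using graph sc by unfold_locales (auto simp: topological_graph_def second_countable_graph_def)

context sc_graph
begin

abbreviation "bp \<equiv> boundary_paths E"
abbreviation "bps \<equiv> boundary_path_space E"
abbreviation "Vt \<equiv> topspace (vertices E)"
abbreviation "Et \<equiv> topspace (edges E)"

lemma rng_continuous: "continuous_map (edges E) (vertices E) (rng E)"
  using graph by (simp add: topological_graph_def)

lemma rng_in: "e \<in> Et \<Longrightarrow> rng E e \<in> Vt"
  using rng_continuous by (auto simp: continuous_map_def)

lemma src_in: "e \<in> Et \<Longrightarrow> src E e \<in> Vt"
  by (rule s_in)

lemma singular_in: "v \<in> singular_vertices E \<Longrightarrow> v \<in> Vt"
  by (simp add: singular_vertices_def)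

lemma path_data_boundary:
  assumes "\<alpha> \<in> bp"
  shows "path_data E (path_length \<alpha>) (path_range E \<alpha>) (path_edge \<alpha>)"
  using assms
proof (cases rule: boundary_pathE)
  case (Vertex v)
  then show ?thesis using singular_in by (auto simp: path_data_def zero_enat_def)
next
  case (Edges es)
  have "es ! i \<in> Et \<and> rng E (es ! i) = vertex_at E (rng E (hd es)) ((!) es) i" if "i < length es" for i
    using Edges that by (cases i) (auto simp: hd_conv_nth)
  moreover have "vertex_at E (rng E (hd es)) ((!) es) (length es) \<in> singular_vertices E"
    using Edges by (cases "length es") (auto simp: last_conv_nth)
  moreover have "rng E (hd es) \<in> Vt" using Edges(2,3) hd_in_set[of es] by (intro rng_in) blast
  ultimately show ?thesis using Edges(1) by (simp add: path_data_def path_edge_eqs)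
next
  case (Infinite x)
  have x: "x i \<in> Et \<and> rng E (x i) = vertex_at E (rng E (x 0)) x i" for i
    using Infinite(2,3) by (cases i) (simp_all add: image_subset_iff)
  have v: "rng E (x 0) \<in> Vt" using Infinite(2) by (intro rng_in) auto
  have "path_data E \<infinity> (rng E (x 0)) x"
    unfolding path_data_def using x v by (metis enat.distinct(1))
  then show ?thesis by (simp only: Infinite(1) path_edge_eqs path_range.simps path_length.simps)
qed

lemma boundary_path_exists:
  assumes "path_data E n v x"
  obtains \<alpha> where "\<alpha> \<in> bp" "path_length \<alpha> = n" "path_range E \<alpha> = v"
    "\<And>i. enat i < n \<Longrightarrow> path_edge \<alpha> i = x i"
proof (cases n)
  case infinity
  have x: "x i \<in> Et" "rng E (x i) = vertex_at E v x i" for i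
    using assms by (auto simp: path_data_def infinity)
  have "src E (x i) = rng E (x (Suc i))" for i using x(2)[of "Suc i"] by simp
  then have "Infinite x \<in> bp" using x(1) by (auto simp: boundary_paths_def infinite_paths_def)
  then show thesis using x(2)[of 0] infinity by (intro that[of "Infinite x"]) auto
next
  case (enat k)
  have x: "x i \<in> Et" "rng E (x i) = vertex_at E v x i" if "i < k" for i
    using assms that by (auto simp: path_data_def enat)
  have end_sing: "vertex_at E v x k \<in> singular_vertices E" using assms by (auto simp: path_data_def enat)
  show thesis
  proof (cases k)
    case 0
    then have "Vertex v \<in> bp" using end_sing singular_in by (auto simp: boundary_paths_def finite_paths_def)
    then show thesis using 0 enat by (intro that[of "Vertex v"]) (auto simp: zero_enat_def)
  next
    case (Suc m)
    let ?es = "map x [0..<k]"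
    have "src E (?es ! i) = rng E (?es ! Suc i)" if "Suc i < length ?es" for i
      using x(2)[of "Suc i"] that by simp
    moreover have "src E (last ?es) \<in> singular_vertices E"
      using end_sing Suc by simp
    moreover have "set ?es \<subseteq> Et" using x(1) by auto
    ultimately have "Edges ?es \<in> bp" using Suc by (auto simp: boundary_paths_def finite_paths_def simp del: upt_Suc)
    moreover have "rng E (hd ?es) = v" using x(2)[of 0] Suc by (simp add: hd_map del: upt_Suc)
    ultimately show thesis using Suc enat
      by (intro that[of "Edges ?es"]) (auto simp del: upt_Suc)
  qed
qed

lemma boundary_path_eqI:
  assumes "\<alpha> \<in> bp" "\<beta> \<in> bp" "path_length \<alpha> = path_length \<beta>" "path_range E \<alpha> = path_range E \<beta>"
    "\<And>i. enat i < path_length \<alpha> \<Longrightarrow> path_edge \<alpha> i = path_edge \<beta> i"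
  shows "\<alpha> = \<beta>"
  using assms
  by (cases \<alpha>; cases \<beta>) (auto simp: zero_enat_def boundary_paths_def finite_paths_def infinite_paths_def
      intro!: nth_equalityI)

lemma path_range_in: "\<alpha> \<in> bp \<Longrightarrow> path_range E \<alpha> \<in> Vt"
  using path_data_boundary by (auto simp: path_data_def)

lemma path_edge_in: "\<alpha> \<in> bp \<Longrightarrow> enat i < path_length \<alpha> \<Longrightarrow> path_edge \<alpha> i \<in> Et"
  using path_data_boundary by (auto simp: path_data_def)

lemma rng_path_edge:
  "\<alpha> \<in> bp \<Longrightarrow> enat i < path_length \<alpha> \<Longrightarrow>
    rng E (path_edge \<alpha> i) = vertex_at E (path_range E \<alpha>) (path_edge \<alpha>) i"
  using path_data_boundary by (auto simp: path_data_def)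

lemma path_end_singular:
  "\<alpha> \<in> bp \<Longrightarrow> path_length \<alpha> = enat n \<Longrightarrow>
    vertex_at E (path_range E \<alpha>) (path_edge \<alpha>) n \<in> singular_vertices E"
  using path_data_boundary by (auto simp: path_data_def)

lemma vertex_iff_length_0: "\<alpha> \<in> bp \<Longrightarrow> \<alpha> \<in> range Vertex \<longleftrightarrow> path_length \<alpha> = 0"
  by (erule boundary_pathE) (auto simp: zero_enat_def)

lemma prepend_boundary:
  assumes "\<beta> \<in> bp" "e \<in> Et" "src E e = path_range E \<beta>"
  shows "prepend e \<beta> \<in> bp" "shift E (prepend e \<beta>) = \<beta>" "path_length (prepend e \<beta>) = eSuc (path_length \<beta>)"
    "path_range E (prepend e \<beta>) = rng E e" "path_edge (prepend e \<beta>) 0 = e"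
    "\<And>i. path_edge (prepend e \<beta>) (Suc i) = path_edge \<beta> i \<or> path_length \<beta> \<le> enat i"
proof -
  from \<open>\<beta> \<in> bp\<close>
  have "prepend e \<beta> \<in> bp \<and> shift E (prepend e \<beta>) = \<beta>"
  proof (cases rule: boundary_pathE)
    case (Edges es)
    have "src E ((e # es) ! i) = rng E ((e # es) ! Suc i)" if "Suc i < length (e # es)" for i
      using Edges assms that by (cases i) (auto simp: hd_conv_nth)
    then show ?thesis
      using Edges assms by (auto simp: boundary_paths_def finite_paths_def)
  next
    case (Infinite x)
    have "src E (case_nat e x i) = rng E (case_nat e x (Suc i))" for i
      using Infinite assms by (cases i) auto
    moreover have "range (case_nat e x) \<subseteq> Et"
      using Infinite(2) assms(2) by (simp add: image_subset_iff split: nat.splits)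
    ultimately show ?thesis using Infinite(1) by (auto simp: boundary_paths_def infinite_paths_def)
  qed (use assms in \<open>auto simp: boundary_paths_def finite_paths_def\<close>)
  then show "prepend e \<beta> \<in> bp" "shift E (prepend e \<beta>) = \<beta>" by auto
qed (cases \<beta>; auto simp: eSuc_enat one_eSuc zero_enat_def one_enat_def)+

lemma shift_boundary:
  assumes "\<alpha> \<in> bp" "0 < path_length \<alpha>"
  shows "shift E \<alpha> \<in> bp" "path_range E (shift E \<alpha>) = src E (path_edge \<alpha> 0)"
    "prepend (path_edge \<alpha> 0) (shift E \<alpha>) = \<alpha>"
proof -
  from \<open>\<alpha> \<in> bp\<close>
  have "shift E \<alpha> \<in> bp \<and> path_range E (shift E \<alpha>) = src E (path_edge \<alpha> 0) \<and>
      prepend (path_edge \<alpha> 0) (shift E \<alpha>) = \<alpha>"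
  proof (cases rule: boundary_pathE)
    case (Edges es)
    obtain e es' where es: "es = e # es'" using Edges by (cases es) auto
    show ?thesis
    proof (cases es')
      case Nil
      then show ?thesis using Edges singular_in by (auto simp: es boundary_paths_def finite_paths_def)
    next
      case (Cons f fs)
      have "src E (es' ! i) = rng E (es' ! Suc i)" if "Suc i < length es'" for i
        using Edges(4)[of "Suc i"] that es by auto
      moreover have "src E e = rng E f" using Edges(4)[of 0] es Cons by auto
      ultimately show ?thesis using Edges Cons by (auto simp: es boundary_paths_def finite_paths_def)
    qed
  next
    case (Infinite x)
    have "case_nat (x 0) (\<lambda>i. x (Suc i)) = x" by (auto split: nat.splits)
    then show ?thesis using Infinite by (auto simp: boundary_paths_def infinite_paths_def)
  qed (use assms in auto)
  then show "shift E \<alpha> \<in> bp" "path_range E (shift E \<alpha>) = src E (path_edge \<alpha> 0)"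
    "prepend (path_edge \<alpha> 0) (shift E \<alpha>) = \<alpha>" by auto
qed

section \<open>Cylinder sets\<close>

text \<open>Unlike \<^const>\<open>cylinder\<close>, this prescribes conditions for the range and each of the first \<open>n\<close> edges
  separately. Such sets are closed under finite intersections, and the shift maps them to sets of the
  same form.\<close>

definition cyl :: "nat \<Rightarrow> 'v set \<Rightarrow> (nat \<Rightarrow> 'e set) \<Rightarrow> ('v, 'e) gpath set" where
  "cyl n B A = {\<alpha> \<in> bp. enat n \<le> path_length \<alpha> \<and> path_range E \<alpha> \<in> B \<and> (\<forall>i<n. path_edge \<alpha> i \<in> A i)}"

lemma cyl_subset: "cyl n B A \<subseteq> bp"
  by (auto simp: cyl_def)

lemma cyl_0: "cyl 0 B A = {\<alpha> \<in> bp. path_range E \<alpha> \<in> B}"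
  by (auto simp: cyl_def zero_enat_def[symmetric])

lemma cyl_Int:
  "cyl n B A \<inter> cyl m B' A' =
    cyl (max n m) (B \<inter> B') (\<lambda>i. (if i < n then A i else Et) \<inter> (if i < m then A' i else Et))"
proof -
  have *: "path_edge \<alpha> i \<in> Et" if "\<alpha> \<in> bp" "enat n \<le> path_length \<alpha>" "i < n" for \<alpha> i n
    using path_edge_in[OF that(1), of i] that by (metis enat_ord_simps(2) less_le_trans)
  have "enat (max n m) \<le> L \<longleftrightarrow> enat n \<le> L \<and> enat m \<le> L" for L
    by (cases L) auto
  moreover have "(\<forall>i<max n m. path_edge \<alpha> i \<in> (if i < n then A i else Et) \<inter> (if i < m then A' i else Et)) \<longleftrightarrow>
      (\<forall>i<n. path_edge \<alpha> i \<in> A i) \<and> (\<forall>i<m. path_edge \<alpha> i \<in> A' i)"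
    if "\<alpha> \<in> bp" "enat n \<le> path_length \<alpha>" "enat m \<le> path_length \<alpha>" for \<alpha>
    using *[OF that(1,2)] *[OF that(1,3)] by (auto simp: less_max_iff_disj)
  ultimately show ?thesis
    unfolding cyl_def by blast
qed

text \<open>The first edge is recovered from the shifted path by injectivity of the source map on the piece;
  the conditions on the range and on the first edge turn into a condition on the new range.\<close>

lemma shift_image_cyl:
  assumes "A 0 \<subseteq> piece j"
  shows "shift E ` cyl (Suc n) B A = cyl n (src E ` {e \<in> A 0. rng E e \<in> B}) (\<lambda>i. A (Suc i))"
proof (intro equalityI subsetI)
  fix \<beta> assume "\<beta> \<in> shift E ` cyl (Suc n) B A"
  then obtain \<alpha> where \<alpha>: "\<beta> = shift E \<alpha>" "\<alpha> \<in> bp" "enat (Suc n) \<le> path_length \<alpha>" "path_range E \<alpha> \<in> B"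
    "\<And>i. i < Suc n \<Longrightarrow> path_edge \<alpha> i \<in> A i" by (auto simp: cyl_def)
  have pos: "0 < path_length \<alpha>" using \<alpha>(3) by (metis enat_0_iff(2) gr_zeroI not_less_eq_eq le_zero_eq nat.simps(3))
  note sh = shift_boundary[OF \<alpha>(2) pos]
  have e0: "path_edge \<alpha> 0 \<in> Et" using path_edge_in[OF \<alpha>(2), of 0] pos by (simp add: zero_enat_def)
  note pre = prepend_boundary[OF sh(1) e0 sh(2)[symmetric], unfolded sh(3)]
  have "rng E (path_edge \<alpha> 0) \<in> B" using \<alpha>(4) pre(4) by simp
  moreover have len: "enat n \<le> path_length \<beta>" using \<alpha>(1,3) pre(3) by (simp add: eSuc_enat[symmetric])
  moreover have "path_edge \<beta> i \<in> A (Suc i)" if "i < n" for i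
    using \<alpha>(5)[of "Suc i"] pre(6)[of i] that len \<alpha>(1) by (metis Suc_less_eq enat_ord_simps(1) leD order_trans)
  ultimately show "\<beta> \<in> cyl n (src E ` {e \<in> A 0. rng E e \<in> B}) (\<lambda>i. A (Suc i))"
    using \<alpha>(5)[of 0] sh \<alpha>(1) by (auto simp: cyl_def)
next
  fix \<beta> assume "\<beta> \<in> cyl n (src E ` {e \<in> A 0. rng E e \<in> B}) (\<lambda>i. A (Suc i))"
  then obtain e where e: "e \<in> A 0" "rng E e \<in> B" "src E e = path_range E \<beta>" and \<beta>: "\<beta> \<in> bp"
    "enat n \<le> path_length \<beta>" "\<And>i. i < n \<Longrightarrow> path_edge \<beta> i \<in> A (Suc i)"
    by (auto simp: cyl_def)
  have "e \<in> Et" using e(1) assms piece_in by blast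
  note pre = prepend_boundary[OF \<beta>(1) this e(3)]
  have "path_edge (prepend e \<beta>) i \<in> A i" if "i < Suc n" for i
  proof (cases i)
    case (Suc m)
    then have "path_edge (prepend e \<beta>) (Suc m) = path_edge \<beta> m"
      using pre(6)[of m] \<beta>(2) that by (metis Suc_less_eq enat_ord_simps(1) leD order_trans)
    then show ?thesis using \<beta>(3)[of m] Suc that by simp
  qed (use pre e in auto)
  then have "prepend e \<beta> \<in> cyl (Suc n) B A"
    using pre(1,3,4) e(2) \<beta>(2) by (auto simp: cyl_def eSuc_enat[symmetric])
  then show "\<beta> \<in> shift E ` cyl (Suc n) B A" using pre(2) by (metis imageI)
qed

lemma inj_on_shift_piece: "inj_on (shift E) {\<alpha> \<in> bp. 0 < path_length \<alpha> \<and> path_edge \<alpha> 0 \<in> piece j}"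
proof (rule inj_onI)
  fix \<alpha> \<beta> assume a: "\<alpha> \<in> {\<alpha> \<in> bp. 0 < path_length \<alpha> \<and> path_edge \<alpha> 0 \<in> piece j}"
    "\<beta> \<in> {\<alpha> \<in> bp. 0 < path_length \<alpha> \<and> path_edge \<alpha> 0 \<in> piece j}" "shift E \<alpha> = shift E \<beta>"
  then have "path_edge \<alpha> 0 = path_edge \<beta> 0"
    using shift_boundary(2)[of \<alpha>] shift_boundary(2)[of \<beta>] inj_onD[OF inj_on_piece[of j]] by auto
  then have eq: "prepend (path_edge \<alpha> 0) (shift E \<alpha>) = prepend (path_edge \<beta> 0) (shift E \<beta>)" using a(3) by simp
  have "prepend (path_edge \<alpha> 0) (shift E \<alpha>) = \<alpha>" "prepend (path_edge \<beta> 0) (shift E \<beta>) = \<beta>"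
    using a(1,2) by (auto intro!: shift_boundary(3))
  then show "\<alpha> = \<beta>" using eq by metis
qed

lemma path_prefix_eq:
  assumes "\<alpha> \<in> bp" "n \<ge> 1" "enat n \<le> path_length \<alpha>"
  shows "path_prefix n \<alpha> = Edges (map (path_edge \<alpha>) [0..<n])"
  using assms by (cases \<alpha>) (auto simp: zero_enat_def intro!: nth_equalityI)

lemma cylinder_eq:
  "cylinder E S = {\<alpha> \<in> bp. Vertex (path_range E \<alpha>) \<in> S \<or>
     (\<exists>n\<ge>1. enat n \<le> path_length \<alpha> \<and> Edges (map (path_edge \<alpha>) [0..<n]) \<in> S)}"
  unfolding cylinder_def using path_prefix_eq by (auto; metis)

lemma topspace_path_space:
  "topspace (path_space E n) =
    {x \<in> {..<n} \<rightarrow>\<^sub>E Et. \<forall>i. Suc i < n \<longrightarrow> src E (x i) = rng E (x (Suc i))}"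
  by (auto simp: path_space_def)

lemma map_eq_path_space:
  assumes "x \<in> topspace (path_space E n)" "y \<in> topspace (path_space E m)"
  shows "map x [0..<n] = map y [0..<m] \<longleftrightarrow> n = m \<and> x = y"
proof
  assume eq: "map x [0..<n] = map y [0..<m]"
  then have nm: "n = m" by (metis length_map length_upt minus_nat.diff_0)
  have "x i = y i" if "i < n" for i using eq nm that by (metis add_0 nth_map_upt minus_nat.diff_0)
  then have "x = y" using assms nm by (intro PiE_ext[of x "{..<n}" "\<lambda>_. Et" y]) (auto simp: topspace_path_space)
  then show "n = m \<and> x = y" using nm by simp
qed auto

lemma prefix_in_path_space:
  assumes "\<alpha> \<in> bp" "enat n \<le> path_length \<alpha>"
  shows "restrict (path_edge \<alpha>) {..<n} \<in> topspace (path_space E n)"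
proof -
  have lt: "enat i < path_length \<alpha>" if "i < n" for i using that assms by (metis enat_ord_simps(2) less_le_trans)
  then show ?thesis
    using path_edge_in[OF assms(1)] rng_path_edge[OF assms(1), OF lt, of "Suc _"]
    by (auto simp: topspace_path_space)
qed

lemma map_restrict_prefix: "map (restrict x {..<n}) [0..<n] = map x [0..<n]"
  by simp

section \<open>The topology of the boundary path space\<close>

lemma openin_finite_path_vertices:
  assumes "openin (vertices E) W" shows "openin (finite_path_topology E) (Vertex ` W)"
proof -
  have "{v \<in> Vt. Vertex v \<in> Vertex ` W} = W" using openin_subset[OF assms] by auto
  moreover have "{x \<in> topspace (path_space E n). Edges (map x [0..<n]) \<in> Vertex ` W} = {}" for n by auto
  moreover have "Vertex ` W \<subseteq> finite_paths E"
    using openin_subset[OF assms] by (auto simp: finite_paths_def)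
  ultimately show ?thesis
    unfolding openin_finite_path_topology finite_path_open_def by (metis assms openin_empty)
qed

lemma Edges_in_finite_paths:
  assumes "n \<ge> 1" "x \<in> topspace (path_space E n)"
  shows "Edges (map x [0..<n]) \<in> finite_paths E"
  using assms by (auto simp: topspace_path_space finite_paths_def PiE_iff)

lemma finite_path_Edges:
  assumes "Edges es \<in> finite_paths E"
  shows "\<exists>x\<in>topspace (path_space E (length es)). es = map x [0..<length es]"
proof (intro bexI)
  show "es = map (restrict ((!) es) {..<length es}) [0..<length es]" by (auto intro: nth_equalityI)
  show "restrict ((!) es) {..<length es} \<in> topspace (path_space E (length es))"
    using assms by (auto simp: topspace_path_space finite_paths_def)
qed

lemma openin_finite_path_edges:
  assumes n: "n \<ge> 1" and O': "openin (path_space E n) O'"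
  shows "openin (finite_path_topology E) ((\<lambda>x. Edges (map x [0..<n])) ` O')"
proof -
  have sub: "O' \<subseteq> topspace (path_space E n)" using openin_subset[OF O'] .
  have e1: "{v \<in> Vt. Vertex v \<in> (\<lambda>x. Edges (map x [0..<n])) ` O'} = {}" by auto
  have e2: "{x \<in> topspace (path_space E m). Edges (map x [0..<m]) \<in> (\<lambda>x. Edges (map x [0..<n])) ` O'} =
      (if m = n then O' else {})" for m
    using sub map_eq_path_space[of _ m _ n] by (auto; blast)
  have "(\<lambda>x. Edges (map x [0..<n])) ` O' \<subseteq> finite_paths E"
    using sub Edges_in_finite_paths[OF n] by blast
  then show ?thesis
    using O' unfolding openin_finite_path_topology finite_path_open_def e1 e2 by simp
qed

lemma openin_cylinder: "openin (finite_path_topology E) U \<Longrightarrow> openin bps (cylinder E U)"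
proof -
  assume "openin (finite_path_topology E) U"
  then have "cylinder E U - cylinder E {} \<in> {cylinder E U - cylinder E K | U K.
     openin (finite_path_topology E) U \<and> compactin (finite_path_topology E) K}"
    by blast
  moreover have "cylinder E U - cylinder E {} = cylinder E U" by (auto simp: cylinder_def)
  ultimately show ?thesis unfolding boundary_path_space_def by (metis (no_types, lifting) topology_generated_by_Basis)
qed

text \<open>The condition on the range becomes a condition on the first edge when there is one.\<close>

lemma openin_cyl:
  assumes W: "openin (vertices E) W" and U: "\<And>i. i < n \<Longrightarrow> openin (edges E) (U i)"
  shows "openin bps (cyl n W U)"
proof (cases n)
  case 0
  have "cyl 0 W U = cylinder E (Vertex ` W)" unfolding cyl_0 cylinder_eq by auto
  then show ?thesis using 0 openin_cylinder[OF openin_finite_path_vertices[OF W]] by simp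
next
  case (Suc m)
  define U' where "U' i = (if i = 0 then U 0 \<inter> {e \<in> Et. rng E e \<in> W} else U i)" for i
  define O' where "O' = topspace (path_space E n) \<inter> Pi\<^sub>E {..<n} U'"
  have "openin (edges E) (U' i)" if "i < n" for i
    using U[OF that] U[of 0] Suc W rng_continuous by (auto simp: U'_def continuous_map_def)
  then have "openin (product_topology (\<lambda>_. edges E) {..<n}) (Pi\<^sub>E {..<n} U')"
    by (auto simp: openin_PiE_gen)
  then have "openin (path_space E n) O'"
    unfolding O'_def path_space_def topspace_subtopology openin_subtopology
    using openin_subset by (intro exI[of _ "Pi\<^sub>E {..<n} U'"]) blast
  then have "openin bps (cylinder E ((\<lambda>x. Edges (map x [0..<n])) ` O'))"
    using Suc by (intro openin_cylinder openin_finite_path_edges) auto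
  moreover have "cylinder E ((\<lambda>x. Edges (map x [0..<n])) ` O') = cyl n W U"
  proof (intro equalityI subsetI)
    fix \<alpha> assume "\<alpha> \<in> cylinder E ((\<lambda>x. Edges (map x [0..<n])) ` O')"
    then obtain k x where \<alpha>: "\<alpha> \<in> bp" "enat k \<le> path_length \<alpha>" "x \<in> O'" "map (path_edge \<alpha>) [0..<k] = map x [0..<n]"
      unfolding cylinder_eq by auto
    have k: "k = n" using \<alpha>(4) by (metis length_map length_upt minus_nat.diff_0)
    then have x: "path_edge \<alpha> i = x i" if "i < n" for i using \<alpha>(4) that by (metis add_0 nth_map_upt minus_nat.diff_0)
    have x': "path_edge \<alpha> i \<in> U' i" if "i < n" for i using \<alpha>(3) that x[OF that] by (auto simp: O'_def)
    have "enat 0 < path_length \<alpha>" using \<alpha>(2) k Suc by (metis enat_ord_simps(2) less_le_trans zero_less_Suc)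
    then have "rng E (path_edge \<alpha> 0) = path_range E \<alpha>" using rng_path_edge[OF \<alpha>(1), of 0] by simp
    then have "path_range E \<alpha> \<in> W" using x'[of 0] Suc by (auto simp: U'_def)
    moreover have "path_edge \<alpha> i \<in> U i" if "i < n" for i using x'[OF that] by (auto simp: U'_def split: if_splits)
    ultimately show "\<alpha> \<in> cyl n W U" using \<alpha> k by (auto simp: cyl_def)
  next
    fix \<alpha> assume a: "\<alpha> \<in> cyl n W U"
    then have \<alpha>: "\<alpha> \<in> bp" "enat n \<le> path_length \<alpha>" "path_range E \<alpha> \<in> W" "\<And>i. i < n \<Longrightarrow> path_edge \<alpha> i \<in> U i"
      by (auto simp: cyl_def)
    have l: "enat 0 < path_length \<alpha>" using \<alpha>(2) Suc by (metis enat_ord_simps(2) less_le_trans zero_less_Suc)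
    then have "path_edge \<alpha> i \<in> U' i" if "i < n" for i
      using \<alpha>(3) \<alpha>(4)[OF that] rng_path_edge[OF \<alpha>(1) l] path_edge_in[OF \<alpha>(1) l] by (auto simp: U'_def)
    then have "restrict (path_edge \<alpha>) {..<n} \<in> O'"
      using prefix_in_path_space[OF \<alpha>(1,2)] by (auto simp: O'_def)
    then have "Edges (map (path_edge \<alpha>) [0..<n]) \<in> (\<lambda>x. Edges (map x [0..<n])) ` O'"
      by (metis (no_types, lifting) image_eqI map_restrict_prefix)
    then show "\<alpha> \<in> cylinder E ((\<lambda>x. Edges (map x [0..<n])) ` O')"
      unfolding cylinder_eq using \<alpha>(1,2) Suc by (auto simp del: upt_Suc intro!: exI[of _ n])
  qed
  ultimately show ?thesis by simp
qed

lemma path_range_continuous: "continuous_map bps (vertices E) (path_range E)"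
proof -
  have "openin bps {\<alpha> \<in> bp. path_range E \<alpha> \<in> W}" if "openin (vertices E) W" for W
    using openin_cyl[OF that, of 0] by (simp add: cyl_0)
  then show ?thesis using path_range_in by (auto simp: continuous_map_def topspace_boundary_path_space)
qed

text \<open>Two countable families that generate the topology. Complements of cylinders over compact sets
  serve as neighbourhoods of paths that are too short for the cylinder. They stay so when the compact
  sets are enlarged, so that those of one exhaustion suffice.\<close>

definition subbase :: "('v, 'e) gpath set set" where
  "subbase = range (\<lambda>(j, ls). cyl (length ls) (Y.cbase j) (\<lambda>i. X.cbase (ls ! i))) \<union>
     range (\<lambda>(n, k). bp - cyl n Vt (\<lambda>_. X.exhaust Et k))"

lemma countable_subbase: "countable subbase"
  unfolding subbase_def by (intro countable_Un countable_image) auto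

text \<open>For a boundary path \<open>\<alpha>\<close>: membership in the interior of \<open>G\<close>, in the topology generated by
  \<^term>\<open>subbase\<close>.\<close>

definition has_nbhd :: "('v, 'e) gpath \<Rightarrow> ('v, 'e) gpath set \<Rightarrow> bool" where
  "has_nbhd \<alpha> G \<longleftrightarrow> (\<exists>F\<subseteq>subbase. finite F \<and> \<alpha> \<in> \<Inter>F \<and> bp \<inter> \<Inter>F \<subseteq> G)"

lemma has_nbhd_Int:
  assumes "has_nbhd \<alpha> G" "has_nbhd \<alpha> H" shows "has_nbhd \<alpha> (G \<inter> H)"
proof -
  obtain F F' where "F \<subseteq> subbase" "finite F" "\<alpha> \<in> \<Inter>F" "bp \<inter> \<Inter>F \<subseteq> G"
    "F' \<subseteq> subbase" "finite F'" "\<alpha> \<in> \<Inter>F'" "bp \<inter> \<Inter>F' \<subseteq> H"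
    using assms unfolding has_nbhd_def by auto
  then show ?thesis unfolding has_nbhd_def by (intro exI[of _ "F \<union> F'"]) auto
qed

lemma has_nbhd_mono: "has_nbhd \<alpha> G \<Longrightarrow> G \<subseteq> H \<Longrightarrow> has_nbhd \<alpha> H"
  unfolding has_nbhd_def by (meson subset_trans)

lemma has_nbhd_bp: "has_nbhd \<alpha> bp"
  unfolding has_nbhd_def by (intro exI[of _ "{}"]) auto

lemma has_nbhd_INT:
  assumes "finite I" "\<And>i. i \<in> I \<Longrightarrow> has_nbhd \<alpha> (G i)"
  shows "has_nbhd \<alpha> (bp \<inter> (\<Inter>i\<in>I. G i))"
  using assms
proof (induction I)
  case empty
  then show ?case using has_nbhd_bp by simp
next
  case (insert i I)
  then have "has_nbhd \<alpha> (G i \<inter> (bp \<inter> (\<Inter>i\<in>I. G i)))" by (rule_tac has_nbhd_Int) auto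
  then show ?case by (rule has_nbhd_mono) auto
qed

lemma has_nbhd_subbase: "G \<in> subbase \<Longrightarrow> \<alpha> \<in> G \<Longrightarrow> has_nbhd \<alpha> G"
  unfolding has_nbhd_def by (intro exI[of _ "{G}"]) auto

lemma has_nbhd_cyl:
  assumes \<alpha>: "\<alpha> \<in> cyl n W U" and W: "openin (vertices E) W" and U: "\<And>i. i < n \<Longrightarrow> openin (edges E) (U i)"
  shows "has_nbhd \<alpha> (cyl n W U)"
proof -
  obtain j where j: "path_range E \<alpha> \<in> Y.cbase j" "Y.cbase j \<subseteq> W"
    using Y.cbase_nhd[OF W, of "path_range E \<alpha>"] \<alpha> Y.cbase_subset_closure by (auto simp: cyl_def)
  have "\<exists>l. path_edge \<alpha> i \<in> X.cbase l \<and> X.cbase l \<subseteq> U i" if "i < n" for i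
    using X.cbase_nhd[OF U[OF that], of "path_edge \<alpha> i"] \<alpha> that X.cbase_subset_closure
    unfolding cyl_def by (metis (mono_tags, lifting) mem_Collect_eq subset_trans)
  then obtain l where l: "\<And>i. i < n \<Longrightarrow> path_edge \<alpha> i \<in> X.cbase (l i) \<and> X.cbase (l i) \<subseteq> U i" by metis
  let ?ls = "map l [0..<n]"
  let ?G = "cyl (length ?ls) (Y.cbase j) (\<lambda>i. X.cbase (?ls ! i))"
  have "?G \<in> subbase" unfolding subbase_def by (rule UnI1, rule image_eqI[of _ _ "(j, ?ls)"]) auto
  moreover have "\<alpha> \<in> ?G" using \<alpha> j l by (auto simp: cyl_def)
  ultimately have "has_nbhd \<alpha> ?G" by (rule has_nbhd_subbase)
  then show ?thesis
  proof (rule has_nbhd_mono)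
    show "?G \<subseteq> cyl n W U" using j l by (auto simp: cyl_def subset_iff)
  qed
qed

text \<open>An open set of paths of length \<open>n\<close> contains a box of open sets of edges around each of its points.\<close>

lemma has_nbhd_prefix:
  assumes \<alpha>: "\<alpha> \<in> bp" "enat n \<le> path_length \<alpha>" and O': "openin (path_space E n) O'"
    "restrict (path_edge \<alpha>) {..<n} \<in> O'"
  shows "has_nbhd \<alpha> {\<beta> \<in> bp. enat n \<le> path_length \<beta> \<and> restrict (path_edge \<beta>) {..<n} \<in> O'}"
proof -
  let ?S = "{x. \<forall>i. Suc i < n \<longrightarrow> src E (x i) = rng E (x (Suc i))}"
  obtain T where T: "openin (product_topology (\<lambda>_. edges E) {..<n}) T" "O' = T \<inter> ?S"
    using O'(1) unfolding path_space_def openin_subtopology by blast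
  then have "restrict (path_edge \<alpha>) {..<n} \<in> T" using O'(2) by blast
  then obtain U where U: "\<forall>i\<in>{..<n}. openin (edges E) (U i)" "restrict (path_edge \<alpha>) {..<n} \<in> Pi\<^sub>E {..<n} U"
    "Pi\<^sub>E {..<n} U \<subseteq> T"
    using T(1) unfolding openin_product_topology_alt by blast
  have "\<alpha> \<in> cyl n Vt U" using \<alpha> U(2) path_range_in by (auto simp: cyl_def PiE_iff)
  then have "has_nbhd \<alpha> (cyl n Vt U)" using U(1) by (intro has_nbhd_cyl) auto
  then show ?thesis
  proof (rule has_nbhd_mono, intro subsetI)
    fix \<beta> assume "\<beta> \<in> cyl n Vt U"
    then have \<beta>: "\<beta> \<in> bp" "enat n \<le> path_length \<beta>" "restrict (path_edge \<beta>) {..<n} \<in> Pi\<^sub>E {..<n} U"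
      by (auto simp: cyl_def)
    moreover have "restrict (path_edge \<beta>) {..<n} \<in> ?S"
      using prefix_in_path_space[OF \<beta>(1,2)] unfolding topspace_path_space by blast
    ultimately show "\<beta> \<in> {\<beta> \<in> bp. enat n \<le> path_length \<beta> \<and> restrict (path_edge \<beta>) {..<n} \<in> O'}"
      using U(3) T(2) by blast
  qed
qed

definition graded :: "nat \<Rightarrow> ('v, 'e) gpath set" where
  "graded n = {\<alpha> \<in> finite_paths E. path_length \<alpha> = enat n}"

lemma graded_0: "graded 0 = Vertex ` Vt"
  by (auto simp: graded_def finite_paths_def zero_enat_def)

lemma graded_pos:
  assumes "n \<ge> 1" shows "graded n = (\<lambda>x. Edges (map x [0..<n])) ` topspace (path_space E n)"
proof
  show "graded n \<subseteq> (\<lambda>x. Edges (map x [0..<n])) ` topspace (path_space E n)"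
  proof
    fix \<alpha> assume "\<alpha> \<in> graded n"
    then obtain es where "\<alpha> = Edges es" "length es = n" "Edges es \<in> finite_paths E"
      using assms by (cases \<alpha>) (auto simp: graded_def zero_enat_def)
    then show "\<alpha> \<in> (\<lambda>x. Edges (map x [0..<n])) ` topspace (path_space E n)"
      using finite_path_Edges by (metis (no_types, lifting) image_eqI)
  qed
  show "(\<lambda>x. Edges (map x [0..<n])) ` topspace (path_space E n) \<subseteq> graded n"
    using Edges_in_finite_paths[OF assms] by (auto simp: graded_def)
qed

lemma openin_graded: "openin (finite_path_topology E) (graded n)"
proof (cases "n = 0")
  case True
  then show ?thesis using openin_finite_path_vertices[of Vt] graded_0 by simp
next
  case False
  then have n: "n \<ge> 1" by simp
  show ?thesis using openin_finite_path_edges[OF n openin_topspace] by (simp add: graded_pos[OF n])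
qed

lemma closedin_graded: "closedin (finite_path_topology E) (graded n)"
proof -
  have "finite_paths E - graded n = (\<Union>m\<in>-{n}. graded m)"
  proof
    show "finite_paths E - graded n \<subseteq> (\<Union>m\<in>-{n}. graded m)"
    proof
      fix \<alpha> assume \<alpha>: "\<alpha> \<in> finite_paths E - graded n"
      then obtain m where "path_length \<alpha> = enat m" by (cases \<alpha>) (auto simp: finite_paths_def zero_enat_def)
      with \<alpha> show "\<alpha> \<in> (\<Union>m\<in>-{n}. graded m)" by (auto simp: graded_def)
    qed
  qed (auto simp: graded_def)
  moreover have "openin (finite_path_topology E) (\<Union>m\<in>-{n}. graded m)" using openin_graded by blast
  ultimately show ?thesis
    by (auto simp: closedin_def topspace_finite_path_topology graded_def)
qed

text \<open>The path spaces of the various lengths are disjoint and open.\<close>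

lemma compact_graded_bound:
  assumes "compactin (finite_path_topology E) K"
  obtains N where "K \<subseteq> (\<Union>n\<le>N. graded n)"
proof -
  have "K \<subseteq> \<Union> (range graded)"
  proof
    fix \<alpha> assume "\<alpha> \<in> K"
    then have \<alpha>: "\<alpha> \<in> finite_paths E"
      using compactin_subset_topspace[OF assms] topspace_finite_path_topology by blast
    then obtain m where "path_length \<alpha> = enat m" by (cases \<alpha>) (auto simp: finite_paths_def zero_enat_def)
    with \<alpha> show "\<alpha> \<in> \<Union> (range graded)" by (auto simp: graded_def)
  qed
  moreover have "\<forall>U\<in>range graded. openin (finite_path_topology E) U" using openin_graded by auto
  ultimately obtain \<F> where \<F>: "finite \<F>" "\<F> \<subseteq> range graded" "K \<subseteq> \<Union>\<F>"
    using assms unfolding compactin_def by metis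
  then obtain I where I: "finite I" "K \<subseteq> \<Union> (graded ` I)"
    using finite_subset_image[OF \<F>(1,2)] by metis
  then obtain N where N: "\<forall>i\<in>I. i \<le> N" using finite_nat_set_iff_bounded_le by auto
  have "K \<subseteq> (\<Union>n\<le>N. graded n)"
  proof
    fix \<alpha> assume "\<alpha> \<in> K"
    then obtain i where "i \<in> I" "\<alpha> \<in> graded i" using I(2) by auto
    then show "\<alpha> \<in> (\<Union>n\<le>N. graded n)" using N by auto
  qed
  then show thesis using that by blast
qed

lemma compact_trace_vertices:
  assumes "compactin (finite_path_topology E) K"
  shows "compactin (vertices E) {v \<in> Vt. Vertex v \<in> K}"
proof -
  have "compactin (subtopology (finite_path_topology E) (graded 0)) (graded 0 \<inter> K)"
    using closed_Int_compactin[OF closedin_graded assms] by (simp add: compactin_subtopology)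
  moreover have "continuous_map (subtopology (finite_path_topology E) (graded 0)) (vertices E) (path_range E)"
  proof -
    have ts: "topspace (subtopology (finite_path_topology E) (graded 0)) = graded 0"
      by (auto simp: topspace_finite_path_topology graded_def)
    have "openin (subtopology (finite_path_topology E) (graded 0)) {\<alpha> \<in> graded 0. path_range E \<alpha> \<in> W}"
      if W: "openin (vertices E) W" for W
    proof -
      have "{\<alpha> \<in> graded 0. path_range E \<alpha> \<in> W} = Vertex ` W \<inter> graded 0"
        by (auto simp: graded_0)
      then show ?thesis
        using openin_finite_path_vertices[OF W] by (metis openin_subtopology_Int)
    qed
    then show ?thesis unfolding continuous_map_def ts by (auto simp: graded_0)
  qed
  ultimately have "compactin (vertices E) (path_range E ` (graded 0 \<inter> K))" by (rule image_compactin)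
  moreover have "path_range E ` (graded 0 \<inter> K) = {v \<in> Vt. Vertex v \<in> K}"
    by (force simp: graded_0)
  ultimately show ?thesis by simp
qed

lemma restrict_Edges_path_space:
  assumes "x \<in> topspace (path_space E n)"
  shows "restrict (path_edge (Edges (map x [0..<n]))) {..<n} = x"
  using assms by (auto simp: topspace_path_space PiE_iff extensional_def)

lemma compact_trace_edges:
  assumes K: "compactin (finite_path_topology E) K" and n: "n \<ge> 1"
  shows "compactin (path_space E n) {x \<in> topspace (path_space E n). Edges (map x [0..<n]) \<in> K}"
proof -
  define p :: "('v, 'e) gpath \<Rightarrow> nat \<Rightarrow> 'e" where "p \<alpha> = restrict (path_edge \<alpha>) {..<n}" for \<alpha>
  have p: "p (Edges (map x [0..<n])) = x" if "x \<in> topspace (path_space E n)" for x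
    unfolding p_def by (rule restrict_Edges_path_space[OF that])
  have ts: "topspace (subtopology (finite_path_topology E) (graded n)) = graded n"
    by (auto simp: topspace_finite_path_topology graded_def)
  have "continuous_map (subtopology (finite_path_topology E) (graded n)) (path_space E n) p"
    unfolding continuous_map_def ts
  proof (intro conjI allI impI)
    show "p \<in> graded n \<rightarrow> topspace (path_space E n)"
      unfolding graded_pos[OF n] by (auto simp: p)
    fix U assume U: "openin (path_space E n) U"
    have "{\<alpha> \<in> graded n. p \<alpha> \<in> U} = (\<lambda>x. Edges (map x [0..<n])) ` U \<inter> graded n"
    proof (intro equalityI subsetI)
      fix \<alpha> assume "\<alpha> \<in> {\<alpha> \<in> graded n. p \<alpha> \<in> U}"
      then show "\<alpha> \<in> (\<lambda>x. Edges (map x [0..<n])) ` U \<inter> graded n"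
        unfolding graded_pos[OF n] by (auto simp: p)
    next
      fix \<alpha> assume "\<alpha> \<in> (\<lambda>x. Edges (map x [0..<n])) ` U \<inter> graded n"
      then obtain x where "x \<in> U" "\<alpha> = Edges (map x [0..<n])" "\<alpha> \<in> graded n" by blast
      then show "\<alpha> \<in> {\<alpha> \<in> graded n. p \<alpha> \<in> U}" using openin_subset[OF U] p[of x] by auto
    qed
    then show "openin (subtopology (finite_path_topology E) (graded n)) {\<alpha> \<in> graded n. p \<alpha> \<in> U}"
      using openin_finite_path_edges[OF n U] by (metis openin_subtopology_Int)
  qed
  moreover have "compactin (subtopology (finite_path_topology E) (graded n)) (graded n \<inter> K)"
    using closed_Int_compactin[OF closedin_graded K] by (simp add: compactin_subtopology)
  ultimately have "compactin (path_space E n) (p ` (graded n \<inter> K))" by (metis image_compactin)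
  moreover have "p ` (graded n \<inter> K) = {x \<in> topspace (path_space E n). Edges (map x [0..<n]) \<in> K}"
  proof (intro equalityI subsetI)
    fix x assume "x \<in> p ` (graded n \<inter> K)"
    then show "x \<in> {x \<in> topspace (path_space E n). Edges (map x [0..<n]) \<in> K}"
      unfolding graded_pos[OF n] by (auto simp: p)
  next
    fix x assume x: "x \<in> {x \<in> topspace (path_space E n). Edges (map x [0..<n]) \<in> K}"
    then have "x = p (Edges (map x [0..<n]))" by (simp add: p)
    moreover have "Edges (map x [0..<n]) \<in> graded n \<inter> K"
      unfolding graded_pos[OF n] using x by blast
    ultimately show "x \<in> p ` (graded n \<inter> K)" by (rule image_eqI)
  qed
  ultimately show ?thesis by simp
qed

lemma Hausdorff_path_space: "Hausdorff_space (path_space E n)"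
  unfolding path_space_def using X.hd
  by (intro Hausdorff_space_subtopology) (simp add: Hausdorff_space_product_topology)

lemma has_nbhd_avoid_vertices:
  assumes K: "compactin (finite_path_topology E) K" and \<alpha>: "\<alpha> \<in> bp" "Vertex (path_range E \<alpha>) \<notin> K"
  shows "has_nbhd \<alpha> {\<beta> \<in> bp. Vertex (path_range E \<beta>) \<notin> K}"
proof -
  let ?W = "Vt - {v \<in> Vt. Vertex v \<in> K}"
  have W: "openin (vertices E) ?W"
    using compactin_imp_closedin[OF Y.hd compact_trace_vertices[OF K]] by blast
  have "\<alpha> \<in> cyl 0 ?W (\<lambda>_. Et)" using \<alpha> path_range_in by (auto simp: cyl_0)
  then have "has_nbhd \<alpha> (cyl 0 ?W (\<lambda>_. Et))" using W by (intro has_nbhd_cyl) auto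
  then show ?thesis by (rule has_nbhd_mono) (auto simp: cyl_0)
qed

text \<open>A path with at least \<open>n\<close> edges is separated from the compact set of paths of length \<open>n\<close> by a
  neighbourhood of its initial segment. A shorter path has no such segment; then the complement of
  the cylinder over a product of compact sets containing the given one is a neighbourhood.\<close>

lemma has_nbhd_avoid_edges:
  assumes K: "compactin (finite_path_topology E) K" and \<alpha>: "\<alpha> \<in> bp" and n: "n \<ge> 1"
    and notin: "enat n \<le> path_length \<alpha> \<Longrightarrow> Edges (map (path_edge \<alpha>) [0..<n]) \<notin> K"
  shows "has_nbhd \<alpha> {\<beta> \<in> bp. enat n \<le> path_length \<beta> \<longrightarrow> Edges (map (path_edge \<beta>) [0..<n]) \<notin> K}"
proof -
  define Kn where "Kn = {x \<in> topspace (path_space E n). Edges (map x [0..<n]) \<in> K}"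
  have Kn: "compactin (path_space E n) Kn" unfolding Kn_def using compact_trace_edges[OF K n] .
  have iff: "Edges (map (path_edge \<beta>) [0..<n]) \<in> K \<longleftrightarrow> restrict (path_edge \<beta>) {..<n} \<in> Kn"
    if "\<beta> \<in> bp" "enat n \<le> path_length \<beta>" for \<beta>
    using prefix_in_path_space[OF that] by (simp add: Kn_def map_restrict_prefix)
  have proj: "\<exists>k. \<forall>x\<in>Kn. x i \<in> X.exhaust Et k" if "i < n" for i
  proof -
    have "compactin (product_topology (\<lambda>_. edges E) {..<n}) Kn"
      using Kn unfolding path_space_def compactin_subtopology by blast
    then have "compactin (edges E) ((\<lambda>x. x i) ` Kn)"
      using that by (intro image_compactin) (auto intro!: continuous_map_product_projection)
    then obtain k where "(\<lambda>x. x i) ` Kn \<subseteq> X.exhaust Et k"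
      using X.compact_subset_exhaust[OF openin_topspace] compactin_subset_topspace by metis
    then show ?thesis by blast
  qed
  show ?thesis
  proof (cases "enat n \<le> path_length \<alpha>")
    case True
    let ?O = "topspace (path_space E n) - Kn"
    have op: "openin (path_space E n) ?O"
      using compactin_imp_closedin[OF Hausdorff_path_space Kn] by blast
    have "restrict (path_edge \<alpha>) {..<n} \<in> ?O"
      using prefix_in_path_space[OF \<alpha> True] notin[OF True] iff[OF \<alpha> True] by simp
    from has_nbhd_prefix[OF \<alpha> True op this] show ?thesis
      by (rule has_nbhd_mono) (use iff in blast)
  next
    case False
    obtain k where k: "\<And>i. i < n \<Longrightarrow> \<forall>x\<in>Kn. x i \<in> X.exhaust Et (k i)" using proj by metis
    define m where "m = Max (k ` {..<n})"
    have "X.exhaust Et (k i) \<subseteq> X.exhaust Et m" if "i < n" for i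
      using that X.exhaust_mono unfolding mono_def m_def by (metis Max_ge finite_imageI finite_lessThan imageI lessThan_iff)
    then have m: "x i \<in> X.exhaust Et m" if "i < n" "x \<in> Kn" for x i using k that by blast
    let ?G = "bp - cyl n Vt (\<lambda>_. X.exhaust Et m)"
    have "?G \<in> subbase" unfolding subbase_def by (rule UnI2, rule image_eqI[of _ _ "(n, m)"]) auto
    moreover have "\<alpha> \<in> ?G" using \<alpha> False by (auto simp: cyl_def)
    ultimately have "has_nbhd \<alpha> ?G" by (rule has_nbhd_subbase)
    then show ?thesis
    proof (rule has_nbhd_mono, intro subsetI)
      fix \<beta> assume \<beta>: "\<beta> \<in> ?G"
      have "restrict (path_edge \<beta>) {..<n} \<notin> Kn" if "enat n \<le> path_length \<beta>"
      proof
        assume "restrict (path_edge \<beta>) {..<n} \<in> Kn"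
        then have "path_edge \<beta> i \<in> X.exhaust Et m" if "i < n" for i using m[OF that] that by fastforce
        then have "\<beta> \<in> cyl n Vt (\<lambda>_. X.exhaust Et m)"
          using \<beta> that path_range_in by (auto simp: cyl_def)
        with \<beta> show False by simp
      qed
      with \<beta> iff show "\<beta> \<in> {\<beta> \<in> bp. enat n \<le> path_length \<beta> \<longrightarrow> Edges (map (path_edge \<beta>) [0..<n]) \<notin> K}"
        by blast
    qed
  qed
qed

lemma has_nbhd_basic:
  assumes U: "openin (finite_path_topology E) U" and K: "compactin (finite_path_topology E) K"
    and \<alpha>: "\<alpha> \<in> cylinder E U - cylinder E K"
  shows "has_nbhd \<alpha> (cylinder E U - cylinder E K)"
proof -
  have \<alpha>': "\<alpha> \<in> bp" using \<alpha> by (auto simp: cylinder_def)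
  have 1: "has_nbhd \<alpha> (cylinder E U)"
  proof (cases "Vertex (path_range E \<alpha>) \<in> U")
    case True
    let ?W = "{v \<in> Vt. Vertex v \<in> U}"
    have W: "openin (vertices E) ?W"
      using U by (simp add: openin_finite_path_topology finite_path_open_def)
    have "\<alpha> \<in> cyl 0 ?W (\<lambda>_. Et)" using True \<alpha>' path_range_in by (auto simp: cyl_0)
    then have "has_nbhd \<alpha> (cyl 0 ?W (\<lambda>_. Et))" using W by (intro has_nbhd_cyl) auto
    then show ?thesis by (rule has_nbhd_mono) (auto simp: cyl_0 cylinder_def)
  next
    case False
    then obtain n where n: "n \<ge> 1" "enat n \<le> path_length \<alpha>" "Edges (map (path_edge \<alpha>) [0..<n]) \<in> U"
      using \<alpha> unfolding cylinder_eq by auto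
    let ?O = "{x \<in> topspace (path_space E n). Edges (map x [0..<n]) \<in> U}"
    have op: "openin (path_space E n) ?O"
      using U n(1) by (simp add: openin_finite_path_topology finite_path_open_def)
    have "restrict (path_edge \<alpha>) {..<n} \<in> ?O"
      using prefix_in_path_space[OF \<alpha>' n(2)] n(3) by (simp add: map_restrict_prefix)
    from has_nbhd_prefix[OF \<alpha>' n(2) op this] show ?thesis
    proof (rule has_nbhd_mono)
      show "{\<beta> \<in> bp. enat n \<le> path_length \<beta> \<and> restrict (path_edge \<beta>) {..<n} \<in> ?O} \<subseteq> cylinder E U"
        unfolding cylinder_eq using n(1) by (auto simp: map_restrict_prefix)
    qed
  qed
  obtain N where N: "K \<subseteq> (\<Union>n\<le>N. graded n)" using compact_graded_bound[OF K] .
  let ?A = "\<lambda>n. if n = 0 then {\<beta> \<in> bp. Vertex (path_range E \<beta>) \<notin> K}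
    else {\<beta> \<in> bp. enat n \<le> path_length \<beta> \<longrightarrow> Edges (map (path_edge \<beta>) [0..<n]) \<notin> K}"
  have "has_nbhd \<alpha> (?A n)" for n
    using \<alpha> has_nbhd_avoid_vertices[OF K \<alpha>'] has_nbhd_avoid_edges[OF K \<alpha>', of n]
    unfolding cylinder_eq by auto
  then have "has_nbhd \<alpha> (bp \<inter> (\<Inter>n\<in>{..N}. ?A n))" by (intro has_nbhd_INT) auto
  then have "has_nbhd \<alpha> (cylinder E U \<inter> (bp \<inter> (\<Inter>n\<in>{..N}. ?A n)))" by (rule has_nbhd_Int[OF 1])
  then show ?thesis
  proof (rule has_nbhd_mono, intro subsetI)
    fix \<beta> assume \<beta>: "\<beta> \<in> cylinder E U \<inter> (bp \<inter> (\<Inter>n\<in>{..N}. ?A n))"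
    have "Vertex (path_range E \<beta>) \<notin> K" using \<beta> by (auto dest: bspec[of _ _ 0])
    moreover have "Edges (map (path_edge \<beta>) [0..<n]) \<notin> K" if "n \<ge> 1" "enat n \<le> path_length \<beta>" for n
    proof
      assume a: "Edges (map (path_edge \<beta>) [0..<n]) \<in> K"
      then have "n \<le> N" using N by (auto simp: graded_def)
      then have "\<beta> \<in> ?A n" using \<beta> by blast
      then show False using that a by simp
    qed
    ultimately show "\<beta> \<in> cylinder E U - cylinder E K" using \<beta> unfolding cylinder_eq by blast
  qed
qed

text \<open>The topology of the boundary path space is thus contained in the one generated by the countable
  subbase. This gives both the description of the Borel sets and the reduction of compactness to
  covers by subbasic sets.\<close>

lemma has_nbhd_open:
  assumes "openin bps G" "\<alpha> \<in> G" shows "has_nbhd \<alpha> G"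
proof -
  have "generate_topology_on {cylinder E U - cylinder E K | U K.
     openin (finite_path_topology E) U \<and> compactin (finite_path_topology E) K} G"
    using assms(1) unfolding boundary_path_space_def by (simp add: openin_topology_generated_by_iff)
  then show ?thesis using assms(2)
  proof (induction arbitrary: \<alpha>)
    case (Int a b)
    then show ?case using has_nbhd_Int by blast
  next
    case (UN K)
    then show ?case using has_nbhd_mono by (metis Union_iff Union_upper)
  next
    case (Basis s)
    then show ?case using has_nbhd_basic by blast
  qed simp
qed

section \<open>Borel sets of boundary paths\<close>

definition borel_cyls :: "('v, 'e) gpath set set" where
  "borel_cyls = {cyl n B A | n B A. B \<in> sets (borel_of (vertices E)) \<and> (\<forall>i. A i \<in> sets (borel_of (edges E)))}"

lemma length_ge_eq_cyl: "{\<alpha> \<in> bp. enat n \<le> path_length \<alpha>} = cyl n Vt (\<lambda>_. Et)"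
proof -
  have "path_edge \<alpha> i \<in> Et" if "\<alpha> \<in> bp" "enat n \<le> path_length \<alpha>" "i < n" for \<alpha> i
    using path_edge_in[OF that(1), of i] that by (metis enat_ord_simps(2) less_le_trans)
  then show ?thesis using path_range_in by (auto simp: cyl_def)
qed

lemma path_edge_borel:
  assumes "A \<in> sets (borel_of (edges E))"
  shows "{\<alpha> \<in> bp. enat i < path_length \<alpha> \<and> path_edge \<alpha> i \<in> A} \<in> sets (borel_of bps)"
proof -
  have suc: "enat i < L \<longleftrightarrow> enat (Suc i) \<le> L" for L by (cases L) auto
  have len: "{\<alpha> \<in> bp. enat i < path_length \<alpha>} \<in> sets (borel_of bps)"
    unfolding suc length_ge_eq_cyl by (intro openin_borel_of openin_cyl) auto
  have "A \<in> sigma_sets Et {U. openin (edges E) U}" using assms by (simp add: sets_borel_of)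
  then show ?thesis
  proof induction
    case (Basic U)
    have "{\<alpha> \<in> bp. enat i < path_length \<alpha> \<and> path_edge \<alpha> i \<in> U} =
        cyl (Suc i) Vt (\<lambda>j. if j = i then U else Et)"
    proof (intro equalityI subsetI)
      fix \<alpha> assume "\<alpha> \<in> {\<alpha> \<in> bp. enat i < path_length \<alpha> \<and> path_edge \<alpha> i \<in> U}"
      then have \<alpha>: "\<alpha> \<in> bp" "enat (Suc i) \<le> path_length \<alpha>" "path_edge \<alpha> i \<in> U" using suc by auto
      have "path_edge \<alpha> j \<in> (if j = i then U else Et)" if "j < Suc i" for j
        using \<alpha> that path_edge_in[OF \<alpha>(1), of j] by (metis enat_ord_simps(2) less_le_trans)
      then show "\<alpha> \<in> cyl (Suc i) Vt (\<lambda>j. if j = i then U else Et)"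
        using \<alpha>(1,2) path_range_in unfolding cyl_def by blast
    next
      fix \<alpha> assume "\<alpha> \<in> cyl (Suc i) Vt (\<lambda>j. if j = i then U else Et)"
      then have "\<alpha> \<in> bp" "enat (Suc i) \<le> path_length \<alpha>" "path_edge \<alpha> i \<in> (if i = i then U else Et)"
        unfolding cyl_def by blast+
      then show "\<alpha> \<in> {\<alpha> \<in> bp. enat i < path_length \<alpha> \<and> path_edge \<alpha> i \<in> U}" using suc by simp
    qed
    moreover have "openin bps (cyl (Suc i) Vt (\<lambda>j. if j = i then U else Et))"
      using Basic by (intro openin_cyl) auto
    ultimately show ?case using openin_borel_of by metis
  next
    case (Compl A)
    have "{\<alpha> \<in> bp. enat i < path_length \<alpha> \<and> path_edge \<alpha> i \<in> Et - A} =
      {\<alpha> \<in> bp. enat i < path_length \<alpha>} - {\<alpha> \<in> bp. enat i < path_length \<alpha> \<and> path_edge \<alpha> i \<in> A}"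
      using path_edge_in by auto
    then show ?case using len Compl by auto
  next
    case (Union A)
    have "{\<alpha> \<in> bp. enat i < path_length \<alpha> \<and> path_edge \<alpha> i \<in> (\<Union>n. A n)} =
      (\<Union>n. {\<alpha> \<in> bp. enat i < path_length \<alpha> \<and> path_edge \<alpha> i \<in> A n})" by auto
    then show ?case using Union by auto
  qed auto
qed

lemma path_range_measurable: "path_range E \<in> borel_of bps \<rightarrow>\<^sub>M borel_of (vertices E)"
  by (rule continuous_map_borel_of_measurable[OF path_range_continuous])

lemma cyl_borel:
  assumes B: "B \<in> sets (borel_of (vertices E))" and A: "\<And>i. i < n \<Longrightarrow> A i \<in> sets (borel_of (edges E))"
  shows "cyl n B A \<in> sets (borel_of bps)"
proof -
  have a: "path_range E -` B \<inter> space (borel_of bps) \<in> sets (borel_of bps)"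
    using measurable_sets[OF path_range_measurable B] .
  have b: "cyl n Vt (\<lambda>_. Et) \<in> sets (borel_of bps)" by (intro openin_borel_of openin_cyl) auto
  have c: "space (borel_of bps) \<inter> (\<Inter>i\<in>{..<n}. {\<alpha> \<in> bp. enat i < path_length \<alpha> \<and> path_edge \<alpha> i \<in> A i}) \<in> sets (borel_of bps)"
  proof (cases "n = 0")
    case True
    then show ?thesis using sets.top[of "borel_of bps"] by simp
  next
    case False
    then have "(\<Inter>i\<in>{..<n}. {\<alpha> \<in> bp. enat i < path_length \<alpha> \<and> path_edge \<alpha> i \<in> A i}) \<in> sets (borel_of bps)"
      using path_edge_borel A by (intro sets.finite_INT) auto
    then show ?thesis by (rule sets.Int[OF sets.top])
  qed
  have eq: "cyl n B A = (path_range E -` B \<inter> space (borel_of bps)) \<inter> cyl n Vt (\<lambda>_. Et) \<inter>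
    (space (borel_of bps) \<inter> (\<Inter>i\<in>{..<n}. {\<alpha> \<in> bp. enat i < path_length \<alpha> \<and> path_edge \<alpha> i \<in> A i}))"
  proof -
    have "enat i < L" if "i < n" "enat n \<le> L" for i L using that by (metis enat_ord_simps(2) less_le_trans)
    then show ?thesis
      unfolding length_ge_eq_cyl[symmetric] cyl_def space_borel_of topspace_boundary_path_space
      using path_range_in path_edge_in by auto
  qed
  show ?thesis unfolding eq by (rule sets.Int[OF sets.Int[OF a b] c])
qed

lemma cyl_in_borel_cyls:
  "B \<in> sets (borel_of (vertices E)) \<Longrightarrow> (\<And>i. A i \<in> sets (borel_of (edges E))) \<Longrightarrow> cyl n B A \<in> borel_cyls"
  unfolding borel_cyls_def by blast

lemma borel_cyls_Pow: "borel_cyls \<subseteq> Pow bp"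
  using cyl_subset by (auto simp: borel_cyls_def)

lemma subbase_generated: "subbase \<subseteq> sigma_sets bp borel_cyls"
proof -
  have 1: "cyl n B A \<in> sigma_sets bp borel_cyls"
    if "B \<in> sets (borel_of (vertices E))" "\<And>i. A i \<in> sets (borel_of (edges E))" for n B A
    using that by (intro sigma_sets.Basic) (auto simp: borel_cyls_def)
  have "cyl (length ls) (Y.cbase j) (\<lambda>i. X.cbase (ls ! i)) \<in> sigma_sets bp borel_cyls" for j ls
    using X.cbase_open Y.cbase_open by (intro 1 openin_borel_of) auto
  moreover have "bp - cyl n Vt (\<lambda>_. X.exhaust Et k) \<in> sigma_sets bp borel_cyls" for n k
    using X.compactin_borel_of[OF X.exhaust_compact] openin_borel_of[OF openin_topspace]
    by (intro sigma_sets.Compl 1) auto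
  ultimately show ?thesis by (auto simp: subbase_def)
qed

text \<open>A countable subbase makes every open set a countable union of finite intersections of subbasic
  sets.\<close>

lemma sets_borel_of_bps: "sets (borel_of bps) = sigma_sets bp borel_cyls"
proof
  interpret S: sigma_algebra bp "sigma_sets bp borel_cyls"
    by (rule sigma_algebra_sigma_sets[OF borel_cyls_Pow])
  have "G \<in> sigma_sets bp borel_cyls" if G: "openin bps G" for G
  proof -
    define \<F> where "\<F> = {F. F \<subseteq> subbase \<and> finite F \<and> bp \<inter> \<Inter>F \<subseteq> G}"
    have "countable \<F>"
      using countable_Collect_finite_subset[OF countable_subbase]
      by (rule countable_subset[rotated]) (auto simp: \<F>_def)
    moreover have "bp \<inter> \<Inter>F \<in> sigma_sets bp borel_cyls" if "F \<in> \<F>" for F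
    proof (cases "F = {}")
      case False
      then have "\<Inter>F \<in> sigma_sets bp borel_cyls"
        using that subbase_generated S.finite_INT[of F "\<lambda>x. x"] by (auto simp: \<F>_def)
      then show ?thesis by auto
    qed auto
    ultimately have "(\<Union>F\<in>\<F>. bp \<inter> \<Inter>F) \<in> sigma_sets bp borel_cyls"
      by (intro S.countable_UN'') auto
    moreover have "(\<Union>F\<in>\<F>. bp \<inter> \<Inter>F) = G"
    proof
      show "G \<subseteq> (\<Union>F\<in>\<F>. bp \<inter> \<Inter>F)"
      proof
        fix \<alpha> assume \<alpha>: "\<alpha> \<in> G"
        have "\<alpha> \<in> bp" using openin_subset[OF G] \<alpha> topspace_boundary_path_space by blast
        then show "\<alpha> \<in> (\<Union>F\<in>\<F>. bp \<inter> \<Inter>F)"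
          using has_nbhd_open[OF G \<alpha>] unfolding has_nbhd_def \<F>_def by auto
      qed
    qed (auto simp: \<F>_def)
    ultimately show ?thesis by simp
  qed
  then show "sets (borel_of bps) \<subseteq> sigma_sets bp borel_cyls"
    unfolding sets_borel_of topspace_boundary_path_space by (intro S.sigma_sets_subset) auto
  have "borel_cyls \<subseteq> sets (borel_of bps)" using cyl_borel by (auto simp: borel_cyls_def)
  from sets.sigma_sets_subset[OF this] show "sigma_sets bp borel_cyls \<subseteq> sets (borel_of bps)"
    by (simp add: topspace_boundary_path_space)
qed

lemma Int_stable_borel_cyls: "Int_stable borel_cyls"
  unfolding Int_stable_def
proof (intro ballI)
  fix a b assume "a \<in> borel_cyls" "b \<in> borel_cyls"
  then obtain n B A m B' A' where *: "a = cyl n B A" "B \<in> sets (borel_of (vertices E))"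
    "\<forall>i. A i \<in> sets (borel_of (edges E))" "b = cyl m B' A'" "B' \<in> sets (borel_of (vertices E))"
    "\<forall>i. A' i \<in> sets (borel_of (edges E))" unfolding borel_cyls_def by blast
  have "Et \<in> sets (borel_of (edges E))" by (metis sets.top space_borel_of)
  then show "a \<inter> b \<in> borel_cyls"
    using *(2,3,5,6) unfolding *(1,4) cyl_Int by (intro cyl_in_borel_cyls) auto
qed

section \<open>Compact sets of boundary paths\<close>

lemma openin_Int_INT_finite:
  assumes "finite F" "openin T W0" "\<And>e. e \<in> F \<Longrightarrow> openin T (W e)"
  shows "openin T (W0 \<inter> (\<Inter>e\<in>F. W e))"
  using assms
proof (induction F)
  case (insert e F)
  then have "openin T (W e \<inter> (W0 \<inter> (\<Inter>e\<in>F. W e)))" by (rule_tac openin_Int) auto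
  then show ?case by (simp add: Int_ac)
qed auto

text \<open>What regularity contributes to compactness: no boundary path ends near \<open>w\<close>, and if a path passes
  near \<open>w\<close>, then its next edge lies in a fixed compact set.\<close>

lemma regular_nbhd:
  assumes "w \<in> regular_vertices E"
  obtains W K where "openin (vertices E) W" "w \<in> W" "compactin (edges E) K" "W \<subseteq> regular_vertices E"
    "\<And>e. e \<in> Et \<Longrightarrow> rng E e \<in> W \<Longrightarrow> e \<in> K"
proof -
  obtain W where W: "openin (vertices E) W" "w \<in> W" "compactin (vertices E) (vertices E closure_of W)"
    "compactin (edges E) (rng_preimage E (vertices E closure_of W))" "rng E ` rng_preimage E W = W"
    using assms unfolding regular_vertices_def by blast
  have "W \<subseteq> regular_vertices E"
    using W openin_subset[OF W(1)] unfolding regular_vertices_def by blast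
  moreover have "e \<in> rng_preimage E (vertices E closure_of W)" if "e \<in> Et" "rng E e \<in> W" for e
    using that closure_of_subset[OF openin_subset[OF W(1)]] by (auto simp: rng_preimage_def)
  ultimately show thesis using that W by blast
qed

text \<open>Suppose that no finite part of the cover works. Call a finite path bad if none of its basic
  neighbourhoods is covered finitely. A bad vertex exists by compactness of \<open>K0\<close>. Every bad path has
  a bad extension by one edge: if its source is regular, the paths through its neighbourhood
  continue with an edge from a compact set; if its source is singular, it is itself a boundary
  path, and the member of the cover that contains it can only be the complement of a longer
  compact cylinder, so that again only edges from a compact set matter. In the limit one obtains
  an infinite path with bad initial segments, although a member of the cover that contains it
  covers a neighbourhood of one of them.\<close>

lemma finite_subcover_range:
  assumes K0: "compactin (vertices E) K0" and C: "C \<subseteq> subbase" and cover: "cyl 0 K0 (\<lambda>_. Et) \<subseteq> \<Union>C"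
  shows "\<exists>C'. finite C' \<and> C' \<subseteq> C \<and> cyl 0 K0 (\<lambda>_. Et) \<subseteq> \<Union>C'"
proof (rule ccontr)
  assume neg: "\<not> (\<exists>C'. finite C' \<and> C' \<subseteq> C \<and> cyl 0 K0 (\<lambda>_. Et) \<subseteq> \<Union>C')"
  let ?Z = "cyl 0 K0 (\<lambda>_. Et)"
  have K0V: "K0 \<subseteq> Vt" using compactin_subset_topspace[OF K0] .
  \<comment> \<open>Being covered by finitely many members of the cover.\<close>
  define fc where "fc S \<longleftrightarrow> (\<exists>C'. finite C' \<and> C' \<subseteq> C \<and> S \<inter> ?Z \<subseteq> \<Union>C')" for S
  have fc_mono: "fc T" if "fc S" "T \<subseteq> S" for S T
    using that unfolding fc_def by (meson Int_mono order_refl subset_trans)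
  have fc_Un: "fc (S \<union> T)" if ST: "fc S" "fc T" for S T
  proof -
    obtain C1 C2 where "finite C1" "C1 \<subseteq> C" "S \<inter> ?Z \<subseteq> \<Union>C1" "finite C2" "C2 \<subseteq> C" "T \<inter> ?Z \<subseteq> \<Union>C2"
      using ST unfolding fc_def by auto
    then show ?thesis unfolding fc_def by (intro exI[of _ "C1 \<union> C2"]) auto
  qed
  have fc_empty: "fc {}" unfolding fc_def by auto
  have fc_UN: "fc (\<Union>e\<in>F. S e)" if "finite F" "\<And>e. e \<in> F \<Longrightarrow> fc (S e)" for F and S :: "'z \<Rightarrow> _"
    using that by (induction F) (auto simp: fc_empty intro: fc_Un)
  have fc_member: "fc S" if "G \<in> C" "S \<subseteq> G" for G S
    using that unfolding fc_def by (intro exI[of _ "{G}"]) auto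
  define nbd where "nbd v es W U \<longleftrightarrow> openin (vertices E) W \<and> v \<in> W \<and>
    (\<forall>i<length es. openin (edges E) (U i) \<and> es ! i \<in> U i)" for v and es :: "'e list" and W U
  define bad where "bad v es \<longleftrightarrow> v \<in> K0 \<and>
    (\<forall>i<length es. es ! i \<in> Et \<and> rng E (es ! i) = vertex_at E v ((!) es) i) \<and>
    (\<forall>W U. nbd v es W U \<longrightarrow> \<not> fc (cyl (length es) W U))" for v es
  have start: "\<exists>v. bad v []"
  proof (rule ccontr)
    assume "\<not> (\<exists>v. bad v [])"
    moreover have "cyl 0 W U = cyl 0 W (\<lambda>_. Et)" for W U by (simp add: cyl_0)
    ultimately have "\<forall>v\<in>K0. \<exists>W. openin (vertices E) W \<and> v \<in> W \<and> fc (cyl 0 W (\<lambda>_. Et))"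
      unfolding bad_def nbd_def by (metis less_nat_zero_code list.size(3))
    then obtain W where W: "\<And>v. v \<in> K0 \<Longrightarrow> openin (vertices E) (W v) \<and> v \<in> W v \<and> fc (cyl 0 (W v) (\<lambda>_. Et))"
      by metis
    have "K0 \<subseteq> \<Union> (W ` K0)" using W by auto
    moreover have "\<forall>U\<in>W ` K0. openin (vertices E) U" using W by auto
    ultimately obtain \<F> where \<F>: "finite \<F>" "\<F> \<subseteq> W ` K0" "K0 \<subseteq> \<Union>\<F>"
      using K0 unfolding compactin_def by metis
    then obtain F where F: "finite F" "F \<subseteq> K0" "K0 \<subseteq> \<Union> (W ` F)"
      using finite_subset_image[OF \<F>(1,2)] by metis
    have "fc (\<Union>v\<in>F. cyl 0 (W v) (\<lambda>_. Et))" using F W by (intro fc_UN) auto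
    moreover have "?Z \<subseteq> (\<Union>v\<in>F. cyl 0 (W v) (\<lambda>_. Et))" using F by (auto simp: cyl_0)
    ultimately have "fc ?Z" by (rule fc_mono)
    then show False using neg unfolding fc_def by auto
  qed
  \<comment> \<open>Otherwise every edge \<open>e\<close> of \<open>K\<close> has a neighbourhood such that the paths near \<open>es\<close> that continue
    with an edge from it are finitely covered: by assumption if \<open>e\<close> extends \<open>es\<close>, and because
    there are none, by the Hausdorff property, if it does not.\<close>
  have extend: "\<exists>e. bad v (es @ [e])"
    if bad: "bad v es" and K: "compactin (edges E) K" and nbd0: "nbd v es W0 U0"
      and fc0: "fc {\<alpha> \<in> cyl (length es) W0 U0. \<not> (enat (length es) < path_length \<alpha> \<and> path_edge \<alpha> (length es) \<in> K)}"
    for v es K W0 U0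
  proof (rule ccontr)
    assume no: "\<not> (\<exists>e. bad v (es @ [e]))"
    let ?n = "length es"
    have KE: "K \<subseteq> Et" using compactin_subset_topspace[OF K] .
    have badD: "v \<in> K0" "\<And>i. i < ?n \<Longrightarrow> es ! i \<in> Et" "\<And>i. i < ?n \<Longrightarrow> rng E (es ! i) = vertex_at E v ((!) es) i"
      using bad unfolding bad_def by auto
    have "\<exists>Ue W U. openin (edges E) Ue \<and> e \<in> Ue \<and> nbd v es W U \<and>
        fc {\<alpha> \<in> cyl ?n W U. enat ?n < path_length \<alpha> \<and> path_edge \<alpha> ?n \<in> Ue}" if e: "e \<in> K" for e
    proof (cases "rng E e = vertex_at E v ((!) es) ?n")
      case True
      have "(es @ [e]) ! i \<in> Et \<and> rng E ((es @ [e]) ! i) = vertex_at E v ((!) (es @ [e])) i" if "i < length (es @ [e])" for i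
      proof (cases "i = ?n")
        case i: True
        have "vertex_at E v ((!) (es @ [e])) ?n = vertex_at E v ((!) es) ?n"
          by (cases ?n) (auto simp: nth_append)
        then show ?thesis using i e KE True by auto
      next
        case False
        then have "i < ?n" using that by simp
        moreover have "vertex_at E v ((!) (es @ [e])) i = vertex_at E v ((!) es) i"
          using \<open>i < ?n\<close> by (cases i) (auto simp: nth_append)
        ultimately show ?thesis using badD by (auto simp: nth_append)
      qed
      then obtain W U where WU: "nbd v (es @ [e]) W U" "fc (cyl (Suc ?n) W U)"
        using no badD(1) unfolding bad_def by (metis length_append_singleton)
      have "nbd v es W U" using WU(1) unfolding nbd_def by (auto simp: nth_append split: if_splits)
      moreover have "openin (edges E) (U ?n)" "e \<in> U ?n" using WU(1) unfolding nbd_def by (auto dest: spec[of _ ?n])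
      moreover have "{\<alpha> \<in> cyl ?n W U. enat ?n < path_length \<alpha> \<and> path_edge \<alpha> ?n \<in> U ?n} \<subseteq> cyl (Suc ?n) W U"
        by (auto simp: cyl_def less_Suc_eq Suc_ile_eq)
      ultimately show ?thesis using WU(2) fc_mono by blast
    next
      case False
      have "vertex_at E v ((!) es) ?n \<in> Vt"
        using badD K0V src_in by (cases ?n) auto
      moreover have "rng E e \<in> Vt" using rng_in e KE by blast
      ultimately obtain P Q where PQ: "openin (vertices E) P" "openin (vertices E) Q" "vertex_at E v ((!) es) ?n \<in> P"
        "rng E e \<in> Q" "disjnt P Q"
        using Y.hd False unfolding Hausdorff_space_def by metis
      let ?U = "\<lambda>i. if Suc i = ?n then {e \<in> Et. src E e \<in> P} else Et"
      let ?W = "if ?n = 0 then P else Vt"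
      have "openin (edges E) {e \<in> Et. src E e \<in> P}" using s_continuous PQ(1) unfolding continuous_map_def by blast
      then have n1: "nbd v es ?W ?U"
        using PQ(1,3) badD K0V unfolding nbd_def by (auto simp: vertex_at_def split: nat.splits)
      have op: "openin (edges E) {e \<in> Et. rng E e \<in> Q}" using rng_continuous PQ(2) unfolding continuous_map_def by blast
      have "{\<alpha> \<in> cyl ?n ?W ?U. enat ?n < path_length \<alpha> \<and> path_edge \<alpha> ?n \<in> {e \<in> Et. rng E e \<in> Q}} = {}"
      proof (rule ccontr)
        assume "\<not> ?thesis"
        then obtain \<alpha> where \<alpha>: "\<alpha> \<in> cyl ?n ?W ?U" "enat ?n < path_length \<alpha>" "rng E (path_edge \<alpha> ?n) \<in> Q" by blast
        have "vertex_at E (path_range E \<alpha>) (path_edge \<alpha>) ?n \<in> P"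
          using \<alpha>(1) by (cases ?n) (auto simp: cyl_def)
        then show False using rng_path_edge[OF _ \<alpha>(2)] \<alpha>(1,3) PQ(5) by (auto simp: cyl_def disjnt_iff)
      qed
      then have "fc {\<alpha> \<in> cyl ?n ?W ?U. enat ?n < path_length \<alpha> \<and> path_edge \<alpha> ?n \<in> {e \<in> Et. rng E e \<in> Q}}"
        using fc_empty by (rule ssubst)
      moreover have "e \<in> {e \<in> Et. rng E e \<in> Q}" using PQ(4) e KE by blast
      ultimately show ?thesis using op n1 by blast
    qed
    then have "\<forall>e. \<exists>Ue W U. e \<in> K \<longrightarrow> openin (edges E) Ue \<and> e \<in> Ue \<and> nbd v es W U \<and>
        fc {\<alpha> \<in> cyl ?n W U. enat ?n < path_length \<alpha> \<and> path_edge \<alpha> ?n \<in> Ue}" by blast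
    from this[unfolded choice_iff]
    obtain Ue W U where WU: "\<And>e. e \<in> K \<Longrightarrow> openin (edges E) (Ue e)" "\<And>e. e \<in> K \<Longrightarrow> e \<in> Ue e"
      "\<And>e. e \<in> K \<Longrightarrow> nbd v es (W e) (U e)"
      "\<And>e. e \<in> K \<Longrightarrow> fc {\<alpha> \<in> cyl ?n (W e) (U e). enat ?n < path_length \<alpha> \<and> path_edge \<alpha> ?n \<in> Ue e}"
      by blast
    have "K \<subseteq> \<Union> (Ue ` K)" using WU by auto
    moreover have "\<forall>U\<in>Ue ` K. openin (edges E) U" using WU by auto
    ultimately obtain \<F> where \<F>: "finite \<F>" "\<F> \<subseteq> Ue ` K" "K \<subseteq> \<Union>\<F>"
      using K unfolding compactin_def by metis
    then obtain F where F: "finite F" "F \<subseteq> K" "K \<subseteq> \<Union> (Ue ` F)"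
      using finite_subset_image[OF \<F>(1,2)] by metis
    let ?W = "W0 \<inter> (\<Inter>e\<in>F. W e)"
    let ?U = "\<lambda>i. U0 i \<inter> (\<Inter>e\<in>F. U e i)"
    have "nbd v es ?W ?U"
      using nbd0 WU(3) F(2) unfolding nbd_def
      by (intro conjI allI impI openin_Int_INT_finite[OF F(1)]) blast+
    moreover have "fc (cyl ?n ?W ?U)"
    proof (rule fc_mono)
      show "fc ({\<alpha> \<in> cyl ?n W0 U0. \<not> (enat ?n < path_length \<alpha> \<and> path_edge \<alpha> ?n \<in> K)} \<union>
        (\<Union>e\<in>F. {\<alpha> \<in> cyl ?n (W e) (U e). enat ?n < path_length \<alpha> \<and> path_edge \<alpha> ?n \<in> Ue e}))"
        using WU(4) F(1,2) by (intro fc_Un fc_UN fc0) auto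
      show "cyl ?n ?W ?U \<subseteq> {\<alpha> \<in> cyl ?n W0 U0. \<not> (enat ?n < path_length \<alpha> \<and> path_edge \<alpha> ?n \<in> K)} \<union>
        (\<Union>e\<in>F. {\<alpha> \<in> cyl ?n (W e) (U e). enat ?n < path_length \<alpha> \<and> path_edge \<alpha> ?n \<in> Ue e})"
      proof
        fix \<alpha> assume \<alpha>: "\<alpha> \<in> cyl ?n ?W ?U"
        then have 0: "\<alpha> \<in> cyl ?n W0 U0" and F': "\<And>e. e \<in> F \<Longrightarrow> \<alpha> \<in> cyl ?n (W e) (U e)"
          by (auto simp: cyl_def)
        show "\<alpha> \<in> {\<alpha> \<in> cyl ?n W0 U0. \<not> (enat ?n < path_length \<alpha> \<and> path_edge \<alpha> ?n \<in> K)} \<union>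
          (\<Union>e\<in>F. {\<alpha> \<in> cyl ?n (W e) (U e). enat ?n < path_length \<alpha> \<and> path_edge \<alpha> ?n \<in> Ue e})"
        proof (cases "enat ?n < path_length \<alpha> \<and> path_edge \<alpha> ?n \<in> K")
          case True
          then obtain e where "e \<in> F" "path_edge \<alpha> ?n \<in> Ue e" using F(3) by blast
          then show ?thesis using True F' by blast
        qed (use 0 in blast)
      qed
    qed
    ultimately show False using bad unfolding bad_def by blast
  qed
  \<comment> \<open>A member of the cover that only restricts edges already present in a bad path would contain a
    neighbourhood of it.\<close>
  have close_cyl: False
    if bad: "bad v es" and G: "cyl m W U \<in> C" and WU: "openin (vertices E) W" "\<And>i. i < m \<Longrightarrow> openin (edges E) (U i)"
      and m: "m \<le> length es" and in_G: "v \<in> W" "\<And>i. i < m \<Longrightarrow> es ! i \<in> U i" for v es m W U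
  proof -
    let ?U = "\<lambda>i. if i < m then U i else Et"
    have "nbd v es W ?U" using WU in_G bad unfolding nbd_def bad_def by auto
    moreover have "fc (cyl (length es) W ?U)"
    proof (rule fc_member[OF G], rule subsetI)
      fix \<alpha> assume \<alpha>: "\<alpha> \<in> cyl (length es) W ?U"
      then have \<alpha>': "enat (length es) \<le> path_length \<alpha>"
        "\<And>i. i < length es \<Longrightarrow> path_edge \<alpha> i \<in> (if i < m then U i else Et)"
        unfolding cyl_def by blast+
      have "path_edge \<alpha> i \<in> U i" if "i < m" for i
        using \<alpha>'(2)[of i] that m by simp
      moreover have "enat m \<le> path_length \<alpha>"
        using \<alpha>'(1) m by (meson enat_ord_simps(1) order_trans)
      ultimately show "\<alpha> \<in> cyl m W U" using \<alpha> unfolding cyl_def by auto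
    qed
    ultimately show False using bad unfolding bad_def by blast
  qed
  have close_compl: False
    if bad: "bad v es" and G: "bp - cyl m Vt (\<lambda>_. L) \<in> C" and L: "compactin (edges E) L"
      and i: "i < m" "i < length es" "es ! i \<notin> L" for v es m L i
  proof -
    let ?U = "\<lambda>j. if j = i then Et - L else Et"
    have "openin (edges E) (Et - L)" using compactin_imp_closedin[OF X.hd L] by blast
    then have "nbd v es Vt ?U" using i bad K0V unfolding nbd_def bad_def by auto
    moreover have "fc (cyl (length es) Vt ?U)"
    proof (rule fc_member[OF G], rule subsetI)
      fix \<alpha> assume \<alpha>: "\<alpha> \<in> cyl (length es) Vt ?U"
      then have "path_edge \<alpha> i \<in> ?U i" using i(2) unfolding cyl_def by blast
      then show "\<alpha> \<in> bp - cyl m Vt (\<lambda>_. L)" using \<alpha> i(1) by (auto simp: cyl_def)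
    qed
    ultimately show False using bad unfolding bad_def by blast
  qed
  have subbase_cases: "(\<exists>m W U. G = cyl m W U \<and> openin (vertices E) W \<and> (\<forall>i<m. openin (edges E) (U i))) \<or>
      (\<exists>m L. G = bp - cyl m Vt (\<lambda>_. L) \<and> compactin (edges E) L)" if "G \<in> subbase" for G
  proof -
    from that consider j ls where "G = cyl (length ls) (Y.cbase j) (\<lambda>i. X.cbase (ls ! i))"
      | n k where "G = bp - cyl n Vt (\<lambda>_. X.exhaust Et k)" unfolding subbase_def by auto
    then show ?thesis using X.cbase_open Y.cbase_open X.exhaust_compact by cases blast+
  qed
  have step: "\<exists>e. bad v (es @ [e])" if bad: "bad v es" for v es
  proof -
    let ?n = "length es"
    let ?w = "vertex_at E v ((!) es) ?n"
    have badD: "v \<in> K0" "\<And>i. i < ?n \<Longrightarrow> es ! i \<in> Et" "\<And>i. i < ?n \<Longrightarrow> rng E (es ! i) = vertex_at E v ((!) es) i"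
      using bad unfolding bad_def by auto
    have wV: "?w \<in> Vt" using badD K0V src_in by (cases ?n) auto
    show ?thesis
    proof (cases "?w \<in> regular_vertices E")
      case True
      obtain W K where WK: "openin (vertices E) W" "?w \<in> W" "compactin (edges E) K" "W \<subseteq> regular_vertices E"
        "\<And>e. e \<in> Et \<Longrightarrow> rng E e \<in> W \<Longrightarrow> e \<in> K"
        using regular_nbhd[OF True] by metis
      let ?U = "\<lambda>i. if Suc i = ?n then {e \<in> Et. src E e \<in> W} else Et"
      let ?W = "if ?n = 0 then W else Vt"
      have "openin (edges E) {e \<in> Et. src E e \<in> W}" using s_continuous WK(1) unfolding continuous_map_def by blast
      then have n1: "nbd v es ?W ?U"
        using WK(1,2) badD K0V unfolding nbd_def by (auto simp: vertex_at_def split: nat.splits)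
      have "enat ?n < path_length \<alpha> \<and> path_edge \<alpha> ?n \<in> K" if \<alpha>: "\<alpha> \<in> cyl ?n ?W ?U" for \<alpha>
      proof -
        have \<alpha>': "\<alpha> \<in> bp" "enat ?n \<le> path_length \<alpha>" using \<alpha> by (auto simp: cyl_def)
        have w: "vertex_at E (path_range E \<alpha>) (path_edge \<alpha>) ?n \<in> W"
          using \<alpha> by (cases ?n) (auto simp: cyl_def)
        then have "path_length \<alpha> \<noteq> enat ?n"
          using path_end_singular[OF \<alpha>'(1)] WK(4) by (auto simp: singular_vertices_def)
        then have lt: "enat ?n < path_length \<alpha>" using \<alpha>'(2) by simp
        then show ?thesis using rng_path_edge[OF \<alpha>'(1) lt] w WK(5) path_edge_in[OF \<alpha>'(1) lt] by simp
      qed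
      then have "{\<alpha> \<in> cyl ?n ?W ?U. \<not> (enat ?n < path_length \<alpha> \<and> path_edge \<alpha> ?n \<in> K)} = {}" by blast
      then show ?thesis by (intro extend[OF bad WK(3) n1]) (simp only: fc_empty)
    next
      case False
      then have "path_data E (enat ?n) v ((!) es)"
        using badD K0V wV unfolding path_data_def singular_vertices_def by auto
      then obtain \<alpha> where \<alpha>: "\<alpha> \<in> bp" "path_length \<alpha> = enat ?n" "path_range E \<alpha> = v"
        "\<And>i. enat i < enat ?n \<Longrightarrow> path_edge \<alpha> i = es ! i"
        using boundary_path_exists by metis
      have "\<alpha> \<in> ?Z" using \<alpha> badD(1) by (auto simp: cyl_0)
      then obtain G where G: "G \<in> C" "\<alpha> \<in> G" using cover by blast
      from subbase_cases[of G] G(1) C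
      consider (a) m W U where "G = cyl m W U" "openin (vertices E) W" "\<And>i. i < m \<Longrightarrow> openin (edges E) (U i)"
        | (b) m L where "G = bp - cyl m Vt (\<lambda>_. L)" "compactin (edges E) L" by blast
      then show ?thesis
      proof cases
        case a
        have "m \<le> ?n" "v \<in> W" "\<And>i. i < m \<Longrightarrow> path_edge \<alpha> i \<in> U i"
          using G(2) \<alpha>(2,3) unfolding a(1) cyl_def by auto
        moreover from this \<alpha>(4) have "es ! i \<in> U i" if "i < m" for i using that by (metis enat_ord_simps(2) less_le_trans)
        ultimately show ?thesis using close_cyl[OF bad G(1)[unfolded a(1)] a(2,3)] by blast
      next
        case b
        show ?thesis
        proof (cases "m \<le> ?n")
          case True
          then obtain i where "i < m" "path_edge \<alpha> i \<notin> L"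
            using G(2) \<alpha> path_range_in[OF \<alpha>(1)] unfolding b(1) cyl_def by auto
          then show ?thesis
            using close_compl[OF bad G(1)[unfolded b(1)] b(2), of i] \<alpha>(4)[of i] True by auto
        next
          case False
          have n0: "nbd v es Vt (\<lambda>_. Et)" using badD K0V unfolding nbd_def by auto
          have "{\<alpha> \<in> cyl ?n Vt (\<lambda>_. Et). \<not> (enat ?n < path_length \<alpha> \<and> path_edge \<alpha> ?n \<in> L)} \<subseteq> G"
          proof
            fix \<beta> assume \<beta>: "\<beta> \<in> {\<alpha> \<in> cyl ?n Vt (\<lambda>_. Et). \<not> (enat ?n < path_length \<alpha> \<and> path_edge \<alpha> ?n \<in> L)}"
            have "\<beta> \<notin> cyl m Vt (\<lambda>_. L)"
            proof
              assume b: "\<beta> \<in> cyl m Vt (\<lambda>_. L)"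
              then have "enat ?n < path_length \<beta>" using False unfolding cyl_def
                by (metis (mono_tags, lifting) enat_ord_simps(2) less_le_trans mem_Collect_eq not_le)
              moreover have "path_edge \<beta> ?n \<in> L" using b False unfolding cyl_def by auto
              ultimately show False using \<beta> by blast
            qed
            then show "\<beta> \<in> G" using \<beta> cyl_subset unfolding b(1) by blast
          qed
          then show ?thesis using extend[OF bad b(2) n0] fc_member[OF G(1)] by blast
        qed
      qed
    qed
  qed
  obtain v0 where v0: "bad v0 []" using start by blast
  have "\<exists>f. \<forall>n. (bad v0 (f n) \<and> length (f n) = n) \<and> (\<exists>e. f (Suc n) = f n @ [e])"
  proof (rule dependent_nat_choice)
    show "\<exists>x. bad v0 x \<and> length x = 0" using v0 by auto
    show "\<exists>y. (bad v0 y \<and> length y = Suc n) \<and> (\<exists>e. y = x @ [e])" if "bad v0 x \<and> length x = n" for x n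
      using step[of v0 x] that by fastforce
  qed
  then obtain f where f: "\<And>n. bad v0 (f n)" "\<And>n. length (f n) = n" "\<And>n. \<exists>e. f (Suc n) = f n @ [e]" by blast
  \<comment> \<open>The limit of the growing bad paths.\<close>
  define x where "x i = f (Suc i) ! i" for i
  have fx: "f n ! i = x i" if "i < n" for n i
    using that
  proof (induction n)
    case (Suc n)
    then show ?case using f(2)[of n] f(3)[of n] by (cases "i = n") (auto simp: x_def nth_append)
  qed simp
  have "x i \<in> Et \<and> rng E (x i) = vertex_at E v0 x i" for i
  proof -
    have "f (Suc i) ! i \<in> Et \<and> rng E (f (Suc i) ! i) = vertex_at E v0 ((!) (f (Suc i))) i"
      using f(1)[of "Suc i"] f(2)[of "Suc i"] unfolding bad_def by auto
    moreover have "vertex_at E v0 ((!) (f (Suc i))) i = vertex_at E v0 x i"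
      using fx[of _ "Suc i"] by (cases i) auto
    ultimately show ?thesis by (simp add: fx)
  qed
  moreover have v0K: "v0 \<in> K0" using v0 unfolding bad_def by blast
  ultimately have "path_data E \<infinity> v0 x" using K0V unfolding path_data_def by auto
  then obtain \<alpha> where \<alpha>: "\<alpha> \<in> bp" "path_length \<alpha> = \<infinity>" "path_range E \<alpha> = v0"
    "\<And>i. enat i < \<infinity> \<Longrightarrow> path_edge \<alpha> i = x i"
    using boundary_path_exists by metis
  have "\<alpha> \<in> ?Z" using \<alpha> v0K by (auto simp: cyl_0)
  then obtain G where G: "G \<in> C" "\<alpha> \<in> G" using cover by blast
  from subbase_cases[of G] G(1) C
  consider (a) m W U where "G = cyl m W U" "openin (vertices E) W" "\<And>i. i < m \<Longrightarrow> openin (edges E) (U i)"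
    | (b) m L where "G = bp - cyl m Vt (\<lambda>_. L)" "compactin (edges E) L" by blast
  then show False
  proof cases
    case a
    have "v0 \<in> W" "\<And>i. i < m \<Longrightarrow> x i \<in> U i"
      using G(2) \<alpha>(3,4) unfolding a(1) cyl_def by auto
    then show False using close_cyl[OF f(1)[of m] G(1)[unfolded a(1)] a(2,3)] f(2) fx by simp
  next
    case b
    then obtain i where "i < m" "x i \<notin> L"
      using G(2) \<alpha> path_range_in[OF \<alpha>(1)] unfolding b(1) cyl_def by auto
    then show False using close_compl[OF f(1)[of m] G(1)[unfolded b(1)] b(2), of i] f(2) fx by simp
  qed
qed

text \<open>Alexander's subbase theorem reduces the claim to covers by subbasic sets.\<close>

theorem compactin_range_preimage:
  assumes K0: "compactin (vertices E) K0" shows "compactin bps (cyl 0 K0 A)"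
proof -
  let ?Z = "cyl 0 K0 (\<lambda>_. Et)"
  define T where "T = topology (arbitrary union_of (finite intersection_of (\<lambda>x. x \<in> subbase) relative_to ?Z))"
  have tsT: "topspace T = ?Z" unfolding T_def by (rule topspace_subbase)
  have "compact_space T"
  proof (rule Alexander_subbase_alt[where U = ?Z and \<B> = subbase])
    show "?Z \<subseteq> \<Union>subbase"
    proof
      fix \<alpha> assume "\<alpha> \<in> ?Z"
      then have "\<alpha> \<in> bp" by (auto simp: cyl_def)
      then obtain j where "path_range E \<alpha> \<in> Y.cbase j"
        using Y.cbase_nhd[OF openin_topspace path_range_in] by blast
      then have "\<alpha> \<in> cyl (length []) (Y.cbase j) (\<lambda>i. X.cbase ([] ! i))" using \<open>\<alpha> \<in> bp\<close> by (auto simp: cyl_0)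
      moreover have "cyl (length []) (Y.cbase j) (\<lambda>i. X.cbase ([] ! i)) \<in> subbase"
        unfolding subbase_def by (rule UnI1, rule image_eqI[of _ _ "(j, [])"]) auto
      ultimately show "\<alpha> \<in> \<Union>subbase" by blast
    qed
    show "\<exists>C'. finite C' \<and> C' \<subseteq> C \<and> ?Z \<subseteq> \<Union>C'" if "C \<subseteq> subbase" "?Z \<subseteq> \<Union>C" for C
      using finite_subcover_range[OF K0 that] .
  qed (simp add: T_def)
  moreover have "continuous_map T bps (\<lambda>x. x)"
  proof -
    have "openin T {\<alpha> \<in> ?Z. \<alpha> \<in> G}" if G: "openin bps G" for G
    proof (subst openin_subopen, intro ballI)
      fix \<alpha> assume \<alpha>: "\<alpha> \<in> {\<alpha> \<in> ?Z. \<alpha> \<in> G}"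
      then obtain F where F: "F \<subseteq> subbase" "finite F" "\<alpha> \<in> \<Inter>F" "bp \<inter> \<Inter>F \<subseteq> G"
        using has_nbhd_open[OF G, of \<alpha>] unfolding has_nbhd_def by auto
      have "(finite intersection_of (\<lambda>x. x \<in> subbase)) (\<Inter>F)"
        unfolding intersection_of_def using F by (intro exI[of _ F]) auto
      then have "(finite intersection_of (\<lambda>x. x \<in> subbase) relative_to ?Z) (?Z \<inter> \<Inter>F)"
        by (rule relative_to_inc)
      then have "openin T (?Z \<inter> \<Inter>F)" unfolding T_def openin_subbase by (rule arbitrary_union_of_inc)
      then show "\<exists>T'. openin T T' \<and> \<alpha> \<in> T' \<and> T' \<subseteq> {\<alpha> \<in> ?Z. \<alpha> \<in> G}"
        using \<alpha> F(3,4) cyl_subset by (intro exI[of _ "?Z \<inter> \<Inter>F"]) blast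
    qed
    then show ?thesis
      unfolding continuous_map_def tsT topspace_boundary_path_space
      using cyl_subset[of 0 K0 "\<lambda>_. Et"] by auto
  qed
  ultimately have "compactin bps ((\<lambda>x. x) ` ?Z)" using image_compactin tsT unfolding compact_space_def by metis
  moreover have "(\<lambda>x. x) ` ?Z = cyl 0 K0 A" unfolding cyl_0 by simp
  ultimately show ?thesis by metis
qed

end

section \<open>Invariant measures and their range distributions\<close>

context sc_graph
begin

lemma space_borel_bps: "space (borel_of bps) = bp"
  by (simp add: topspace_boundary_path_space)

text \<open>Measures that are finite on compact sets are determined by the integrals of compactly supported
  functions, so the description in the definition of \<^const>\<open>src_pullback\<close> has a unique solution.\<close>

lemma src_pullback_eq:
  assumes \<mu>: "\<mu> \<in> regular_borel_measures (vertices E)"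
  shows "src_pullback E \<mu> = pullback \<mu>"
  unfolding src_pullback_def
proof (rule the_equality)
  show 1: "pullback \<mu> \<in> regular_borel_measures (edges E) \<and>
    (\<forall>h\<in>Cc (edges E). (\<integral>e. h e \<partial>pullback \<mu>) =
        (\<integral>v. (\<Sum>\<^sub>\<infinity>e\<in>{e \<in> Et. src E e = v}. h e) \<partial>\<mu>))"
    using pullback_regular[OF \<mu>] integral_pullback[OF \<mu>] by simp
  show "M = pullback \<mu>" if "M \<in> regular_borel_measures (edges E) \<and>
    (\<forall>h\<in>Cc (edges E). (\<integral>e. h e \<partial>M) =
        (\<integral>v. (\<Sum>\<^sub>\<infinity>e\<in>{e \<in> Et. src E e = v}. h e) \<partial>\<mu>))" for M
    using that 1 by (intro X.regular_borel_measures_eqI_Cc) auto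
qed

definition first_in :: "nat \<Rightarrow> ('v, 'e) gpath set" where
  "first_in j = {\<alpha> \<in> bp. 0 < path_length \<alpha> \<and> path_edge \<alpha> 0 \<in> piece j}"

lemma length_pos_iff: "enat (Suc 0) \<le> L \<longleftrightarrow> 0 < L"
  by (cases L) (auto simp: zero_enat_def)

lemma first_in_eq_cyl: "first_in j = cyl (Suc 0) Vt (\<lambda>_. piece j)"
  using path_range_in by (auto simp: first_in_def cyl_def length_pos_iff)

lemma first_in_borel: "first_in j \<in> sets (borel_of bps)"
  unfolding first_in_eq_cyl by (intro cyl_borel) (auto simp: openin_borel_of)

lemma first_in_disjoint: "\<alpha> \<in> first_in i \<Longrightarrow> \<alpha> \<in> first_in j \<Longrightarrow> i = j"
  using piece_unique by (auto simp: first_in_def)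

lemma first_in_cover: "bp - range Vertex = (\<Union>j. first_in j)"
proof -
  have "\<exists>j. \<alpha> \<in> first_in j" if \<alpha>: "\<alpha> \<in> bp" "0 < path_length \<alpha>" for \<alpha>
    using path_edge_in[OF \<alpha>(1), of 0] \<alpha> piece_cover by (auto simp: first_in_def zero_enat_def)
  then show ?thesis using vertex_iff_length_0 by (auto simp: first_in_def)
qed

lemma cyl_Int_first_in:
  "cyl (Suc n) B A \<inter> first_in j = cyl (Suc n) B (A(0 := A 0 \<inter> piece j))"
proof -
  have "enat (Suc n) \<le> L \<Longrightarrow> 0 < L" for L by (cases L) (auto simp: zero_enat_def)
  then show ?thesis by (auto simp: cyl_def first_in_def)
qed

lemma shift_image_first_in:
  "shift E ` (cyl (Suc n) B A \<inter> first_in j) =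
    cyl n (src E ` {e \<in> A 0 \<inter> piece j. rng E e \<in> B}) (\<lambda>i. A (Suc i))"
  unfolding cyl_Int_first_in by (subst shift_image_cyl[of _ j]) (auto simp: fun_upd_def)

lemma rng_vimage_borel:
  assumes "A \<in> sets (borel_of (edges E))" "B \<in> sets (borel_of (vertices E))"
  shows "{e \<in> A. rng E e \<in> B} \<in> sets (borel_of (edges E))"
proof -
  have "rng E -` B \<inter> space (borel_of (edges E)) \<in> sets (borel_of (edges E))"
    using continuous_map_borel_of_measurable[OF rng_continuous] assms(2) by (rule measurable_sets)
  moreover have "{e \<in> A. rng E e \<in> B} = A \<inter> (rng E -` B \<inter> space (borel_of (edges E)))"
    using sets.sets_into_space[OF assms(1)] by auto
  ultimately show ?thesis using assms(1) by (metis sets.Int)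
qed

lemma src_image_borel:
  assumes "A \<in> sets (borel_of (edges E))" "B \<in> sets (borel_of (vertices E))"
  shows "src E ` {e \<in> A \<inter> piece j. rng E e \<in> B} \<in> sets (borel_of (vertices E))"
proof -
  have "{e \<in> A \<inter> piece j. rng E e \<in> B} = {e \<in> A. rng E e \<in> B} \<inter> piece j" by auto
  then show ?thesis using image_piece_measurable[OF rng_vimage_borel[OF assms]] by metis
qed

text \<open>The same reasoning as for \<open>image_chart_seq_measurable\<close>, with cylinders in place of open sets.\<close>

lemma shift_image_borel_first_in:
  assumes "A \<in> sets (borel_of bps)" shows "shift E ` (A \<inter> first_in j) \<in> sets (borel_of bps)"
proof -
  have inj: "inj_on (shift E) (first_in j)" using inj_on_shift_piece by (simp add: first_in_def)
  have cyl: "shift E ` (cyl n B A \<inter> first_in j) \<in> sets (borel_of bps)"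
    if BA: "B \<in> sets (borel_of (vertices E))" "\<And>i. A i \<in> sets (borel_of (edges E))" for n B A
  proof (cases n)
    case 0
    have "cyl 0 B A \<inter> first_in j = cyl (Suc 0) B (\<lambda>_. Et) \<inter> first_in j"
      using path_edge_in by (auto simp: cyl_def first_in_def length_pos_iff zero_enat_def)
    then show ?thesis
      unfolding 0 using BA openin_borel_of[OF openin_topspace]
      by (simp only: shift_image_first_in) (intro cyl_borel src_image_borel)
  next
    case (Suc m)
    then show ?thesis using BA by (simp only: shift_image_first_in) (intro cyl_borel src_image_borel)
  qed
  have whole: "shift E ` first_in j \<in> sets (borel_of bps)"
  proof -
    have "cyl 0 Vt (\<lambda>_. Et) \<inter> first_in j = first_in j"
      using path_range_in by (auto simp: cyl_0 first_in_def)
    then show ?thesis using cyl[of Vt "\<lambda>_. Et" 0] openin_borel_of[OF openin_topspace] by metis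
  qed
  have "A \<in> sigma_sets bp borel_cyls" using assms by (simp add: sets_borel_of_bps)
  then show ?thesis
  proof induction
    case (Basic A)
    then show ?case using cyl unfolding borel_cyls_def by blast
  next
    case (Compl A)
    have "shift E ` ((bp - A) \<inter> first_in j) = shift E ` first_in j - shift E ` (A \<inter> first_in j)"
      using inj unfolding inj_on_def first_in_def by blast
    then show ?case using whole Compl by auto
  next
    case (Union A)
    have "shift E ` ((\<Union>n. A n) \<inter> first_in j) = (\<Union>n. shift E ` (A n \<inter> first_in j))" by auto
    then show ?case using Union by auto
  qed auto
qed

lemma Int_first_in_cover: "A \<subseteq> bp - range Vertex \<Longrightarrow> (\<Union>j. A \<inter> first_in j) = A"
  unfolding first_in_cover by auto

lemma shift_image_borel:
  assumes "A \<in> sets (borel_of bps)" "A \<subseteq> bp - range Vertex"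
  shows "shift E ` A \<in> sets (borel_of bps)"
proof -
  have "shift E ` A = (\<Union>j. shift E ` (A \<inter> first_in j))"
    using Int_first_in_cover[OF assms(2)] by (metis image_UN)
  then show ?thesis using shift_image_borel_first_in[OF assms(1)] by auto
qed

text \<open>A set on which the shift is injective splits along the pieces that contain the first edge, and the
  images of the parts stay disjoint.\<close>

lemma invariant_measuresI:
  assumes \<nu>: "\<nu> \<in> regular_borel_measures bps"
    and inv: "\<And>A j. A \<in> sets (borel_of bps) \<Longrightarrow> A \<subseteq> first_in j \<Longrightarrow> emeasure \<nu> (shift E ` A) = emeasure \<nu> A"
  shows "\<nu> \<in> invariant_measures E"
proof -
  have sets: "sets \<nu> = sets (borel_of bps)" using \<nu> by (rule regular_borel_measures_sets)
  have "emeasure \<nu> (shift E ` A) = emeasure \<nu> A"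
    if A: "A \<in> sets (borel_of bps)" "A \<subseteq> bp - range Vertex" "inj_on (shift E) A" for A
  proof -
    have dis: "disjoint_family (\<lambda>j. A \<inter> first_in j)"
      using first_in_disjoint by (auto simp: disjoint_family_on_def)
    have dis': "disjoint_family (\<lambda>j. shift E ` (A \<inter> first_in j))"
      unfolding disjoint_family_on_def
    proof (intro ballI impI)
      fix i j :: nat assume "i \<noteq> j"
      then have "A \<inter> first_in i \<inter> (A \<inter> first_in j) = {}" using first_in_disjoint by blast
      then show "shift E ` (A \<inter> first_in i) \<inter> shift E ` (A \<inter> first_in j) = {}"
        using inj_on_image_Int[OF A(3), of "A \<inter> first_in i" "A \<inter> first_in j"] by auto
    qed
    have "emeasure \<nu> (shift E ` A) = emeasure \<nu> (\<Union>j. shift E ` (A \<inter> first_in j))"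
      using Int_first_in_cover[OF A(2)] by (metis image_UN)
    also have "\<dots> = (\<Sum>j. emeasure \<nu> (shift E ` (A \<inter> first_in j)))"
      using shift_image_borel_first_in[OF A(1)] dis' sets by (intro suminf_emeasure[symmetric]) auto
    also have "\<dots> = (\<Sum>j. emeasure \<nu> (A \<inter> first_in j))"
      using A(1) first_in_borel by (intro suminf_cong inv) auto
    also have "\<dots> = emeasure \<nu> (\<Union>j. A \<inter> first_in j)"
      using A(1) first_in_borel dis sets by (intro suminf_emeasure) auto
    finally show ?thesis using Int_first_in_cover[OF A(2)] by simp
  qed
  then show ?thesis using \<nu> by (simp add: invariant_measures_def)
qed

lemma invariant_measuresD:
  assumes "\<nu> \<in> invariant_measures E" "A \<in> sets (borel_of bps)" "A \<subseteq> bp - range Vertex" "inj_on (shift E) A"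
  shows "emeasure \<nu> (shift E ` A) = emeasure \<nu> A"
  using assms unfolding invariant_measures_def by simp

text \<open>This recursion in the number of edge conditions makes an invariant measure computable from its
  push-forward along the range map.\<close>

lemma emeasure_cyl_Suc:
  assumes \<nu>: "\<nu> \<in> invariant_measures E" and B: "B \<in> sets (borel_of (vertices E))"
    and A: "\<And>i. A i \<in> sets (borel_of (edges E))"
  shows "emeasure \<nu> (cyl (Suc n) B A) =
    (\<Sum>j. emeasure \<nu> (cyl n (src E ` {e \<in> A 0 \<inter> piece j. rng E e \<in> B}) (\<lambda>i. A (Suc i))))"
proof -
  have sets: "sets \<nu> = sets (borel_of bps)"
    using \<nu> by (simp add: invariant_measures_def regular_borel_measures_sets)
  have pos: "enat (Suc n) \<le> L \<Longrightarrow> 0 < L" for L by (cases L) (auto simp: zero_enat_def)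
  have sub: "cyl (Suc n) B A \<subseteq> bp - range Vertex"
    unfolding cyl_def using vertex_iff_length_0 pos by auto
  have m: "cyl (Suc n) B A \<in> sets (borel_of bps)" using A B by (intro cyl_borel)
  have dis: "disjoint_family (\<lambda>j. cyl (Suc n) B A \<inter> first_in j)"
    using first_in_disjoint by (auto simp: disjoint_family_on_def)
  have "emeasure \<nu> (cyl (Suc n) B A) = emeasure \<nu> (\<Union>j. cyl (Suc n) B A \<inter> first_in j)"
    using Int_first_in_cover[OF sub] by simp
  also have "\<dots> = (\<Sum>j. emeasure \<nu> (cyl (Suc n) B A \<inter> first_in j))"
    using m first_in_borel dis sets by (intro suminf_emeasure[symmetric]) auto
  also have "\<dots> = (\<Sum>j. emeasure \<nu> (shift E ` (cyl (Suc n) B A \<inter> first_in j)))"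
  proof (rule suminf_cong)
    fix j
    have "inj_on (shift E) (cyl (Suc n) B A \<inter> first_in j)"
      using inj_on_shift_piece[of j] unfolding first_in_def[symmetric] by (rule inj_on_subset) auto
    moreover have "cyl (Suc n) B A \<inter> first_in j \<in> sets (borel_of bps)" using m first_in_borel by blast
    moreover have "cyl (Suc n) B A \<inter> first_in j \<subseteq> bp - range Vertex" using sub by (rule le_infI1)
    ultimately show "emeasure \<nu> (cyl (Suc n) B A \<inter> first_in j) = emeasure \<nu> (shift E ` (cyl (Suc n) B A \<inter> first_in j))"
      by (intro invariant_measuresD[OF \<nu>, symmetric])
  qed
  finally show ?thesis by (simp only: shift_image_first_in)
qed

abbreviation push :: "('v, 'e) gpath measure \<Rightarrow> 'v measure" where
  "push \<nu> \<equiv> distr \<nu> (borel_of (vertices E)) (path_range E)"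

lemma emeasure_push:
  assumes "sets \<nu> = sets (borel_of bps)" "B \<in> sets (borel_of (vertices E))"
  shows "emeasure (push \<nu>) B = emeasure \<nu> (cyl 0 B A)"
proof -
  have sp: "space \<nu> = bp" using assms(1) by (metis sets_eq_imp_space_eq space_borel_bps)
  have m: "path_range E \<in> \<nu> \<rightarrow>\<^sub>M borel_of (vertices E)"
    using path_range_measurable by (simp add: measurable_cong_sets[OF assms(1) refl])
  have "path_range E -` B \<inter> space \<nu> = cyl 0 B A" by (auto simp: sp cyl_0)
  then show ?thesis using emeasure_distr[OF m assms(2)] by simp
qed

lemma emeasure_cyl_unique:
  assumes \<nu>: "\<nu> \<in> invariant_measures E" "\<nu>' \<in> invariant_measures E" and eq: "push \<nu> = push \<nu>'"
    and "B \<in> sets (borel_of (vertices E))" "\<And>i. A i \<in> sets (borel_of (edges E))"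
  shows "emeasure \<nu> (cyl n B A) = emeasure \<nu>' (cyl n B A)"
  using assms(4,5)
proof (induction n arbitrary: B A)
  case 0
  have "sets \<nu> = sets (borel_of bps)" "sets \<nu>' = sets (borel_of bps)"
    using \<nu> by (auto simp: invariant_measures_def regular_borel_measures_sets)
  then show ?case using emeasure_push[of \<nu> B A] emeasure_push[of \<nu>' B A] eq 0 by simp
next
  case (Suc n)
  then show ?case
    by (simp only: emeasure_cyl_Suc[OF \<nu>(1)] emeasure_cyl_Suc[OF \<nu>(2)])
       (intro suminf_cong Suc.IH src_image_borel)
qed

lemma push_regular:
  assumes \<nu>: "\<nu> \<in> regular_borel_measures bps"
  shows "push \<nu> \<in> regular_borel_measures (vertices E)"
proof -
  have "emeasure (push \<nu>) K < \<infinity>" if K: "compactin (vertices E) K" for K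
    using emeasure_push[OF regular_borel_measures_sets[OF \<nu>] Y.compactin_borel_of[OF K], of "\<lambda>_. Et"]
      regular_borel_measures_compact[OF \<nu> compactin_range_preimage[OF K, of "\<lambda>_. Et"]] by simp
  then show ?thesis by (simp add: regular_borel_measures_def)
qed

lemma invariant_measures_regular: "\<nu> \<in> invariant_measures E \<Longrightarrow> \<nu> \<in> regular_borel_measures bps"
  by (simp add: invariant_measures_def)

theorem push_inj_on: "inj_on push (invariant_measures E)"
proof (rule inj_onI)
  fix \<nu> \<nu>' assume \<nu>: "\<nu> \<in> invariant_measures E" "\<nu>' \<in> invariant_measures E" and eq: "push \<nu> = push \<nu>'"
  have sets: "sets \<nu> = sets (borel_of bps)" "sets \<nu>' = sets (borel_of bps)"
    using \<nu> by (auto simp: invariant_measures_def regular_borel_measures_sets)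
  show "\<nu> = \<nu>'"
  proof (rule measure_eqI_generator_eq[OF Int_stable_borel_cyls borel_cyls_Pow])
    show "emeasure \<nu> C = emeasure \<nu>' C" if "C \<in> borel_cyls" for C
      using that emeasure_cyl_unique[OF \<nu> eq] unfolding borel_cyls_def by blast
    show "sets \<nu> = sigma_sets bp borel_cyls" "sets \<nu>' = sigma_sets bp borel_cyls"
      using sets sets_borel_of_bps by auto
    let ?C = "\<lambda>k. cyl 0 (Y.exhaust Vt k) (\<lambda>_. Et)"
    show "range ?C \<subseteq> borel_cyls"
      using Y.compactin_borel_of[OF Y.exhaust_compact] openin_borel_of[OF openin_topspace]
      by (auto intro!: cyl_in_borel_cyls)
    show "(\<Union>k. ?C k) = bp"
      using Y.exhaust_Union[OF openin_topspace] path_range_in by (auto simp: cyl_0)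
    show "emeasure \<nu> (?C k) \<noteq> \<infinity>" for k
      using regular_borel_measures_compact[OF invariant_measures_regular[OF \<nu>(1)]
          compactin_range_preimage[OF Y.exhaust_compact, of Vt k]] by (simp add: less_top)
  qed
qed

lemma length_pos_borel: "{\<alpha> \<in> bp. 0 < path_length \<alpha>} \<in> sets (borel_of bps)"
  unfolding length_pos_iff[symmetric] length_ge_eq_cyl by (intro cyl_borel) (auto simp: openin_borel_of)

text \<open>For \<open>A\<close> inside a piece, the paths with first edge in \<open>A\<close> are mapped by the shift onto the paths with
  range in \<open>s(A)\<close>.\<close>

lemma pullback_push:
  assumes \<nu>: "\<nu> \<in> invariant_measures E"
  shows "(\<lambda>\<alpha>. path_edge \<alpha> 0) \<in> restrict_space \<nu> {\<alpha> \<in> bp. 0 < path_length \<alpha>} \<rightarrow>\<^sub>M borel_of (edges E)"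
    and "pullback (push \<nu>) =
      distr (restrict_space \<nu> {\<alpha> \<in> bp. 0 < path_length \<alpha>}) (borel_of (edges E)) (\<lambda>\<alpha>. path_edge \<alpha> 0)"
proof -
  let ?Z = "{\<alpha> \<in> bp. 0 < path_length \<alpha>}"
  have sets: "sets \<nu> = sets (borel_of bps)"
    using \<nu> by (simp add: invariant_measures_def regular_borel_measures_sets)
  then have sp: "space \<nu> = bp" by (metis sets_eq_imp_space_eq space_borel_bps)
  have Z: "?Z \<inter> space \<nu> \<in> sets \<nu>" using length_pos_borel sets sp by (simp add: Int_absorb2 Collect_restrict)
  have spZ: "space (restrict_space \<nu> ?Z) = ?Z" using sp by (auto simp: space_restrict_space)
  have pre: "(\<lambda>\<alpha>. path_edge \<alpha> 0) -` A \<inter> ?Z = cyl (Suc 0) Vt (\<lambda>_. A)" for A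
    using path_range_in by (auto simp: cyl_def length_pos_iff)
  show m: "(\<lambda>\<alpha>. path_edge \<alpha> 0) \<in> restrict_space \<nu> ?Z \<rightarrow>\<^sub>M borel_of (edges E)"
  proof (rule measurableI)
    show "path_edge \<alpha> 0 \<in> space (borel_of (edges E))" if "\<alpha> \<in> space (restrict_space \<nu> ?Z)" for \<alpha>
      using that path_edge_in[of \<alpha> 0] unfolding spZ by (simp add: zero_enat_def)
    show "(\<lambda>\<alpha>. path_edge \<alpha> 0) -` A \<inter> space (restrict_space \<nu> ?Z) \<in> sets (restrict_space \<nu> ?Z)"
      if "A \<in> sets (borel_of (edges E))" for A
    proof -
      have "cyl (Suc 0) Vt (\<lambda>_. A) \<in> sets \<nu>" unfolding sets using that by (intro cyl_borel) (auto simp: openin_borel_of)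
      moreover have "cyl (Suc 0) Vt (\<lambda>_. A) \<subseteq> ?Z" using pre[of A] by blast
      ultimately show ?thesis unfolding spZ pre using sets_restrict_space_iff[OF Z] by blast
    qed
  qed
  show "pullback (push \<nu>) = distr (restrict_space \<nu> ?Z) (borel_of (edges E)) (\<lambda>\<alpha>. path_edge \<alpha> 0)"
  proof (rule measure_eqI)
    fix A assume "A \<in> sets (pullback (push \<nu>))"
    then have A: "A \<in> sets (borel_of (edges E))" by simp
    have eq: "{e \<in> A \<inter> piece j. rng E e \<in> Vt} = A \<inter> piece j" for j using rng_in piece_in by auto
    have "emeasure (pullback (push \<nu>)) A = (\<Sum>j. emeasure (push \<nu>) (src E ` (A \<inter> piece j)))"
      using A by (intro emeasure_pullback) auto
    also have "\<dots> = (\<Sum>j. emeasure \<nu> (cyl 0 (src E ` (A \<inter> piece j)) (\<lambda>_. A)))"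
      using image_piece_measurable[OF A] by (intro suminf_cong emeasure_push[OF sets])
    also have "\<dots> = emeasure \<nu> (cyl (Suc 0) Vt (\<lambda>_. A))"
      using emeasure_cyl_Suc[OF \<nu> openin_borel_of[OF openin_topspace], of "\<lambda>_. A" 0] A eq by simp
    also have "\<dots> = emeasure (distr (restrict_space \<nu> ?Z) (borel_of (edges E)) (\<lambda>\<alpha>. path_edge \<alpha> 0)) A"
    proof -
      have "cyl (Suc 0) Vt (\<lambda>_. A) \<subseteq> ?Z" using pre[of A] by blast
      then show ?thesis
        unfolding emeasure_distr[OF m A] spZ pre by (rule emeasure_restrict_space[OF Z, symmetric])
    qed
    finally show "emeasure (pullback (push \<nu>)) A =
      emeasure (distr (restrict_space \<nu> ?Z) (borel_of (edges E)) (\<lambda>\<alpha>. path_edge \<alpha> 0)) A" .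
  qed simp
qed

text \<open>By the preceding lemma, the integral of \<open>f \<circ> r\<close> against the pull-back is the integral of
  \<open>f(r(\<alpha>))\<close> over the boundary paths \<open>\<alpha>\<close> of positive length. The remaining paths are singular
  vertices, where \<open>f\<close> vanishes if its support consists of regular ones.\<close>

theorem push_vertex_invariant:
  assumes \<nu>: "\<nu> \<in> invariant_measures E" shows "push \<nu> \<in> vertex_invariant_measures E"
proof -
  let ?Z = "{\<alpha> \<in> bp. 0 < path_length \<alpha>}"
  have reg: "push \<nu> \<in> regular_borel_measures (vertices E)"
    using push_regular[OF invariant_measures_regular[OF \<nu>]] .
  have sets: "sets \<nu> = sets (borel_of bps)"
    using \<nu> by (simp add: invariant_measures_def regular_borel_measures_sets)
  then have sp: "space \<nu> = bp" by (metis sets_eq_imp_space_eq space_borel_bps)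
  have Z: "?Z \<inter> space \<nu> \<in> sets \<nu>" using length_pos_borel sets sp by (simp add: Int_absorb2 Collect_restrict)
  have spZ: "space (restrict_space \<nu> ?Z) = ?Z" using sp by (auto simp: space_restrict_space)
  have rm: "path_range E \<in> \<nu> \<rightarrow>\<^sub>M borel_of (vertices E)"
    using path_range_measurable by (simp add: measurable_cong_sets[OF sets refl])
  have left: "(\<integral>\<^sup>+e. ennreal (f (rng E e)) \<partial>src_pullback E (push \<nu>)) =
      (\<integral>\<^sup>+\<alpha>. ennreal (f (path_range E \<alpha>)) * indicator ?Z \<alpha> \<partial>\<nu>)"
    and right: "(\<integral>\<^sup>+v. ennreal (f v) \<partial>push \<nu>) = (\<integral>\<^sup>+\<alpha>. ennreal (f (path_range E \<alpha>)) \<partial>\<nu>)"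
    if f: "f \<in> Cc (vertices E)" for f
  proof -
    have fm: "(\<lambda>v. ennreal (f v)) \<in> borel_measurable (borel_of (vertices E))"
      using Y.Cc_measurable[OF f] by simp
    have frm: "(\<lambda>e. ennreal (f (rng E e))) \<in> borel_measurable (borel_of (edges E))"
      using measurable_compose[OF continuous_map_borel_of_measurable[OF rng_continuous] fm] .
    have "(\<integral>\<^sup>+e. ennreal (f (rng E e)) \<partial>src_pullback E (push \<nu>)) =
        (\<integral>\<^sup>+\<alpha>. ennreal (f (rng E (path_edge \<alpha> 0))) \<partial>restrict_space \<nu> ?Z)"
      unfolding src_pullback_eq[OF reg] pullback_push(2)[OF \<nu>]
      using frm by (intro nn_integral_distr pullback_push(1)[OF \<nu>]) auto
    also have "\<dots> = (\<integral>\<^sup>+\<alpha>. ennreal (f (path_range E \<alpha>)) \<partial>restrict_space \<nu> ?Z)"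
    proof (rule nn_integral_cong, unfold spZ)
      fix \<alpha> assume "\<alpha> \<in> ?Z"
      then have "rng E (path_edge \<alpha> 0) = path_range E \<alpha>"
        using rng_path_edge[of \<alpha> 0] by (simp add: zero_enat_def)
      then show "ennreal (f (rng E (path_edge \<alpha> 0))) = ennreal (f (path_range E \<alpha>))" by simp
    qed
    also have "\<dots> = (\<integral>\<^sup>+\<alpha>. ennreal (f (path_range E \<alpha>)) * indicator ?Z \<alpha> \<partial>\<nu>)"
      by (rule nn_integral_restrict_space[OF Z])
    finally show "(\<integral>\<^sup>+e. ennreal (f (rng E e)) \<partial>src_pullback E (push \<nu>)) =
      (\<integral>\<^sup>+\<alpha>. ennreal (f (path_range E \<alpha>)) * indicator ?Z \<alpha> \<partial>\<nu>)" .
    show "(\<integral>\<^sup>+v. ennreal (f v) \<partial>push \<nu>) = (\<integral>\<^sup>+\<alpha>. ennreal (f (path_range E \<alpha>)) \<partial>\<nu>)"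
      using fm rm by (intro nn_integral_distr) auto
  qed
  show ?thesis
    unfolding vertex_invariant_measures_def
  proof (intro CollectI conjI ballI impI reg)
    fix f assume f: "f \<in> Cc (vertices E)" and nonneg: "\<forall>v\<in>Vt. 0 \<le> f v"
    show "(\<integral>\<^sup>+e. ennreal (f (rng E e)) \<partial>src_pullback E (push \<nu>)) \<le> (\<integral>\<^sup>+v. ennreal (f v) \<partial>push \<nu>)"
      unfolding left[OF f] right[OF f] by (intro nn_integral_mono) (auto simp: indicator_def)
    assume supp: "supp (vertices E) f \<subseteq> regular_vertices E"
    have "f (path_range E \<alpha>) = 0" if "\<alpha> \<in> bp" "\<alpha> \<notin> ?Z" for \<alpha>
    proof -
      have "path_length \<alpha> = 0" using that by simp
      then have "path_length \<alpha> = enat 0" by (simp only: zero_enat_def)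
      then have "path_range E \<alpha> \<in> singular_vertices E" using path_end_singular[OF that(1), of 0] by simp
      then have "path_range E \<alpha> \<notin> supp (vertices E) f" "path_range E \<alpha> \<in> Vt"
        using supp by (auto simp: singular_vertices_def)
      then show ?thesis
        using closure_of_subset[of "{x \<in> Vt. f x \<noteq> 0}" "vertices E"] unfolding supp_def by auto
    qed
    then show "(\<integral>\<^sup>+e. ennreal (f (rng E e)) \<partial>src_pullback E (push \<nu>)) = (\<integral>\<^sup>+v. ennreal (f v) \<partial>push \<nu>)"
      unfolding left[OF f] right[OF f] by (intro nn_integral_cong) (auto simp: sp indicator_def)
  qed
qed

lemma convex_comb_invariant:
  assumes M: "M \<in> invariant_measures E" and N: "N \<in> invariant_measures E"
  shows "convex_comb t M N \<in> invariant_measures E"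
proof -
  have sets: "sets M = sets (borel_of bps)" "sets N = sets (borel_of bps)"
    using M N by (auto simp: invariant_measures_def regular_borel_measures_sets)
  have e: "emeasure (convex_comb t M N) A = ennreal t * emeasure M A + ennreal (1 - t) * emeasure N A"
    if "A \<in> sets (borel_of bps)" for A
    using that sets by (intro emeasure_convex_comb) auto
  have "emeasure (convex_comb t M N) K < \<infinity>" if K: "compactin bps K" for K
  proof (cases "K \<in> sets (borel_of bps)")
    case True
    then show ?thesis
      using regular_borel_measures_compact[OF invariant_measures_regular[OF M] K]
        regular_borel_measures_compact[OF invariant_measures_regular[OF N] K]
      by (simp add: e ennreal_mult_less_top)
  next
    case False
    then show ?thesis by (simp add: emeasure_notin_sets sets_convex_comb sets)
  qed
  then have "convex_comb t M N \<in> regular_borel_measures bps"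
    by (simp add: regular_borel_measures_def sets_convex_comb sets)
  moreover have "emeasure (convex_comb t M N) (shift E ` A) = emeasure (convex_comb t M N) A"
    if A: "A \<in> sets (borel_of bps)" "A \<subseteq> bp - range Vertex" "inj_on (shift E) A" for A
    using M N A e[OF A(1)] e[OF shift_image_borel[OF A(1,2)]] unfolding invariant_measures_def by auto
  ultimately show ?thesis by (simp add: invariant_measures_def)
qed

lemma push_convex_comb:
  assumes M: "M \<in> invariant_measures E" and N: "N \<in> invariant_measures E"
  shows "push (convex_comb t M N) = convex_comb t (push M) (push N)"
proof (rule measure_eqI)
  show "sets (push (convex_comb t M N)) = sets (convex_comb t (push M) (push N))"
    by (simp add: sets_convex_comb)
  fix B assume "B \<in> sets (push (convex_comb t M N))"
  then have B: "B \<in> sets (borel_of (vertices E))" by simp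
  have sets: "sets M = sets (borel_of bps)" "sets N = sets (borel_of bps)"
    using M N by (auto simp: invariant_measures_def regular_borel_measures_sets)
  have "cyl 0 B (\<lambda>_. Et) \<in> sets (borel_of bps)" using B by (intro cyl_borel) auto
  then show "emeasure (push (convex_comb t M N)) B = emeasure (convex_comb t (push M) (push N)) B"
    using B sets
    by (simp add: emeasure_push[where A = "\<lambda>_. Et"] sets_convex_comb emeasure_convex_comb)
qed

end

section \<open>An extension theorem for measures on sequence spaces\<close>

abbreviation seqs :: "'a measure \<Rightarrow> (nat \<Rightarrow> 'a) measure" where
  "seqs S \<equiv> PiM UNIV (\<lambda>_. S)"

abbreviation marginal :: "'a measure \<Rightarrow> nat \<Rightarrow> (nat \<Rightarrow> 'a) measure \<Rightarrow> (nat \<Rightarrow> 'a) measure" where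
  "marginal S k N \<equiv> distr N (PiM {..<k} (\<lambda>_. S)) (\<lambda>x. restrict x {..<k})"

lemma marginal_restrict:
  assumes "sets N = sets (seqs S)" "J \<subseteq> {..<k}"
  shows "distr (marginal S k N) (PiM J (\<lambda>_. S)) (\<lambda>x. restrict x J) = distr N (PiM J (\<lambda>_. S)) (\<lambda>x. restrict x J)"
proof -
  have [measurable_cong]: "sets N = sets (seqs S)" by fact
  have "(\<lambda>x. restrict x {..<k}) \<in> N \<rightarrow>\<^sub>M PiM {..<k} (\<lambda>_. S)"
    using measurable_restrict_subset[of "{..<k}" UNIV "\<lambda>_. S"] by (simp add: measurable_cong_sets[OF assms(1) refl])
  moreover have "restrict (restrict x {..<k}) J = restrict x J" for x :: "nat \<Rightarrow> 'a"
    using assms(2) by (simp add: Int_absorb1)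
  ultimately show ?thesis
    using measurable_restrict_subset[OF assms(2), of "\<lambda>_. S"] by (simp add: distr_distr comp_def)
qed

lemma measure_eqI_marginals:
  fixes M :: "(nat \<Rightarrow> 'a) measure"
  assumes sets: "sets M = sets (seqs S)" "sets N = sets (seqs S)" and fin: "finite_measure M"
    and eq: "\<And>k. marginal S (Suc k) M = marginal S (Suc k) N"
  shows "M = N"
proof (rule measure_eqI_PiM_infinite[OF sets _ fin])
  fix A and J :: "nat set" assume J: "finite J" and A: "\<And>i. i \<in> J \<Longrightarrow> A i \<in> sets S"
  obtain k where k: "J \<subseteq> {..<Suc k}"
    using J finite_nat_set_iff_bounded_le by (metis lessThan_Suc_atMost subsetI atMost_iff)
  have "emeasure M' (prod_emb UNIV (\<lambda>_. S) J (Pi\<^sub>E J A)) =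
      emeasure (distr M' (PiM J (\<lambda>_. S)) (\<lambda>x. restrict x J)) (Pi\<^sub>E J A)"
    if M': "sets M' = sets (seqs S)" for M' :: "(nat \<Rightarrow> 'a) measure"
  proof -
    have m: "(\<lambda>x. restrict x J) \<in> M' \<rightarrow>\<^sub>M PiM J (\<lambda>_. S)"
      using measurable_restrict_subset[of J UNIV "\<lambda>_. S"] by (simp add: measurable_cong_sets[OF M' refl])
    have sp: "space M' = space (seqs S)" using M' by (rule sets_eq_imp_space_eq)
    have "Pi\<^sub>E J A \<in> sets (PiM J (\<lambda>_. S))" using A J by (intro sets_PiM_I_finite)
    from emeasure_distr[OF m this] show ?thesis by (simp add: prod_emb_def sp space_PiM)
  qed
  then show "emeasure M (prod_emb UNIV (\<lambda>_. S) J (Pi\<^sub>E J A)) = emeasure N (prod_emb UNIV (\<lambda>_. S) J (Pi\<^sub>E J A))"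
    using sets eq[of k] marginal_restrict[OF sets(1) k] marginal_restrict[OF sets(2) k] by metis
qed

text \<open>What is used of a standard Borel space: a measurable injection into a Polish space that maps
  measurable sets to Borel sets.\<close>

locale borel_embedding =
  fixes S :: "'a measure" and \<phi> :: "'a \<Rightarrow> nat \<Rightarrow> real"
  assumes \<phi>_measurable: "\<phi> \<in> borel_measurable S" and \<phi>_inj: "inj_on \<phi> (space S)"
    and \<phi>_image: "\<And>A. A \<in> sets S \<Longrightarrow> \<phi> ` A \<in> sets borel"
begin

text \<open>Off the image the value is some fixed point of the space, which keeps the map measurable.\<close>

definition unembed :: "(nat \<Rightarrow> real) \<Rightarrow> 'a" where
  "unembed y = (if y \<in> \<phi> ` space S then inv_into (space S) \<phi> y else (SOME x. x \<in> space S))"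

lemma unembed: "x \<in> space S \<Longrightarrow> unembed (\<phi> x) = x"
  using \<phi>_inj by (simp add: unembed_def)

lemma unembed_measurable:
  assumes ne: "space S \<noteq> {}" shows "unembed \<in> borel \<rightarrow>\<^sub>M S"
proof (rule measurableI)
  have some: "(SOME x. x \<in> space S) \<in> space S" using ne some_in_eq by blast
  show "unembed y \<in> space S" for y using some by (auto simp: unembed_def inv_into_into)
  show "unembed -` A \<inter> space borel \<in> sets borel" if A: "A \<in> sets S" for A
  proof -
    have sub: "A \<subseteq> space S" using A by (rule sets.sets_into_space)
    have "unembed -` A \<inter> space borel =
        \<phi> ` A \<union> (if (SOME x. x \<in> space S) \<in> A then - \<phi> ` space S else {})"
    proof (intro set_eqI)
      fix y
      show "y \<in> unembed -` A \<inter> space borel \<longleftrightarrow>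
          y \<in> \<phi> ` A \<union> (if (SOME x. x \<in> space S) \<in> A then - \<phi> ` space S else {})"
      proof (cases "y \<in> \<phi> ` space S")
        case True
        then obtain x where x: "x \<in> space S" "y = \<phi> x" by blast
        then have "\<phi> x \<in> \<phi> ` A \<longleftrightarrow> x \<in> A" using sub \<phi>_inj by (meson inj_on_image_mem_iff)
        then show ?thesis using x unembed[OF x(1)] True by auto
      next
        case False
        then have "y \<notin> \<phi> ` A" using sub by blast
        then show ?thesis using False by (auto simp: unembed_def)
      qed
    qed
    then show ?thesis using \<phi>_image[OF A] \<phi>_image[OF sets.top] by auto
  qed
qed

text \<open>Transported by \<open>\<phi>\<close>, the marginals form a projective family over a Polish space, to which
  Kolmogorov's theorem applies; the limit is transported back. A finite set \<open>J\<close> of coordinates gets its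
  law from any \<open>N n\<close> with \<open>J \<subseteq> {..n}\<close>.\<close>

theorem kolmogorov_extension:
  fixes N :: "nat \<Rightarrow> (nat \<Rightarrow> 'a) measure"
  assumes sets: "\<And>n. sets (N n) = sets (seqs S)" and prob: "\<And>n. prob_space (N n)"
    and stable: "\<And>n. marginal S (Suc n) (N (Suc n)) = marginal S (Suc n) (N n)"
  obtains L where "sets L = sets (seqs S)" "\<And>k. marginal S (Suc k) L = marginal S (Suc k) (N k)"
proof -
  have sp: "space (N n) = space (seqs S)" for n using sets by (rule sets_eq_imp_space_eq)
  have ne: "space S \<noteq> {}"
    using prob_space.not_empty[OF prob[of 0]] unfolding sp space_PiM by auto
  have stable_le: "distr (N (n + d)) (PiM J (\<lambda>_. S)) (\<lambda>x. restrict x J) = distr (N n) (PiM J (\<lambda>_. S)) (\<lambda>x. restrict x J)"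
    if "J \<subseteq> {..<Suc n}" for J n d
  proof (induction d)
    case (Suc d)
    have J: "J \<subseteq> {..<Suc (n + d)}" using that by auto
    have "distr (N (Suc (n + d))) (PiM J (\<lambda>_. S)) (\<lambda>x. restrict x J) = distr (N (n + d)) (PiM J (\<lambda>_. S)) (\<lambda>x. restrict x J)"
      by (metis marginal_restrict[OF sets J, of "Suc (n + d)"] marginal_restrict[OF sets J, of "n + d"] stable[of "n + d"])
    then show ?case unfolding add_Suc_right using Suc by (rule trans)
  qed (simp only: add_0_right)
  \<comment> \<open>From this index on the law of the coordinates in \<open>J\<close> no longer changes.\<close>
  define bd :: "nat set \<Rightarrow> nat" where "bd J = (LEAST n. J \<subseteq> {..<Suc n})" for J
  have bd: "J \<subseteq> {..<Suc (bd J)}" if fJ: "finite J" for J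
  proof -
    obtain k where "\<forall>i\<in>J. i \<le> k" using fJ unfolding finite_nat_set_iff_bounded_le by blast
    then have "J \<subseteq> {..<Suc k}" by auto
    then show ?thesis unfolding bd_def by (rule LeastI)
  qed
  have bd_le: "bd J \<le> n" if "J \<subseteq> {..<Suc n}" for J n
    unfolding bd_def by (rule Least_le) (rule that)
  define Q where "Q J n = distr (N n) (PiM J (\<lambda>_. borel)) (\<lambda>x. \<lambda>i\<in>J. \<phi> (x i))" for J n
  define P where "P J = Q J (bd J)" for J
  have m1: "(\<lambda>x. \<lambda>i\<in>J. \<phi> (x i)) \<in> PiM J (\<lambda>_. S) \<rightarrow>\<^sub>M PiM J (\<lambda>_. borel)" for J
    using \<phi>_measurable by measurable
  have m2: "(\<lambda>x. restrict x J) \<in> N n \<rightarrow>\<^sub>M PiM J (\<lambda>_. S)" for J n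
    using measurable_restrict_subset[of J UNIV "\<lambda>_. S"] by (simp add: measurable_cong_sets[OF sets refl])
  have Q_alt: "Q J n = distr (distr (N n) (PiM J (\<lambda>_. S)) (\<lambda>x. restrict x J)) (PiM J (\<lambda>_. borel)) (\<lambda>x. \<lambda>i\<in>J. \<phi> (x i))" for J n
    unfolding Q_def distr_distr[OF m1 m2] comp_def by (intro distr_cong refl) auto
  have m3: "(\<lambda>x. \<lambda>i\<in>J. \<phi> (x i)) \<in> N n \<rightarrow>\<^sub>M PiM J (\<lambda>_. borel)" for J n
    using measurable_compose[OF m2 m1, of J n] by (simp cong: restrict_cong)
  have Q_stable: "Q J n = P J" if "J \<subseteq> {..<Suc n}" for J n
  proof -
    have fJ: "finite J" using that finite_subset by blast
    have "n = bd J + (n - bd J)" using bd_le[OF that] by simp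
    then show ?thesis unfolding P_def Q_alt using stable_le[OF bd[OF fJ], of "n - bd J"] by simp
  qed
  interpret polish_projective UNIV P
  proof (unfold polish_projective_def projective_family_def, intro conjI allI impI)
    fix J H :: "nat set" assume JH: "J \<subseteq> H" "finite H" "H \<subseteq> UNIV"
    have "distr (P H) (PiM J (\<lambda>_. borel)) (\<lambda>x. restrict x J) = Q J (bd H)"
    proof -
      have "(\<lambda>x. restrict x J) \<in> PiM H (\<lambda>_. borel :: (nat \<Rightarrow> real) measure) \<rightarrow>\<^sub>M PiM J (\<lambda>_. borel)"
        by (rule measurable_restrict_subset[OF JH(1)])
      then show ?thesis
        unfolding P_def Q_def by (simp add: distr_distr[OF _ m3[of H "bd H"]] comp_def Int_absorb1[OF JH(1)])
    qed
    also have "\<dots> = P J" using bd[OF JH(2)] JH(1) by (intro Q_stable) auto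
    finally show "P J = distr (P H) (PiM J (\<lambda>_. borel)) (\<lambda>x. restrict x J)" by simp
  next
    show "prob_space (P J)" for J unfolding P_def Q_def by (rule prob_space.prob_space_distr[OF prob m3])
  qed
  have G: "(\<lambda>y i. unembed (y i)) \<in> lim \<rightarrow>\<^sub>M seqs S"
    unfolding measurable_cong_sets[OF sets_lim refl]
    by (rule measurable_abs_UNIV, rule measurable_compose[OF _ unembed_measurable[OF ne]],
        rule measurable_component_singleton) simp
  define L where "L = distr lim (seqs S) (\<lambda>y i. unembed (y i))"
  have "marginal S (Suc k) L = marginal S (Suc k) (N k)" for k
  proof -
    let ?J = "{..<Suc k}"
    have mJ: "(\<lambda>x. restrict x ?J) \<in> seqs S \<rightarrow>\<^sub>M PiM ?J (\<lambda>_. S)" by (rule measurable_restrict_subset) simp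
    have mJ': "(\<lambda>x. restrict x ?J) \<in> lim \<rightarrow>\<^sub>M PiM ?J (\<lambda>_. borel)"
      unfolding measurable_cong_sets[OF sets_lim refl] by (rule measurable_restrict_subset) simp
    have mG: "(\<lambda>z. \<lambda>i\<in>?J. unembed (z i)) \<in> PiM ?J (\<lambda>_. borel) \<rightarrow>\<^sub>M PiM ?J (\<lambda>_. S)"
      using unembed_measurable[OF ne] by measurable
    have lim_marg: "distr lim (PiM ?J (\<lambda>_. borel)) (\<lambda>x. restrict x ?J) = P ?J"
    proof (rule measure_eqI)
      show "sets (distr lim (PiM ?J (\<lambda>_. borel)) (\<lambda>x. restrict x ?J)) = sets (P ?J)"
        by (simp add: P_def Q_def)
      fix A assume "A \<in> sets (distr lim (PiM ?J (\<lambda>_. borel)) (\<lambda>x. restrict x ?J))"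
      then have A: "A \<in> sets (PiM ?J (\<lambda>_. borel :: (nat \<Rightarrow> real) measure))" by simp
      show "emeasure (distr lim (PiM ?J (\<lambda>_. borel)) (\<lambda>x. restrict x ?J)) A = emeasure (P ?J) A"
        using emeasure_lim_emb[OF _ _ A] unfolding emeasure_distr[OF mJ' A]
        by (simp add: prod_emb_def space_PiM)
    qed
    have "marginal S (Suc k) L = distr lim (PiM ?J (\<lambda>_. S)) (\<lambda>y. \<lambda>i\<in>?J. unembed (y i))"
      unfolding L_def distr_distr[OF mJ G] by (simp add: comp_def)
    also have "\<dots> = distr (P ?J) (PiM ?J (\<lambda>_. S)) (\<lambda>z. \<lambda>i\<in>?J. unembed (z i))"
      unfolding lim_marg[symmetric] distr_distr[OF mG mJ'] comp_def by (intro distr_cong refl) auto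
    also have "P ?J = Q ?J k" using Q_stable[of ?J k] by simp
    also have "distr (Q ?J k) (PiM ?J (\<lambda>_. S)) (\<lambda>z. \<lambda>i\<in>?J. unembed (z i)) = marginal S (Suc k) (N k)"
      unfolding Q_def distr_distr[OF mG m3] comp_def
    proof (intro distr_cong refl)
      fix x assume "x \<in> space (N k)"
      then have "x i \<in> space S" for i using sp by (auto simp: space_PiM)
      then show "(\<lambda>i\<in>?J. unembed ((\<lambda>i\<in>?J. \<phi> (x i)) i)) = restrict x ?J" by (auto simp: unembed)
    qed
    finally show ?thesis .
  qed
  then show thesis by (intro that[of L]) (auto simp: L_def)
qed

end

section \<open>Disjoint unions of measurable spaces\<close>

definition sum_space :: "'a measure \<Rightarrow> 'b measure \<Rightarrow> ('a + 'b) measure" where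
  "sum_space M N = measure_of (space M <+> space N)
     {C. C \<subseteq> space M <+> space N \<and> Inl -` C \<in> sets M \<and> Inr -` C \<in> sets N} (\<lambda>_. 0)"

lemma sum_space_sigma_algebra:
  "sigma_algebra (space M <+> space N)
     {C. C \<subseteq> space M <+> space N \<and> Inl -` C \<in> sets M \<and> Inr -` C \<in> sets N}"
proof -
  have "Inl -` (space M <+> space N - C) = space M - Inl -` C" "Inr -` (space M <+> space N - C) = space N - Inr -` C" for C
    by auto
  then show ?thesis by (auto simp: sigma_algebra_iff2 vimage_UN intro!: sets.countable_UN)
qed

lemma sets_sum_space:
  "sets (sum_space M N) = {C. C \<subseteq> space M <+> space N \<and> Inl -` C \<in> sets M \<and> Inr -` C \<in> sets N}"
  unfolding sum_space_def
  using sigma_algebra.sets_measure_of_eq[OF sum_space_sigma_algebra] by blast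

lemma space_sum_space [simp]: "space (sum_space M N) = space M <+> space N"
  unfolding sum_space_def by (rule space_measure_of) auto

lemma measurable_Inl: "Inl \<in> M \<rightarrow>\<^sub>M sum_space M N" and measurable_Inr: "Inr \<in> N \<rightarrow>\<^sub>M sum_space M N"
proof -
  show "Inl \<in> M \<rightarrow>\<^sub>M sum_space M N"
    by (rule measurableI) (auto simp: sets_sum_space)
  show "Inr \<in> N \<rightarrow>\<^sub>M sum_space M N"
    by (rule measurableI) (auto simp: sets_sum_space)
qed

lemma measurable_sum_spaceI:
  assumes "(\<lambda>v. f (Inl v)) \<in> M \<rightarrow>\<^sub>M K" "(\<lambda>e. f (Inr e)) \<in> N \<rightarrow>\<^sub>M K"
  shows "f \<in> sum_space M N \<rightarrow>\<^sub>M K"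
proof (rule measurableI)
  show "f x \<in> space K" if "x \<in> space (sum_space M N)" for x
    using that assms[THEN measurable_space] by auto
  show "f -` A \<inter> space (sum_space M N) \<in> sets (sum_space M N)" if A: "A \<in> sets K" for A
  proof -
    have "Inl -` (f -` A \<inter> space (sum_space M N)) = (\<lambda>v. f (Inl v)) -` A \<inter> space M"
      "Inr -` (f -` A \<inter> space (sum_space M N)) = (\<lambda>e. f (Inr e)) -` A \<inter> space N" by auto
    then show ?thesis
      using assms[THEN measurable_sets, OF A] by (auto simp: sets_sum_space)
  qed
qed

lemma Inl_image_sets: "A \<in> sets M \<Longrightarrow> Inl ` A \<in> sets (sum_space M N)"
  and Inr_image_sets: "B \<in> sets N \<Longrightarrow> Inr ` B \<in> sets (sum_space M N)"
proof -
  have e: "Inr -` Inl ` A = {}" "Inl -` Inr ` B = {}" for A :: "'a set" and B :: "'b set" by auto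
  show "A \<in> sets M \<Longrightarrow> Inl ` A \<in> sets (sum_space M N)" "B \<in> sets N \<Longrightarrow> Inr ` B \<in> sets (sum_space M N)"
    by (auto simp: sets_sum_space inj_vimage_image_eq e dest: sets.sets_into_space)
qed

text \<open>A leading coordinate records the summand.\<close>

lemma borel_embedding_sum:
  assumes "borel_embedding M \<phi>" "borel_embedding N \<psi>"
  shows "borel_embedding (sum_space M N) (case_sum (\<lambda>v. case_nat 0 (\<phi> v)) (\<lambda>e. case_nat 1 (\<psi> e)))"
    (is "borel_embedding _ ?\<chi>")
proof -
  interpret M: borel_embedding M \<phi> by fact
  interpret N: borel_embedding N \<psi> by fact
  have case_measurable: "(\<lambda>y. case_nat c y) \<in> borel \<rightarrow>\<^sub>M (borel :: (nat \<Rightarrow> real) measure)" for c :: real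
  proof (rule borel_measurable_continuous_onI)
    show "continuous_on UNIV (\<lambda>y :: nat \<Rightarrow> real. case_nat c y)"
    proof (rule continuous_on_coordinatewise_then_product)
      show "continuous_on UNIV (\<lambda>y :: nat \<Rightarrow> real. case_nat c y i)" for i
        by (cases i) (auto intro: continuous_intros continuous_on_product_coordinates)
    qed
  qed
  have tail: "(\<lambda>y :: nat \<Rightarrow> real. \<lambda>n. y (Suc n)) \<in> borel \<rightarrow>\<^sub>M borel"
    by (intro borel_measurable_continuous_onI continuous_on_coordinatewise_then_product
        continuous_on_product_coordinates)
  have head: "(\<lambda>y :: nat \<Rightarrow> real. y 0) \<in> borel \<rightarrow>\<^sub>M borel"
    by (intro borel_measurable_continuous_onI continuous_on_product_coordinates)
  have im: "case_nat c ` B \<in> sets borel" if "B \<in> sets borel" for c :: real and B :: "(nat \<Rightarrow> real) set"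
  proof -
    have "case_nat c ` B = ((\<lambda>y. y 0) -` {c} \<inter> space borel) \<inter> ((\<lambda>y n. y (Suc n)) -` B \<inter> space borel)"
    proof (intro equalityI subsetI)
      fix y assume y: "y \<in> ((\<lambda>y. y 0) -` {c} \<inter> space borel) \<inter> ((\<lambda>y n. y (Suc n)) -` B \<inter> space borel)"
      then have "y = case_nat c (\<lambda>n. y (Suc n))" by (auto simp: fun_eq_iff split: nat.split)
      then show "y \<in> case_nat c ` B" using y by (intro image_eqI) auto
    qed auto
    moreover have "(\<lambda>y :: nat \<Rightarrow> real. y 0) -` {c} \<inter> space borel \<in> sets borel"
      using head by (rule measurable_sets) simp
    ultimately show ?thesis using measurable_sets[OF tail that] by (metis sets.Int)
  qed
  have inj: "case_nat c y = case_nat d z \<longleftrightarrow> c = d \<and> y = z" for c d :: real and y z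
  proof
    assume eq: "case_nat c y = case_nat d z"
    have "y n = z n" for n using fun_cong[OF eq, of "Suc n"] by simp
    then show "c = d \<and> y = z" using fun_cong[OF eq, of 0] by auto
  qed simp
  show ?thesis
  proof
    show "?\<chi> \<in> borel_measurable (sum_space M N)"
      by (rule measurable_sum_spaceI; unfold sum.case)
         (rule measurable_compose[OF M.\<phi>_measurable case_measurable],
          rule measurable_compose[OF N.\<phi>_measurable case_measurable])
    show "inj_on ?\<chi> (space (sum_space M N))"
    proof (rule inj_onI)
      fix x y assume xy: "x \<in> space (sum_space M N)" "y \<in> space (sum_space M N)" "?\<chi> x = ?\<chi> y"
      show "x = y"
      proof (cases x)
        case x: (Inl a)
        show ?thesis
        proof (cases y)
          case (Inl b)
          then show ?thesis using xy x inj_onD[OF M.\<phi>_inj, of a b] by (simp only: sum.case inj) auto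
        next
          case (Inr b)
          then show ?thesis using xy(3) x by (simp only: sum.case inj) simp
        qed
      next
        case x: (Inr a)
        show ?thesis
        proof (cases y)
          case (Inr b)
          then show ?thesis using xy x inj_onD[OF N.\<phi>_inj, of a b] by (simp only: sum.case inj) auto
        next
          case (Inl b)
          then show ?thesis using xy(3) x by (simp only: sum.case inj) simp
        qed
      qed
    qed
    show "?\<chi> ` C \<in> sets borel" if C: "C \<in> sets (sum_space M N)" for C
    proof -
      define A B where AB_def: "A = Inl -` C" "B = Inr -` C"
      have AB: "C = Inl ` A \<union> Inr ` B" using C by (auto simp: sets_sum_space AB_def)
      have "?\<chi> ` C = case_nat 0 ` \<phi> ` (Inl -` C) \<union> case_nat 1 ` \<psi> ` (Inr -` C)"
        unfolding AB_def[symmetric] by (simp add: AB image_Un image_image)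
      then show ?thesis using C M.\<phi>_image N.\<phi>_image im by (auto simp: sets_sum_space)
    qed
  qed
qed

lemma (in lch_space) borel_embedding_emb: "borel_embedding (borel_of X) emb"
  by unfold_locales (use emb_measurable emb_inj emb_image_borel in auto)

context sc_graph
begin

section \<open>The defect of a vertex-invariant measure\<close>

lemma regular_open: "openin (vertices E) (regular_vertices E)"
proof (subst openin_subopen, intro ballI)
  fix w assume "w \<in> regular_vertices E"
  then obtain W where "openin (vertices E) W" "w \<in> W" "W \<subseteq> regular_vertices E"
    using regular_nbhd by metis
  then show "\<exists>T. openin (vertices E) T \<and> w \<in> T \<and> T \<subseteq> regular_vertices E" by blast
qed

lemma singular_borel: "singular_vertices E \<in> sets (borel_of (vertices E))"
  unfolding singular_vertices_def using regular_open by (intro closedin_borel_of) blast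

lemma rng_measurable: "rng E \<in> borel_of (edges E) \<rightarrow>\<^sub>M borel_of (vertices E)"
  by (rule continuous_map_borel_of_measurable[OF rng_continuous])

definition edge_push :: "'v measure \<Rightarrow> 'v measure" where
  "edge_push \<mu> = distr (pullback \<mu>) (borel_of (vertices E)) (rng E)"

lemma sets_edge_push: "sets (edge_push \<mu>) = sets (borel_of (vertices E))"
  by (simp add: edge_push_def)

lemma emeasure_edge_push:
  assumes \<mu>: "sets \<mu> = sets (borel_of (vertices E))" and B: "B \<in> sets (borel_of (vertices E))"
  shows "emeasure (edge_push \<mu>) B = (\<Sum>j. emeasure \<mu> (src E ` {e \<in> piece j. rng E e \<in> B}))"
proof -
  have m: "rng E \<in> pullback \<mu> \<rightarrow>\<^sub>M borel_of (vertices E)"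
    using rng_measurable by (simp add: measurable_cong_sets[OF sets_pullback refl])
  have "rng E -` B \<inter> Et \<in> sets (borel_of (edges E))"
    using measurable_sets[OF rng_measurable B] by simp
  moreover have "rng E -` B \<inter> Et \<inter> piece j = {e \<in> piece j. rng E e \<in> B}" for j using piece_in by auto
  ultimately show ?thesis
    unfolding edge_push_def using emeasure_distr[OF m B] emeasure_pullback[OF \<mu>] by simp
qed

lemma vertex_invariant_Cc:
  assumes \<mu>: "\<mu> \<in> vertex_invariant_measures E" and f: "f \<in> Cc (vertices E)" "\<And>v. v \<in> Vt \<Longrightarrow> 0 \<le> f v"
  shows "(\<integral>\<^sup>+v. ennreal (f v) \<partial>edge_push \<mu>) \<le> (\<integral>\<^sup>+v. ennreal (f v) \<partial>\<mu>)"
    and "supp (vertices E) f \<subseteq> regular_vertices E \<Longrightarrow>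
      (\<integral>\<^sup>+v. ennreal (f v) \<partial>edge_push \<mu>) = (\<integral>\<^sup>+v. ennreal (f v) \<partial>\<mu>)"
proof -
  have reg: "\<mu> \<in> regular_borel_measures (vertices E)" using \<mu> by (simp add: vertex_invariant_measures_def)
  have m: "rng E \<in> pullback \<mu> \<rightarrow>\<^sub>M borel_of (vertices E)"
    using rng_measurable by (simp add: measurable_cong_sets[OF sets_pullback refl])
  have fm: "(\<lambda>v. ennreal (f v)) \<in> borel_measurable (borel_of (vertices E))"
    using Y.Cc_measurable[OF f(1)] by simp
  have *: "(\<integral>\<^sup>+v. ennreal (f v) \<partial>edge_push \<mu>) = (\<integral>\<^sup>+e. ennreal (f (rng E e)) \<partial>src_pullback E \<mu>)"
    unfolding edge_push_def src_pullback_eq[OF reg] using m fm by (intro nn_integral_distr) auto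
  show "(\<integral>\<^sup>+v. ennreal (f v) \<partial>edge_push \<mu>) \<le> (\<integral>\<^sup>+v. ennreal (f v) \<partial>\<mu>)"
    and "supp (vertices E) f \<subseteq> regular_vertices E \<Longrightarrow>
      (\<integral>\<^sup>+v. ennreal (f v) \<partial>edge_push \<mu>) = (\<integral>\<^sup>+v. ennreal (f v) \<partial>\<mu>)"
    using \<mu> f unfolding * vertex_invariant_measures_def by auto
qed

text \<open>This inequality and the next equality restate vertex invariance without test functions.\<close>

lemma edge_push_le:
  assumes \<mu>: "\<mu> \<in> vertex_invariant_measures E" and B: "B \<in> sets (borel_of (vertices E))"
  shows "emeasure (edge_push \<mu>) B \<le> emeasure \<mu> B"
proof -
  have reg: "\<mu> \<in> regular_borel_measures (vertices E)" using \<mu> by (simp add: vertex_invariant_measures_def)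
  show ?thesis
    using vertex_invariant_Cc(1)[OF \<mu>] regular_borel_measures_sets[OF reg]
    by (intro Y.borel_le_if_open_le[OF sets_edge_push reg _ B] Y.open_le_if_Cc_le sets_edge_push) auto
qed

lemma edge_push_regular_open:
  assumes \<mu>: "\<mu> \<in> vertex_invariant_measures E" and U: "openin (vertices E) U" "U \<subseteq> regular_vertices E"
  shows "emeasure (edge_push \<mu>) U = emeasure \<mu> U"
proof (rule antisym)
  have sets: "sets \<mu> = sets (borel_of (vertices E))"
    using \<mu> by (simp add: vertex_invariant_measures_def regular_borel_measures_sets)
  show "emeasure (edge_push \<mu>) U \<le> emeasure \<mu> U" using edge_push_le[OF \<mu> openin_borel_of[OF U(1)]] .
  show "emeasure \<mu> U \<le> emeasure (edge_push \<mu>) U"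
  proof (rule Y.open_le_if_Cc_le[OF sets sets_edge_push _ U(1)])
    fix f assume f: "f \<in> Cc (vertices E)" "\<And>v. v \<in> Vt \<Longrightarrow> 0 \<le> f v" "supp (vertices E) f \<subseteq> U"
    then have "supp (vertices E) f \<subseteq> regular_vertices E" using U(2) by blast
    then show "(\<integral>\<^sup>+v. ennreal (f v) \<partial>\<mu>) \<le> (\<integral>\<^sup>+v. ennreal (f v) \<partial>edge_push \<mu>)"
      using vertex_invariant_Cc(2)[OF \<mu> f(1,2)] by simp
  qed
qed

text \<open>Subtraction makes sense on sets of finite measure; the differences on countably many disjoint such
  sets are added up.\<close>

lemma (in -) measure_difference_exists:
  assumes "sigma_finite_measure M" and sets: "sets N = sets M"
    and le: "\<And>A. A \<in> sets M \<Longrightarrow> emeasure N A \<le> emeasure M A"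
  obtains D where "sets D = sets M" "\<And>A. A \<in> sets M \<Longrightarrow> emeasure M A = emeasure D A + emeasure N A"
proof -
  interpret M: sigma_finite_measure M by fact
  obtain A :: "nat \<Rightarrow> 'a set" where A: "range A \<subseteq> sets M" "(\<Union>i. A i) = space M"
    "\<And>i. emeasure M (A i) \<noteq> \<infinity>" "disjoint_family A"
    using M.sigma_finite_disjoint by metis
  let ?M = "\<lambda>i. density M (indicator (A i))"
  let ?N = "\<lambda>i. density N (indicator (A i))"
  have Am: "A i \<in> sets M" for i using A(1) by auto
  have eM: "emeasure (?M i) B = emeasure M (B \<inter> A i)" if "B \<in> sets M" for B i
    using that Am[of i] by (simp add: emeasure_density indicator_inter_arith[symmetric] Int_commute mult.commute)
  have eN: "emeasure (?N i) B = emeasure N (B \<inter> A i)" if "B \<in> sets M" for B i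
    using that Am[of i] sets
    by (simp add: emeasure_density indicator_inter_arith[symmetric] Int_commute mult.commute)
  have sp: "space N = space M" using sets by (rule sets_eq_imp_space_eq)
  have leA: "emeasure N (B \<inter> A i) \<le> emeasure M (B \<inter> A i)" if "B \<in> sets M" for B i
    using le that Am by blast
  have finM: "emeasure M (B \<inter> A i) < \<infinity>" if "B \<in> sets M" for B i
  proof -
    have "emeasure M (B \<inter> A i) \<le> emeasure M (A i)" using Am by (intro emeasure_mono) auto
    then show ?thesis using A(3)[of i] by (auto simp: less_top intro: le_less_trans)
  qed
  have eD: "emeasure (diff_measure (?M i) (?N i)) B = emeasure M (B \<inter> A i) - emeasure N (B \<inter> A i)"
    if B: "B \<in> sets M" for B i
  proof -
    have "finite_measure (?M i)"
      using finM[OF sets.top, of i] by (intro finite_measureI) (simp add: eM)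
    moreover have "finite_measure (?N i)"
      using finM[OF sets.top, of i] leA[OF sets.top, of i]
      by (intro finite_measureI) (auto simp: sp eN top_unique)
    ultimately show ?thesis
      using B leA by (subst emeasure_diff_measure) (auto simp: sets eM eN)
  qed
  define D where "D = msum (\<lambda>i. diff_measure (?M i) (?N i))"
  have sD: "sets D = sets M" by (simp add: D_def)
  have "emeasure M B = emeasure D B + emeasure N B" if B: "B \<in> sets M" for B
  proof -
    have U: "(\<Union>i. B \<inter> A i) = B" using A(2) sets.sets_into_space[OF B] by auto
    have dis: "disjoint_family (\<lambda>i. B \<inter> A i)" using A(4) by (auto simp: disjoint_family_on_def)
    have "emeasure D B + emeasure N B =
        (\<Sum>i. emeasure M (B \<inter> A i) - emeasure N (B \<inter> A i)) + (\<Sum>i. emeasure N (B \<inter> A i))"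
      using B Am dis suminf_emeasure[of "\<lambda>i. B \<inter> A i" N] U
      by (simp add: D_def emeasure_msum eD sets image_subset_iff)
    also have "\<dots> = (\<Sum>i. (emeasure M (B \<inter> A i) - emeasure N (B \<inter> A i)) + emeasure N (B \<inter> A i))"
      by (intro suminf_add) auto
    also have "\<dots> = (\<Sum>i. emeasure M (B \<inter> A i))"
      using leA[OF B] by (intro suminf_cong diff_add_cancel_ennreal)
    also have "\<dots> = emeasure M B"
      using B Am dis suminf_emeasure[of "\<lambda>i. B \<inter> A i" M] U by (simp add: image_subset_iff)
    finally show ?thesis by simp
  qed
  then show thesis using sD that by blast
qed

text \<open>On basic open sets of regular vertices both measures agree and are finite, so that the difference
  vanishes there; countably many of them cover the regular vertices.\<close>

lemma defect_exists:
  assumes \<mu>: "\<mu> \<in> vertex_invariant_measures E"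
  obtains \<Lambda> where "sets \<Lambda> = sets (borel_of (vertices E))"
    "\<And>B. B \<in> sets (borel_of (vertices E)) \<Longrightarrow> emeasure \<mu> B = emeasure \<Lambda> B + emeasure (edge_push \<mu>) B"
    "emeasure \<Lambda> (regular_vertices E) = 0"
proof -
  have reg: "\<mu> \<in> regular_borel_measures (vertices E)" using \<mu> by (simp add: vertex_invariant_measures_def)
  have sets: "sets \<mu> = sets (borel_of (vertices E))" using reg by (rule regular_borel_measures_sets)
  obtain \<Lambda> where \<Lambda>: "sets \<Lambda> = sets \<mu>"
    "\<And>A. A \<in> sets \<mu> \<Longrightarrow> emeasure \<mu> A = emeasure \<Lambda> A + emeasure (edge_push \<mu>) A"
    using measure_difference_exists[OF Y.regular_borel_measure_sigma_finite[OF reg], of "edge_push \<mu>"]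
      edge_push_le[OF \<mu>] sets sets_edge_push by metis
  define I where "I = {i. Y.cbase i \<subseteq> regular_vertices E}"
  have null: "Y.cbase i \<in> null_sets \<Lambda>" if "i \<in> I" for i
  proof -
    have b: "Y.cbase i \<in> sets \<mu>" using Y.cbase_open openin_borel_of sets by blast
    have "emeasure \<mu> (Y.cbase i) \<le> emeasure \<mu> (vertices E closure_of Y.cbase i)"
      using Y.cbase_subset_closure Y.compactin_borel_of[OF Y.cbase_compact] sets by (intro emeasure_mono) auto
    also have "\<dots> < \<infinity>" using regular_borel_measures_compact[OF reg Y.cbase_compact] .
    finally have fin: "emeasure \<mu> (Y.cbase i) < \<infinity>" .
    have "emeasure (edge_push \<mu>) (Y.cbase i) = emeasure \<mu> (Y.cbase i)"
      using that Y.cbase_open by (intro edge_push_regular_open[OF \<mu>]) (auto simp: I_def)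
    then have "emeasure \<Lambda> (Y.cbase i) + emeasure \<mu> (Y.cbase i) = 0 + emeasure \<mu> (Y.cbase i)"
      using \<Lambda>(2)[OF b] by simp
    then have "emeasure \<Lambda> (Y.cbase i) = 0"
      using fin ennreal_add_left_cancel[of "emeasure \<mu> (Y.cbase i)" "emeasure \<Lambda> (Y.cbase i)" 0]
      by (auto simp: add.commute)
    then show ?thesis using b \<Lambda>(1) by (simp add: null_sets_def)
  qed
  have "regular_vertices E = (\<Union>i\<in>I. Y.cbase i)"
  proof
    show "regular_vertices E \<subseteq> (\<Union>i\<in>I. Y.cbase i)"
    proof
      fix v assume "v \<in> regular_vertices E"
      then obtain i where i: "v \<in> Y.cbase i" "vertices E closure_of Y.cbase i \<subseteq> regular_vertices E"
        using Y.cbase_nhd[OF regular_open] by blast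
      then have "i \<in> I" using Y.cbase_subset_closure[of i] by (auto simp: I_def)
      then show "v \<in> (\<Union>i\<in>I. Y.cbase i)" using i by blast
    qed
  qed (auto simp: I_def)
  then have "regular_vertices E \<in> null_sets \<Lambda>" using null by (metis null_sets_UN' countableI_type)
  then show thesis using that[of \<Lambda>] \<Lambda> sets by auto
qed

section \<open>Sequences coding paths\<close>

text \<open>Both vertices and edges occur in codes of paths: the path \<open>\<alpha>\<^sub>1\<dots>\<alpha>\<^sub>n\<close> is coded by
  \<open>\<alpha>\<^sub>1, \<dots>, \<alpha>\<^sub>n, v, v, v, \<dots>\<close> with \<open>v\<close> its source, and an infinite path by the sequence of its edges. In
  this way a vertex plays the role of a loop at itself, and the shift of paths becomes the shift of
  sequences.\<close>

definition letters :: "('v + 'e) measure" where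
  "letters = sum_space (borel_of (vertices E)) (borel_of (edges E))"

abbreviation words :: "(nat \<Rightarrow> 'v + 'e) measure" where
  "words \<equiv> seqs letters"

definition letter_rng :: "'v + 'e \<Rightarrow> 'v" where
  "letter_rng = case_sum (\<lambda>v. v) (rng E)"

definition letter_src :: "'v + 'e \<Rightarrow> 'v" where
  "letter_src = case_sum (\<lambda>v. v) (src E)"

lemma letter_simps [simp]: "letter_rng (Inl v) = v" "letter_rng (Inr e) = rng E e"
  "letter_src (Inl v) = v" "letter_src (Inr e) = src E e"
  by (simp_all add: letter_rng_def letter_src_def)

lemma letter_rng_measurable: "letter_rng \<in> letters \<rightarrow>\<^sub>M borel_of (vertices E)"
  and letter_src_measurable: "letter_src \<in> letters \<rightarrow>\<^sub>M borel_of (vertices E)"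
  unfolding letters_def
  using rng_measurable continuous_map_borel_of_measurable[OF s_continuous]
  by (auto intro!: measurable_sum_spaceI)

lemma space_letters: "space letters = Vt <+> Et"
  by (simp add: letters_def)

lemma word_component_measurable: "(\<lambda>x. x i) \<in> words \<rightarrow>\<^sub>M letters"
  by (rule measurable_component_singleton) simp

definition word_rng :: "(nat \<Rightarrow> 'v + 'e) \<Rightarrow> 'v" where
  "word_rng x = letter_rng (x 0)"

lemma word_rng_measurable: "word_rng \<in> words \<rightarrow>\<^sub>M borel_of (vertices E)"
  unfolding word_rng_def by (rule measurable_compose[OF word_component_measurable letter_rng_measurable])

text \<open>The sequences to which an edge from the \<open>j\<close>-th piece can be prepended; this edge is then unique.\<close>

definition extendable :: "nat \<Rightarrow> (nat \<Rightarrow> 'v + 'e) set" where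
  "extendable j = {x \<in> space words. word_rng x \<in> src E ` piece j}"

lemma extendable_measurable: "extendable j \<in> sets words"
proof -
  have "extendable j = word_rng -` (src E ` piece j) \<inter> space words" by (auto simp: extendable_def)
  then show ?thesis using measurable_sets[OF word_rng_measurable s_piece_measurable[of j]] by simp
qed

definition grow :: "nat \<Rightarrow> (nat \<Rightarrow> 'v + 'e) \<Rightarrow> nat \<Rightarrow> 'v + 'e" where
  "grow j x = case_nat (Inr (branch j (word_rng x))) x"

definition const_word :: "'v \<Rightarrow> nat \<Rightarrow> 'v + 'e" where
  "const_word v = (\<lambda>_. Inl v)"

lemma const_word_measurable: "const_word \<in> borel_of (vertices E) \<rightarrow>\<^sub>M words"
  unfolding const_word_def letters_def by (intro measurable_abs_UNIV measurable_Inl)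

lemma space_restrict_eq: "A \<in> sets M \<Longrightarrow> space (restrict_space M A) = A"
  by (simp add: space_restrict_space sets.Int_space_eq2)

lemma branch_letter_measurable:
  "(\<lambda>v. Inr (branch j v)) \<in> restrict_space (borel_of (vertices E)) (src E ` piece j) \<rightarrow>\<^sub>M letters"
  unfolding letters_def by (rule measurable_compose[OF branch_measurable[OF refl] measurable_Inr])

lemma grow_measurable: "grow j \<in> restrict_space words (extendable j) \<rightarrow>\<^sub>M words"
proof -
  have "word_rng \<in> restrict_space words (extendable j) \<rightarrow>\<^sub>M restrict_space (borel_of (vertices E)) (src E ` piece j)"
    using word_rng_measurable
    by (intro measurable_restrict_space2 measurable_restrict_space1)
       (auto simp: space_restrict_eq[OF extendable_measurable] extendable_def)
  from measurable_compose[OF this branch_letter_measurable]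
  have "(\<lambda>x. Inr (branch j (word_rng x))) \<in> restrict_space words (extendable j) \<rightarrow>\<^sub>M letters" .
  moreover have "(\<lambda>x. x) \<in> restrict_space words (extendable j) \<rightarrow>\<^sub>M words"
    by (rule measurable_restrict_space1) simp
  ultimately show ?thesis unfolding grow_def by (intro measurable_case_nat')
qed

text \<open>A path either is a vertex, with distribution \<open>\<Lambda>\<close>, or arises from its shift by prepending an edge.
  Codes of invariant measures are the fixed points of this operator.\<close>

definition step :: "'v measure \<Rightarrow> (nat \<Rightarrow> 'v + 'e) measure \<Rightarrow> (nat \<Rightarrow> 'v + 'e) measure" where
  "step \<Lambda> N = msum (case_nat (distr \<Lambda> words const_word)
     (\<lambda>j. distr (restrict_space N (extendable j)) words (grow j)))"

lemma sets_step [simp]: "sets (step \<Lambda> N) = sets words"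
  by (simp add: step_def)

lemma emeasure_step:
  assumes \<Lambda>: "sets \<Lambda> = sets (borel_of (vertices E))" and N: "sets N = sets words" and A: "A \<in> sets words"
  shows "emeasure (step \<Lambda> N) A =
    emeasure \<Lambda> {v \<in> Vt. const_word v \<in> A} + (\<Sum>j. emeasure N {x \<in> extendable j. grow j x \<in> A})"
proof -
  have c: "const_word \<in> \<Lambda> \<rightarrow>\<^sub>M words" using const_word_measurable by (simp add: measurable_cong_sets[OF \<Lambda> refl])
  have sp\<Lambda>: "space \<Lambda> = Vt" using \<Lambda> by (metis sets_eq_imp_space_eq space_borel_of)
  have 1: "emeasure (distr \<Lambda> words const_word) A = emeasure \<Lambda> {v \<in> Vt. const_word v \<in> A}"
    unfolding emeasure_distr[OF c A] sp\<Lambda> by (intro arg_cong[where f = "emeasure \<Lambda>"]) auto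
  have 2: "emeasure (distr (restrict_space N (extendable j)) words (grow j)) A =
      emeasure N {x \<in> extendable j. grow j x \<in> A}" for j
  proof -
    have ex: "extendable j \<in> sets N" using extendable_measurable N by simp
    have m: "grow j \<in> restrict_space N (extendable j) \<rightarrow>\<^sub>M words"
      using grow_measurable[of j] N by (simp cong: measurable_cong_sets restrict_space_sets_cong)
    have "grow j -` A \<inter> extendable j = {x \<in> extendable j. grow j x \<in> A}" by auto
    then show ?thesis
      unfolding emeasure_distr[OF m A] space_restrict_eq[OF ex]
      using ex by (simp add: emeasure_restrict_space sets.Int_space_eq2)
  qed
  let ?M = "case_nat (distr \<Lambda> words const_word) (\<lambda>j. distr (restrict_space N (extendable j)) words (grow j))"
  have "sets (?M i) = sets (?M 0)" for i by (cases i) auto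
  then have "emeasure (step \<Lambda> N) A = (\<Sum>i. emeasure (?M i) A)"
    unfolding step_def using A by (intro emeasure_msum) auto
  also have "\<dots> = (\<Sum>j. emeasure (?M (Suc j)) A) + emeasure (?M 0) A"
    by (rule sums_unique[symmetric], rule sums_Suc) (rule summable_sums, simp)
  finally show ?thesis by (simp add: 1 2 add.commute)
qed

text \<open>If \<open>\<pi>' (grow j x)\<close> depends on \<open>x\<close> only through \<open>\<pi> x\<close>, then the law of \<open>\<pi>'\<close> after the step is
  determined by the law of \<open>\<pi>\<close> before it. The next two lemmas are instances: every step fixes one
  more coordinate.\<close>

lemma step_view:
  assumes \<Lambda>: "sets \<Lambda> = sets (borel_of (vertices E))" and N: "sets N = sets words" "sets N' = sets words"
    and \<pi>: "\<pi> \<in> words \<rightarrow>\<^sub>M W" and \<pi>': "\<pi>' \<in> words \<rightarrow>\<^sub>M W'"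
    and R: "\<And>j. R j \<in> sets W" "\<And>j x. x \<in> space words \<Longrightarrow> x \<in> extendable j \<longleftrightarrow> \<pi> x \<in> R j"
    and q: "\<And>j. q j \<in> restrict_space W (R j) \<rightarrow>\<^sub>M W'" "\<And>j x. x \<in> extendable j \<Longrightarrow> \<pi>' (grow j x) = q j (\<pi> x)"
    and eq: "distr N W \<pi> = distr N' W \<pi>"
  shows "distr (step \<Lambda> N) W' \<pi>' = distr (step \<Lambda> N') W' \<pi>'"
proof (rule measure_eqI)
  fix C assume "C \<in> sets (distr (step \<Lambda> N) W' \<pi>')"
  then have C: "C \<in> sets W'" by simp
  have ex: "x \<in> space words" if "x \<in> extendable j" for x j using that by (simp add: extendable_def)
  have part: "emeasure M {x \<in> extendable j. grow j x \<in> \<pi>' -` C \<inter> space words} =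
      emeasure (distr M W \<pi>) {w \<in> R j. q j w \<in> C}" if M: "sets M = sets words" for M j
  proof -
    have m: "\<pi> \<in> M \<rightarrow>\<^sub>M W" using \<pi> by (simp add: measurable_cong_sets[OF M refl])
    have sp: "space M = space words" using M by (rule sets_eq_imp_space_eq)
    have "q j -` C \<inter> space (restrict_space W (R j)) \<in> sets (restrict_space W (R j))"
      using measurable_sets[OF q(1) C] .
    then have "{w \<in> R j. q j w \<in> C} \<in> sets (restrict_space W (R j))"
      unfolding space_restrict_eq[OF R(1)] by (simp add: vimage_def Int_def conj_commute)
    then have mb: "{w \<in> R j. q j w \<in> C} \<in> sets W"
      using R(1) by (simp add: sets_restrict_space_iff sets.Int_space_eq2)
    have "grow j x \<in> space words" if "x \<in> extendable j" for x
      using measurable_space[OF grow_measurable, of x j] that space_restrict_eq[OF extendable_measurable] by simp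
    then have "{x \<in> extendable j. grow j x \<in> \<pi>' -` C \<inter> space words} = \<pi> -` {w \<in> R j. q j w \<in> C} \<inter> space M"
    proof (intro equalityI subsetI)
      fix x assume "x \<in> {x \<in> extendable j. grow j x \<in> \<pi>' -` C \<inter> space words}"
      then have "x \<in> extendable j" "\<pi>' (grow j x) \<in> C" by auto
      then show "x \<in> \<pi> -` {w \<in> R j. q j w \<in> C} \<inter> space M"
        using R(2)[OF ex] q(2) ex unfolding sp by auto
    next
      fix x assume "x \<in> \<pi> -` {w \<in> R j. q j w \<in> C} \<inter> space M"
      then have x: "x \<in> space words" "\<pi> x \<in> R j" "q j (\<pi> x) \<in> C" unfolding sp by auto
      then have "x \<in> extendable j" using R(2) by blast
      then show "x \<in> {x \<in> extendable j. grow j x \<in> \<pi>' -` C \<inter> space words}"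
        using x(3) q(2) \<open>\<And>x. x \<in> extendable j \<Longrightarrow> grow j x \<in> space words\<close> by auto
    qed
    then show ?thesis by (simp add: emeasure_distr[OF m mb])
  qed
  have "\<pi>' -` C \<inter> space words \<in> sets words" using measurable_sets[OF \<pi>' C] .
  moreover have "emeasure (distr (step \<Lambda> M) W' \<pi>') C = emeasure (step \<Lambda> M) (\<pi>' -` C \<inter> space words)" for M
    using \<pi>' C sets_eq_imp_space_eq[OF sets_step, of \<Lambda> M]
    by (subst emeasure_distr) (simp_all add: measurable_cong_sets[OF sets_step refl])
  ultimately show "emeasure (distr (step \<Lambda> N) W' \<pi>') C = emeasure (distr (step \<Lambda> N') W' \<pi>') C"
    by (simp only: emeasure_step[OF \<Lambda> N(1)] emeasure_step[OF \<Lambda> N(2)] part[OF N(1)] part[OF N(2)] eq)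
qed simp

abbreviation marg :: "nat \<Rightarrow> (nat \<Rightarrow> 'v + 'e) measure \<Rightarrow> (nat \<Rightarrow> 'v + 'e) measure" where
  "marg k N \<equiv> marginal letters k N"

abbreviation range_law :: "(nat \<Rightarrow> 'v + 'e) measure \<Rightarrow> 'v measure" where
  "range_law N \<equiv> distr N (borel_of (vertices E)) word_rng"

lemma restrict_measurable: "(\<lambda>x. restrict x {..<k}) \<in> words \<rightarrow>\<^sub>M PiM {..<k} (\<lambda>_. letters)"
  by (rule measurable_restrict_subset) simp

lemma marg_step_0:
  assumes "sets \<Lambda> = sets (borel_of (vertices E))" "sets N = sets words" "sets N' = sets words"
    and eq: "range_law N = range_law N'"
  shows "marg (Suc 0) (step \<Lambda> N) = marg (Suc 0) (step \<Lambda> N')"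
proof (rule step_view[OF assms(1-3) word_rng_measurable restrict_measurable _ _ _ _ eq])
  show "src E ` piece j \<in> sets (borel_of (vertices E))" for j by (rule s_piece_measurable)
  show "x \<in> extendable j \<longleftrightarrow> word_rng x \<in> src E ` piece j" if "x \<in> space words" for j x
    using that by (simp add: extendable_def)
  show "(\<lambda>v. \<lambda>i\<in>{..<Suc 0}. Inr (branch j v)) \<in>
      restrict_space (borel_of (vertices E)) (src E ` piece j) \<rightarrow>\<^sub>M PiM {..<Suc 0} (\<lambda>_. letters)" for j
    by (intro measurable_restrict branch_letter_measurable)
  show "restrict (grow j x) {..<Suc 0} = (\<lambda>i\<in>{..<Suc 0}. Inr (branch j (word_rng x)))" for j x
    by (auto simp: grow_def)
qed

lemma marg_step_Suc:
  assumes "sets \<Lambda> = sets (borel_of (vertices E))" "sets N = sets words" "sets N' = sets words"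
    and eq: "marg (Suc k) N = marg (Suc k) N'"
  shows "marg (Suc (Suc k)) (step \<Lambda> N) = marg (Suc (Suc k)) (step \<Lambda> N')"
proof (rule step_view[OF assms(1-3) restrict_measurable restrict_measurable _ _ _ _ eq])
  let ?P = "PiM {..<Suc k} (\<lambda>_. letters)"
  let ?R = "\<lambda>j. {y \<in> space ?P. letter_rng (y 0) \<in> src E ` piece j}"
  have rm: "(\<lambda>y. letter_rng (y 0)) \<in> ?P \<rightarrow>\<^sub>M borel_of (vertices E)"
    by (rule measurable_compose[OF _ letter_rng_measurable], rule measurable_component_singleton) simp
  show R: "?R j \<in> sets ?P" for j
  proof -
    have "?R j = (\<lambda>y. letter_rng (y 0)) -` (src E ` piece j) \<inter> space ?P" by auto
    then show ?thesis using measurable_sets[OF rm s_piece_measurable] by simp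
  qed
  show "x \<in> extendable j \<longleftrightarrow> restrict x {..<Suc k} \<in> ?R j" if "x \<in> space words" for j x
    using that measurable_space[OF restrict_measurable that, of "Suc k"]
    by (auto simp: extendable_def word_rng_def)
  show "(\<lambda>y. \<lambda>i\<in>{..<Suc (Suc k)}. case_nat (Inr (branch j (letter_rng (y 0)))) y i) \<in>
      restrict_space ?P (?R j) \<rightarrow>\<^sub>M PiM {..<Suc (Suc k)} (\<lambda>_. letters)" for j
  proof (rule measurable_restrict)
    fix i assume i: "i \<in> {..<Suc (Suc k)}"
    have "(\<lambda>y. letter_rng (y 0)) \<in> restrict_space ?P (?R j) \<rightarrow>\<^sub>M
        restrict_space (borel_of (vertices E)) (src E ` piece j)"
      using rm by (intro measurable_restrict_space2 measurable_restrict_space1)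
        (auto simp: space_restrict_eq[OF R])
    from measurable_compose[OF this branch_letter_measurable]
    have "(\<lambda>y. Inr (branch j (letter_rng (y 0)))) \<in> restrict_space ?P (?R j) \<rightarrow>\<^sub>M letters" .
    moreover have "(\<lambda>y. y m) \<in> restrict_space ?P (?R j) \<rightarrow>\<^sub>M letters" if "i = Suc m" for m
      using i that by (intro measurable_restrict_space1 measurable_component_singleton) auto
    ultimately show "(\<lambda>y. case_nat (Inr (branch j (letter_rng (y 0)))) y i) \<in> restrict_space ?P (?R j) \<rightarrow>\<^sub>M letters"
      by (intro measurable_case_nat)
  qed
  show "restrict (grow j x) {..<Suc (Suc k)} =
      (\<lambda>i\<in>{..<Suc (Suc k)}. case_nat (Inr (branch j (letter_rng (restrict x {..<Suc k} 0)))) (restrict x {..<Suc k}) i)" for j x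
    by (auto simp: grow_def word_rng_def fun_eq_iff split: nat.splits)
qed

text \<open>The range of an extended path is the range of the new edge, whose distribution is the pull-back of
  the former range distribution. So the step replaces \<open>\<mu>\<close> by \<open>T \<mu> + \<Lambda>\<close>, which is \<open>\<mu>\<close> again.\<close>

lemma range_law_step:
  assumes \<mu>: "sets \<mu> = sets (borel_of (vertices E))" and \<Lambda>: "sets \<Lambda> = sets (borel_of (vertices E))"
    "\<And>B. B \<in> sets (borel_of (vertices E)) \<Longrightarrow> emeasure \<mu> B = emeasure \<Lambda> B + emeasure (edge_push \<mu>) B"
    and N: "sets N = sets words" "range_law N = \<mu>"
  shows "range_law (step \<Lambda> N) = \<mu>"
proof (rule measure_eqI)
  show "sets (range_law (step \<Lambda> N)) = sets \<mu>" using \<mu> by simp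
  fix B assume "B \<in> sets (range_law (step \<Lambda> N))"
  then have B: "B \<in> sets (borel_of (vertices E))" by simp
  let ?A = "word_rng -` B \<inter> space words"
  have A: "?A \<in> sets words" using measurable_sets[OF word_rng_measurable B] .
  have spN: "space N = space words" using N(1) by (rule sets_eq_imp_space_eq)
  have mN: "word_rng \<in> N \<rightarrow>\<^sub>M borel_of (vertices E)" using word_rng_measurable by (simp add: measurable_cong_sets[OF N(1) refl])
  have part: "emeasure N {x \<in> extendable j. grow j x \<in> ?A} = emeasure \<mu> (src E ` {e \<in> piece j. rng E e \<in> B})" for j
  proof -
    have "src E ` {e \<in> Et \<inter> piece j. rng E e \<in> B} \<in> sets (borel_of (vertices E))"
      by (rule src_image_borel[OF openin_borel_of[OF openin_topspace] B])
    moreover have "{e \<in> Et \<inter> piece j. rng E e \<in> B} = {e \<in> piece j. rng E e \<in> B}" using piece_in by auto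
    ultimately have m: "src E ` {e \<in> piece j. rng E e \<in> B} \<in> sets (borel_of (vertices E))" by simp
    have ex: "grow j x \<in> space words" if "x \<in> extendable j" for x
      using measurable_space[OF grow_measurable, of x j] that space_restrict_eq[OF extendable_measurable] by simp
    have "{x \<in> extendable j. grow j x \<in> ?A} = word_rng -` (src E ` {e \<in> piece j. rng E e \<in> B}) \<inter> space N"
    proof (intro equalityI subsetI)
      fix x assume x: "x \<in> {x \<in> extendable j. grow j x \<in> ?A}"
      then have "rng E (branch j (word_rng x)) \<in> B" by (auto simp: grow_def word_rng_def)
      then show "x \<in> word_rng -` (src E ` {e \<in> piece j. rng E e \<in> B}) \<inter> space N"
        using x branch_in[of "word_rng x" j] s_branch[of "word_rng x" j] unfolding spN extendable_def
        by (auto intro!: image_eqI[of _ _ "branch j (word_rng x)"])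
    next
      fix x assume "x \<in> word_rng -` (src E ` {e \<in> piece j. rng E e \<in> B}) \<inter> space N"
      then obtain e where e: "e \<in> piece j" "rng E e \<in> B" "word_rng x = src E e" "x \<in> space words" unfolding spN by auto
      then have "x \<in> extendable j" by (auto simp: extendable_def)
      moreover have "word_rng (grow j x) = rng E e" using e branch_s[OF e(1)] by (simp add: grow_def word_rng_def)
      ultimately show "x \<in> {x \<in> extendable j. grow j x \<in> ?A}" using ex e(2) by auto
    qed
    then show ?thesis unfolding N(2)[symmetric] emeasure_distr[OF mN m] by simp
  qed
  have "emeasure (range_law (step \<Lambda> N)) B = emeasure (step \<Lambda> N) ?A"
    using word_rng_measurable B sets_eq_imp_space_eq[OF sets_step, of \<Lambda> N]
    by (subst emeasure_distr) (simp_all add: measurable_cong_sets[OF sets_step refl])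
  also have "\<dots> = emeasure \<Lambda> {v \<in> Vt. const_word v \<in> ?A} + (\<Sum>j. emeasure N {x \<in> extendable j. grow j x \<in> ?A})"
    by (rule emeasure_step[OF \<Lambda>(1) N(1) A])
  also have "{v \<in> Vt. const_word v \<in> ?A} = B"
    using sets.sets_into_space[OF B] measurable_space[OF const_word_measurable]
    by (auto simp: word_rng_def const_word_def)
  also have "emeasure \<Lambda> B + (\<Sum>j. emeasure N {x \<in> extendable j. grow j x \<in> ?A}) = emeasure \<mu> B"
    unfolding part using \<Lambda>(2)[OF B] emeasure_edge_push[OF \<mu> B] by simp
  finally show "emeasure (range_law (step \<Lambda> N)) B = emeasure \<mu> B" .
qed

section \<open>A stationary measure on sequences\<close>

lemma letters_embedding: "borel_embedding letters (case_sum (\<lambda>v. case_nat 0 (Y.emb v)) (\<lambda>e. case_nat 1 (X.emb e)))"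
  unfolding letters_def by (rule borel_embedding_sum[OF Y.borel_embedding_emb X.borel_embedding_emb])

lemma first_letter_measurable: "(\<lambda>y. letter_rng (y 0)) \<in> PiM {..<Suc k} (\<lambda>_. letters) \<rightarrow>\<^sub>M borel_of (vertices E)"
  by (rule measurable_compose[OF _ letter_rng_measurable], rule measurable_component_singleton) simp

lemma word_rng_eq: "word_rng = (\<lambda>x. letter_rng (x 0))"
  by (simp add: fun_eq_iff word_rng_def)

lemma range_law_marg:
  assumes N: "sets N = sets words"
  shows "range_law N = distr (marg (Suc k) N) (borel_of (vertices E)) (\<lambda>y. letter_rng (y 0))"
proof -
  have "(\<lambda>x. restrict x {..<Suc k}) \<in> N \<rightarrow>\<^sub>M PiM {..<Suc k} (\<lambda>_. letters)"
    using restrict_measurable by (simp add: measurable_cong_sets[OF N refl])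
  from distr_distr[OF first_letter_measurable this] show ?thesis
    by (simp add: comp_def word_rng_eq)
qed

text \<open>The density only depends on the first coordinate.\<close>

lemma marg_density:
  assumes N: "sets N = sets words" and H: "H \<in> borel_measurable (borel_of (vertices E))"
  shows "marg (Suc k) (density N (\<lambda>x. H (word_rng x))) = density (marg (Suc k) N) (\<lambda>y. H (letter_rng (y 0)))"
proof -
  have m: "(\<lambda>x. restrict x {..<Suc k}) \<in> N \<rightarrow>\<^sub>M PiM {..<Suc k} (\<lambda>_. letters)"
    using restrict_measurable by (simp add: measurable_cong_sets[OF N refl])
  from density_distr[OF measurable_compose[OF first_letter_measurable H] m]
  show ?thesis by (simp add: word_rng_def)
qed

lemma density_inverse:
  assumes f: "f \<in> borel_measurable M" and pos: "\<And>x. x \<in> space M \<Longrightarrow> 0 < f x \<and> f x < \<infinity>"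
  shows "density (density M f) (\<lambda>x. 1 / f x) = (M :: 'z measure)"
proof -
  have "density (density M f) (\<lambda>x. 1 / f x) = density M (\<lambda>x. f x * (1 / f x))"
    using f by (intro density_density_eq) auto
  also have "\<dots> = density M (\<lambda>_. 1)"
  proof (rule density_cong)
    show "AE x in M. f x * (1 / f x) = 1"
    proof (rule AE_I2)
      fix x assume "x \<in> space M"
      then have "f x / f x = 1" using pos[of x] by (intro ennreal_divide_self) auto
      then show "f x * (1 / f x) = 1" by (simp add: ennreal_times_divide)
    qed
  qed (use f in auto)
  finally show ?thesis by (simp add: density_1)
qed

text \<open>Kolmogorov's theorem needs probability measures, but \<open>\<mu>\<close> may be infinite. All measures involved
  have range distribution \<open>\<mu>\<close>, so a fixed positive density in the range vertex turns all of them into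
  probability measures and commutes with passing to marginals; it is removed at the end. If \<open>\<mu> = 0\<close>,
  no such density exists, and the zero measure is stationary.\<close>

theorem stationary_measure_exists:
  assumes \<mu>: "\<mu> \<in> regular_borel_measures (vertices E)" and \<Lambda>: "sets \<Lambda> = sets (borel_of (vertices E))"
    "\<And>B. B \<in> sets (borel_of (vertices E)) \<Longrightarrow> emeasure \<mu> B = emeasure \<Lambda> B + emeasure (edge_push \<mu>) B"
  obtains N where "sets N = sets words" "range_law N = \<mu>" "step \<Lambda> N = N"
proof -
  have sets\<mu>: "sets \<mu> = sets (borel_of (vertices E))" using \<mu> by (rule regular_borel_measures_sets)
  have sp\<mu>: "space \<mu> = Vt" using \<mu> by (rule regular_borel_measures_space)
  interpret \<mu>: sigma_finite_measure \<mu> by (rule Y.regular_borel_measure_sigma_finite[OF \<mu>])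
  obtain h where h: "h \<in> borel_measurable \<mu>" "integral\<^sup>N \<mu> h \<noteq> \<infinity>" "\<And>x. x \<in> space \<mu> \<Longrightarrow> 0 < h x \<and> h x < \<infinity>"
    using \<mu>.Ex_finite_integrable_function by blast
  define c where "c = integral\<^sup>N \<mu> h"
  show thesis
  proof (cases "c = 0")
    case True
    then have "emeasure \<mu> {x \<in> space \<mu>. h x \<noteq> 0} = 0"
      using nn_integral_0_iff[OF h(1)] by (simp add: c_def)
    moreover have "{x \<in> space \<mu>. h x \<noteq> 0} = space \<mu>" using h(3) by force
    ultimately have "emeasure \<mu> (space \<mu>) = 0" by simp
    then have zero: "emeasure \<mu> B = 0" for B
      by (metis emeasure_space le_zero_eq)
    have zero\<Lambda>: "emeasure \<Lambda> B = 0" for B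
      using \<Lambda>(2)[of B] zero[of B] \<Lambda>(1) emeasure_notin_sets[of B \<Lambda>] by (cases "B \<in> sets \<Lambda>") auto
    have "range_law (null_measure words) = \<mu>"
    proof (rule measure_eqI)
      fix B assume B: "B \<in> sets (range_law (null_measure words))"
      then have "emeasure (range_law (null_measure words)) B = 0"
        using word_rng_measurable by (subst emeasure_distr) (simp_all add: measurable_cong_sets[OF sets_null_measure refl])
      then show "emeasure (range_law (null_measure words)) B = emeasure \<mu> B" using zero by simp
    qed (simp add: sets\<mu>)
    moreover have "step \<Lambda> (null_measure words) = null_measure words"
      by (rule measure_eqI) (simp_all add: emeasure_step[OF \<Lambda>(1)] zero\<Lambda>)
    ultimately show thesis by (intro that[of "null_measure words"]) simp_all
  next
    case False
    define H where "H x = h x / c" for x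
    have c: "0 < c" "c < \<infinity>" using False h(2) by (auto simp: c_def less_top zero_less_iff_neq_zero)
    have Hm: "H \<in> borel_measurable (borel_of (vertices E))"
      using h(1) unfolding H_def by (simp add: measurable_cong_sets[OF sets\<mu> refl])
    have Hpos: "0 < H v \<and> H v < \<infinity>" if "v \<in> Vt" for v
    proof -
      have "0 < h v" "h v \<noteq> top" using h(3)[of v] that sp\<mu> by auto
      then have "h v / c \<noteq> top" "0 < h v / c"
        using c by (auto simp: ennreal_divide_eq_top_iff ennreal_zero_less_divide)
      then show ?thesis by (auto simp: H_def less_top)
    qed
    have wr: "word_rng x \<in> Vt" if "x \<in> space words" for x
      using measurable_space[OF word_rng_measurable that] by simp
    have Hwm: "(\<lambda>x. H (word_rng x)) \<in> borel_measurable words"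
      by (rule measurable_compose[OF word_rng_measurable Hm])
    have Hint: "(\<integral>\<^sup>+v. H v \<partial>\<mu>) = 1"
    proof -
      have "(\<integral>\<^sup>+v. H v \<partial>\<mu>) = c / c" unfolding H_def c_def using h(1) by (rule nn_integral_divide)
      then show ?thesis using c by (simp add: ennreal_divide_self less_top)
    qed
    have prob: "prob_space (density N (\<lambda>x. H (word_rng x)))" if N: "sets N = sets words" "range_law N = \<mu>" for N
    proof (rule prob_spaceI)
      have m: "word_rng \<in> N \<rightarrow>\<^sub>M borel_of (vertices E)"
        using word_rng_measurable by (simp add: measurable_cong_sets[OF N(1) refl])
      have "(\<lambda>x. H (word_rng x)) \<in> borel_measurable N"
        using Hwm by (simp add: measurable_cong_sets[OF N(1) refl])
      then have "emeasure (density N (\<lambda>x. H (word_rng x))) (space (density N (\<lambda>x. H (word_rng x)))) =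
          (\<integral>\<^sup>+x. H (word_rng x) * indicator (space N) x \<partial>N)"
        by (simp add: emeasure_density)
      also have "\<dots> = (\<integral>\<^sup>+x. H (word_rng x) \<partial>N)" by (rule nn_integral_cong) simp
      also have "\<dots> = (\<integral>\<^sup>+v. H v \<partial>range_law N)" using Hm by (intro nn_integral_distr[symmetric] m) simp
      finally show "emeasure (density N (\<lambda>x. H (word_rng x))) (space (density N (\<lambda>x. H (word_rng x)))) = 1"
        using Hint N(2) by simp
    qed
    have eqI: "A = B" if A: "sets A = sets words" "range_law A = \<mu>" and B: "sets B = sets words"
      and eq: "\<And>k. marg (Suc k) A = marg (Suc k) B" for A B
    proof -
      have inv: "density (density M (\<lambda>x. H (word_rng x))) (\<lambda>x. 1 / H (word_rng x)) = M" if "sets M = sets words" for M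
        using Hwm Hpos wr sets_eq_imp_space_eq[OF that]
        by (intro density_inverse) (auto simp: measurable_cong_sets[OF that refl])
      have "density A (\<lambda>x. H (word_rng x)) = density B (\<lambda>x. H (word_rng x))"
      proof (rule measure_eqI_marginals)
        show "finite_measure (density A (\<lambda>x. H (word_rng x)))"
          using prob[OF A] by (simp add: prob_space_def)
        show "marg (Suc k) (density A (\<lambda>x. H (word_rng x))) = marg (Suc k) (density B (\<lambda>x. H (word_rng x)))" for k
          by (simp only: marg_density[OF A(1) Hm] marg_density[OF B Hm] eq)
      qed (use A B in simp_all)
      then show "A = B" using inv[OF A(1)] inv[OF B] by metis
    qed
    define \<nu> where "\<nu> n = (step \<Lambda> ^^ n) (distr \<mu> words const_word)" for n
    have cm: "const_word \<in> \<mu> \<rightarrow>\<^sub>M words" using const_word_measurable by (simp add: measurable_cong_sets[OF sets\<mu> refl])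
    have \<nu>_sets: "sets (\<nu> n) = sets words" for n by (cases n) (simp_all add: \<nu>_def)
    have \<nu>_law: "range_law (\<nu> n) = \<mu>" for n
    proof (induction n)
      case 0
      have "range_law (distr \<mu> words const_word) = distr \<mu> (borel_of (vertices E)) (\<lambda>v. v)"
        unfolding distr_distr[OF word_rng_measurable cm] by (simp add: comp_def word_rng_def const_word_def)
      also have "\<dots> = \<mu>" by (rule distr_id2) (simp add: sets\<mu>)
      finally show ?case by (simp add: \<nu>_def)
    next
      case (Suc n)
      have "range_law (step \<Lambda> (\<nu> n)) = \<mu>" by (rule range_law_step[OF sets\<mu> \<Lambda> \<nu>_sets Suc])
      then show ?case by (simp add: \<nu>_def)
    qed
    have \<nu>_Suc: "\<nu> (Suc n) = step \<Lambda> (\<nu> n)" for n by (simp add: \<nu>_def)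
    have stable: "marg (Suc n) (\<nu> (Suc (Suc n))) = marg (Suc n) (\<nu> (Suc n))" for n
    proof (induction n)
      case 0
      have "marg (Suc 0) (step \<Lambda> (\<nu> (Suc 0))) = marg (Suc 0) (step \<Lambda> (\<nu> 0))"
        by (intro marg_step_0 \<Lambda>(1) \<nu>_sets) (simp only: \<nu>_law)
      then show ?case by (simp only: \<nu>_Suc)
    next
      case (Suc n)
      have "marg (Suc (Suc n)) (step \<Lambda> (\<nu> (Suc (Suc n)))) = marg (Suc (Suc n)) (step \<Lambda> (\<nu> (Suc n)))"
        by (rule marg_step_Suc[OF \<Lambda>(1) \<nu>_sets \<nu>_sets Suc])
      then show ?case by (simp only: \<nu>_Suc)
    qed
    interpret letters: borel_embedding letters "case_sum (\<lambda>v. case_nat 0 (Y.emb v)) (\<lambda>e. case_nat 1 (X.emb e))"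
      by (rule letters_embedding)
    obtain L where L: "sets L = sets words"
      "\<And>k. marg (Suc k) L = marg (Suc k) (density (\<nu> (Suc k)) (\<lambda>x. H (word_rng x)))"
    proof (rule letters.kolmogorov_extension[of "\<lambda>n. density (\<nu> (Suc n)) (\<lambda>x. H (word_rng x))"])
      show "marg (Suc n) (density (\<nu> (Suc (Suc n))) (\<lambda>x. H (word_rng x))) =
          marg (Suc n) (density (\<nu> (Suc n)) (\<lambda>x. H (word_rng x)))" for n
        by (simp only: marg_density[OF \<nu>_sets Hm] stable)
    qed (use prob[OF \<nu>_sets \<nu>_law] \<nu>_sets in auto)
    \<comment> \<open>Undo the normalisation of the limit.\<close>
    define N where "N = density L (\<lambda>x. 1 / H (word_rng x))"
    have N: "sets N = sets words" using L(1) by (simp add: N_def)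
    have margN: "marg (Suc k) N = marg (Suc k) (\<nu> (Suc k))" for k
    proof -
      have "marg (Suc k) N = density (marg (Suc k) L) (\<lambda>y. 1 / H (letter_rng (y 0)))"
        unfolding N_def using Hm by (intro marg_density[OF L(1), where H = "\<lambda>v. 1 / H v"]) simp
      also have "\<dots> = density (density (marg (Suc k) (\<nu> (Suc k))) (\<lambda>y. H (letter_rng (y 0)))) (\<lambda>y. 1 / H (letter_rng (y 0)))"
        by (simp only: L(2) marg_density[OF \<nu>_sets Hm])
      also have "\<dots> = marg (Suc k) (\<nu> (Suc k))"
      proof (rule density_inverse)
        show "(\<lambda>y. H (letter_rng (y 0))) \<in> borel_measurable (marg (Suc k) (\<nu> (Suc k)))"
          using measurable_compose[OF first_letter_measurable Hm] by simp
        show "0 < H (letter_rng (y 0)) \<and> H (letter_rng (y 0)) < \<infinity>" if "y \<in> space (marg (Suc k) (\<nu> (Suc k)))" for y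
          using Hpos measurable_space[OF first_letter_measurable, of y k] that by simp
      qed
      finally show ?thesis .
    qed
    have law: "range_law N = \<mu>"
      using range_law_marg[OF N, of 0] range_law_marg[OF \<nu>_sets, of "Suc 0" 0] margN[of 0] \<nu>_law[of "Suc 0"] by simp
    have "step \<Lambda> N = N"
    proof (rule eqI)
      show "range_law (step \<Lambda> N) = \<mu>" by (rule range_law_step[OF sets\<mu> \<Lambda> N law])
      show "marg (Suc k) (step \<Lambda> N) = marg (Suc k) N" for k
      proof (cases k)
        case 0
        have "marg (Suc 0) (step \<Lambda> N) = marg (Suc 0) (step \<Lambda> (\<nu> 0))"
          by (intro marg_step_0 \<Lambda>(1) N \<nu>_sets) (simp only: \<nu>_law law)
        then show ?thesis unfolding 0 margN by (simp only: \<nu>_Suc)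
      next
        case (Suc m)
        have "marg (Suc (Suc m)) (step \<Lambda> N) = marg (Suc (Suc m)) (step \<Lambda> (\<nu> (Suc m)))"
          by (rule marg_step_Suc[OF \<Lambda>(1) N \<nu>_sets margN])
        then show ?thesis unfolding Suc margN by (simp only: \<nu>_Suc)
      qed
    qed (simp_all add: N)
    then show thesis using that N law by blast
  qed
qed

section \<open>Decoding sequences into boundary paths\<close>

text \<open>Local conditions on consecutive coordinates that characterise the codes of boundary paths: edges
  are composable, and a vertex is singular and repeats forever.\<close>

definition valid_at :: "nat \<Rightarrow> (nat \<Rightarrow> 'v + 'e) set" where
  "valid_at i = {x \<in> space words. letter_src (x i) = letter_rng (x (Suc i)) \<and>
     (\<forall>v. x i = Inl v \<longrightarrow> v \<in> singular_vertices E \<and> x (Suc i) = Inl v)}"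

definition codes :: "(nat \<Rightarrow> 'v + 'e) set" where
  "codes = (\<Inter>i. valid_at i)"

lemma word_component_in: "x \<in> space words \<Longrightarrow> x i \<in> space letters"
  by (auto simp: space_PiM)

text \<open>Equality of two measurable maps is a measurable condition because the target embeds into a Polish
  space.\<close>

lemma equal_measurable:
  assumes S: "borel_embedding S \<phi>" and f: "f \<in> M \<rightarrow>\<^sub>M S" and g: "g \<in> M \<rightarrow>\<^sub>M S"
  shows "{x \<in> space (M :: 'z measure). f x = g x} \<in> sets M"
proof -
  interpret borel_embedding S \<phi> by fact
  have "{x \<in> space M. \<phi> (f x) = \<phi> (g x)} \<in> sets M"
    using measurable_compose[OF f \<phi>_measurable] measurable_compose[OF g \<phi>_measurable] by (rule measurable_equality_set)
  moreover have "{x \<in> space M. \<phi> (f x) = \<phi> (g x)} = {x \<in> space M. f x = g x}"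
    using \<phi>_inj f[THEN measurable_space] g[THEN measurable_space] by (auto dest: inj_onD)
  ultimately show ?thesis by simp
qed

lemma valid_at_measurable: "valid_at i \<in> sets words"
proof -
  have 1: "{x \<in> space words. letter_src (x i) = letter_rng (x (Suc i))} \<in> sets words"
    by (rule equal_measurable[OF Y.borel_embedding_emb
          measurable_compose[OF word_component_measurable letter_src_measurable]
          measurable_compose[OF word_component_measurable letter_rng_measurable]])
  have 2: "{x \<in> space words. x i = x (Suc i)} \<in> sets words"
    by (rule equal_measurable[OF letters_embedding word_component_measurable word_component_measurable])
  have edge: "(\<lambda>x. x i) -` (Inr ` Et) \<inter> space words \<in> sets words"
    unfolding letters_def by (intro measurable_sets[OF word_component_measurable[unfolded letters_def]] Inr_image_sets)
      (auto simp: openin_borel_of)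
  have sing: "(\<lambda>x. x i) -` (Inl ` singular_vertices E) \<inter> space words \<in> sets words"
    unfolding letters_def by (intro measurable_sets[OF word_component_measurable[unfolded letters_def]] Inl_image_sets singular_borel)
  have "valid_at i = {x \<in> space words. letter_src (x i) = letter_rng (x (Suc i))} \<inter>
      (((\<lambda>x. x i) -` (Inr ` Et) \<inter> space words) \<union>
       ((\<lambda>x. x i) -` (Inl ` singular_vertices E) \<inter> space words) \<inter> {x \<in> space words. x i = x (Suc i)})"
  proof (intro equalityI subsetI)
    fix x assume x: "x \<in> valid_at i"
    then have "x i \<in> Vt <+> Et" using word_component_in space_letters by (auto simp: valid_at_def)
    then show "x \<in> {x \<in> space words. letter_src (x i) = letter_rng (x (Suc i))} \<inter>
      (((\<lambda>x. x i) -` (Inr ` Et) \<inter> space words) \<union>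
       ((\<lambda>x. x i) -` (Inl ` singular_vertices E) \<inter> space words) \<inter> {x \<in> space words. x i = x (Suc i)})"
      using x by (auto simp: valid_at_def)
  qed (auto simp: valid_at_def)
  then show ?thesis using 1 2 edge sing by (simp add: sets.Int sets.Un)
qed

lemma codes_measurable: "codes \<in> sets words"
  unfolding codes_def using valid_at_measurable by (intro sets.countable_INT) auto

lemma grow_in: "x \<in> extendable j \<Longrightarrow> grow j x \<in> space words"
  using measurable_space[OF grow_measurable, of x j] space_restrict_eq[OF extendable_measurable] by simp

lemma grow_simps [simp]: "grow j x 0 = Inr (branch j (word_rng x))" "grow j x (Suc i) = x i"
  by (simp_all add: grow_def)

lemma grow_valid_0: "x \<in> extendable j \<Longrightarrow> grow j x \<in> valid_at 0"
  using grow_in[of x j] s_branch[of "word_rng x" j] by (auto simp: valid_at_def extendable_def word_rng_def)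

lemma grow_valid_Suc: "x \<in> extendable j \<Longrightarrow> grow j x \<in> valid_at (Suc i) \<longleftrightarrow> x \<in> valid_at i"
  using grow_in[of x j] by (auto simp: valid_at_def extendable_def)

lemma grow_codes: "x \<in> extendable j \<Longrightarrow> grow j x \<in> codes \<longleftrightarrow> x \<in> codes"
  unfolding codes_def INT_iff using grow_valid_0 grow_valid_Suc by (metis UNIV_I not0_implies_Suc)

lemma const_word_valid: "v \<in> Vt \<Longrightarrow> const_word v \<in> valid_at i \<longleftrightarrow> v \<in> singular_vertices E"
  using measurable_space[OF const_word_measurable, of v] by (auto simp: valid_at_def const_word_def)

text \<open>The fixed point equation describes the first coordinates after one step: constant sequences are
  valid up to a \<open>\<Lambda>\<close>-null set since \<open>\<Lambda>\<close> is carried by singular vertices, a prepended edge fits by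
  construction, and validity at later positions is inherited.\<close>

lemma stationary_valid:
  assumes \<Lambda>: "sets \<Lambda> = sets (borel_of (vertices E))" "emeasure \<Lambda> (regular_vertices E) = 0"
    and N: "sets N = sets words" "step \<Lambda> N = N"
  shows "emeasure N (space words - valid_at i) = 0"
proof -
  have m: "space words - valid_at i \<in> sets words" for i using valid_at_measurable by auto
  have "{v \<in> Vt. const_word v \<in> space words - valid_at i} = regular_vertices E" for i
    using const_word_valid measurable_space[OF const_word_measurable] openin_subset[OF regular_open]
    by (auto simp: singular_vertices_def)
  then have st: "emeasure N (space words - valid_at i) =
      (\<Sum>j. emeasure N {x \<in> extendable j. grow j x \<in> space words - valid_at i})" for i
    using emeasure_step[OF \<Lambda>(1) N(1) m[of i]] \<Lambda>(2) N(2) by simp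
  show ?thesis
  proof (induction i)
    case 0
    have "{x \<in> extendable j. grow j x \<in> space words - valid_at 0} = {}" for j using grow_valid_0 by auto
    then show ?case unfolding st[of 0] by (simp only: emeasure_empty suminf_zero)
  next
    case (Suc i)
    have "emeasure N {x \<in> extendable j. grow j x \<in> space words - valid_at (Suc i)} = 0" for j
    proof (rule emeasure_eq_0[OF _ Suc])
      show "space words - valid_at i \<in> sets N" using m N(1) by simp
      show "{x \<in> extendable j. grow j x \<in> space words - valid_at (Suc i)} \<subseteq> space words - valid_at i"
        using grow_valid_Suc by (auto simp: extendable_def)
    qed
    then show ?case unfolding st[of "Suc i"] by simp
  qed
qed

text \<open>Vertices, the left summands, mark the end of the path.\<close>

definition decodes :: "(nat \<Rightarrow> 'v + 'e) \<Rightarrow> ('v, 'e) gpath \<Rightarrow> bool" where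
  "decodes x \<alpha> \<longleftrightarrow> \<alpha> \<in> bp \<and> path_range E \<alpha> = word_rng x \<and>
     (\<forall>i. (enat i < path_length \<alpha> \<longleftrightarrow> \<not> isl (x i)) \<and> (enat i < path_length \<alpha> \<longrightarrow> x i = Inr (path_edge \<alpha> i)))"

lemma enat_eqI_less:
  assumes "\<And>i. enat i < L \<longleftrightarrow> enat i < M" shows "L = M"
proof (cases L)
  case l: (enat l)
  show ?thesis
  proof (cases M)
    case (enat m)
    have "i < l \<longleftrightarrow> i < m" for i using assms[of i] l enat by simp
    then have "l = m" by (metis less_irrefl linorder_neqE_nat)
    then show ?thesis using l enat by simp
  qed (use assms[of l] l in simp)
next
  case infinity
  then show ?thesis using assms by (cases M) auto
qed

lemma decodes_unique:
  assumes a: "decodes x \<alpha>" "decodes x \<beta>" shows "\<alpha> = \<beta>"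
proof (rule boundary_path_eqI)
  show len: "path_length \<alpha> = path_length \<beta>"
    using a unfolding decodes_def by (intro enat_eqI_less) blast
  show "path_edge \<alpha> i = path_edge \<beta> i" if i: "enat i < path_length \<alpha>" for i
  proof -
    have "x i = Inr (path_edge \<alpha> i)" using a(1) i unfolding decodes_def by blast
    moreover have "x i = Inr (path_edge \<beta> i)" using a(2) i len unfolding decodes_def by metis
    ultimately show ?thesis by simp
  qed
qed (use a in \<open>simp_all add: decodes_def\<close>)

lemma decodes_exists:
  assumes x: "x \<in> codes" shows "\<exists>\<alpha>. decodes x \<alpha>"
proof -
  have V: "x \<in> valid_at i" for i using x by (auto simp: codes_def)
  have sp: "x \<in> space words" using V[of 0] by (simp add: valid_at_def)
  have src: "letter_src (x i) = letter_rng (x (Suc i))" for i using V[of i] by (simp add: valid_at_def)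
  have stop: "v \<in> singular_vertices E \<and> x (Suc i) = Inl v" if "x i = Inl v" for i v
    using V[of i] that unfolding valid_at_def by blast
  define n where "n = (if \<exists>i. isl (x i) then enat (LEAST i. isl (x i)) else \<infinity>)"
  \<comment> \<open>Once a vertex is reached, only this vertex follows.\<close>
  have stay: "isl (x (i + d))" if "isl (x i)" for i d
    using that
  proof (induction d)
    case (Suc d)
    then obtain v where "x (i + d) = Inl v" by (metis isl_def)
    then show ?case using stop[of "i + d" v] by simp
  qed simp
  have n: "enat i < n \<longleftrightarrow> \<not> isl (x i)" for i
  proof (cases "\<exists>i. isl (x i)")
    case True
    define k where "k = (LEAST i. isl (x i))"
    have k: "isl (x k)" unfolding k_def using True by (rule LeastI_ex)
    have "isl (x i)" if "k \<le> i" using stay[OF k, of "i - k"] that by simp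
    moreover have "\<not> isl (x i)" if "i < k" using not_less_Least that unfolding k_def by blast
    ultimately show ?thesis using True by (auto simp: n_def k_def[symmetric] not_le[symmetric])
  qed (simp add: n_def)
  let ?y = "\<lambda>i. projr (x i)"
  have y: "x i = Inr (?y i)" "?y i \<in> Et" if "enat i < n" for i
    using n[of i] that word_component_in[OF sp, of i] unfolding space_letters by auto
  have at: "vertex_at E (word_rng x) ?y i = letter_rng (x i)" if "enat i \<le> n" for i
  proof (cases i)
    case 0
    then show ?thesis by (simp add: word_rng_def)
  next
    case (Suc m)
    then have "enat m < n" using that by (metis Suc_ile_eq)
    then show ?thesis using src[of m] y(1)[of m] Suc by (metis letter_simps(4) vertex_at_simps(2))
  qed
  have "path_data E n (word_rng x) ?y"
    unfolding path_data_def
  proof (intro conjI allI impI)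
    show "word_rng x \<in> Vt" using measurable_space[OF word_rng_measurable sp] by simp
    show "?y i \<in> Et" if "enat i < n" for i using y(2)[OF that] .
    show "rng E (?y i) = vertex_at E (word_rng x) ?y i" if "enat i < n" for i
      using at[of i] y(1)[OF that] that by (metis letter_simps(2) less_imp_le)
    show "vertex_at E (word_rng x) ?y i \<in> singular_vertices E" if i: "n = enat i" for i
    proof -
      have "isl (x i)" using n[of i] i by simp
      then obtain v where v: "x i = Inl v" by (metis isl_def)
      then show ?thesis using at[of i] stop[OF v] i by simp
    qed
  qed
  then obtain \<alpha> where "\<alpha> \<in> bp" "path_length \<alpha> = n" "path_range E \<alpha> = word_rng x"
    "\<And>i. enat i < n \<Longrightarrow> path_edge \<alpha> i = ?y i"
    using boundary_path_exists by metis
  then have "decodes x \<alpha>" using n y(1) by (auto simp: decodes_def)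
  then show ?thesis by blast
qed

definition decode :: "(nat \<Rightarrow> 'v + 'e) \<Rightarrow> ('v, 'e) gpath" where
  "decode x = (SOME \<alpha>. decodes x \<alpha>)"

lemma decode: "x \<in> codes \<Longrightarrow> decodes x (decode x)"
  unfolding decode_def using decodes_exists by (rule someI_ex)

lemma decode_bp: "x \<in> codes \<Longrightarrow> decode x \<in> bp"
  and decode_range: "x \<in> codes \<Longrightarrow> path_range E (decode x) = word_rng x"
  and decode_length: "x \<in> codes \<Longrightarrow> enat i < path_length (decode x) \<longleftrightarrow> \<not> isl (x i)"
  and decode_edge: "x \<in> codes \<Longrightarrow> enat i < path_length (decode x) \<Longrightarrow> x i = Inr (path_edge (decode x) i)"
  using decode[of x] by (auto simp: decodes_def)

lemma decode_measurable: "decode \<in> restrict_space words codes \<rightarrow>\<^sub>M borel_of bps"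
proof (rule measurable_sigma_sets[OF sets_borel_of_bps borel_cyls_Pow])
  note sp = space_restrict_eq[OF codes_measurable]
  show "decode \<in> space (restrict_space words codes) \<rightarrow> bp" unfolding sp using decode_bp by auto
  fix C assume "C \<in> borel_cyls"
  then obtain n B A where C: "C = cyl n B A" and B: "B \<in> sets (borel_of (vertices E))"
    and A: "\<And>i. A i \<in> sets (borel_of (edges E))"
    unfolding borel_cyls_def by blast
  have le: "enat n \<le> L \<longleftrightarrow> (\<forall>i<n. enat i < L)" for L
  proof (cases L)
    case (enat m)
    have "n \<le> m \<longleftrightarrow> (\<forall>i<n. i < m)" by (meson less_le_trans not_le less_irrefl)
    then show ?thesis using enat by simp
  qed simp
  have "decode x \<in> C \<longleftrightarrow> word_rng x \<in> B \<and> (\<forall>i<n. x i \<in> Inr ` A i)" if x: "x \<in> codes" for x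
  proof -
    have "enat i < path_length (decode x) \<and> path_edge (decode x) i \<in> A i \<longleftrightarrow> x i \<in> Inr ` A i" for i
      using decode_length[OF x, of i] decode_edge[OF x, of i] by auto
    then show ?thesis
      using decode_bp[OF x] unfolding C cyl_def le mem_Collect_eq decode_range[OF x] by blast
  qed
  then have "decode -` C \<inter> codes = codes \<inter> (word_rng -` B \<inter> space words) \<inter>
      (\<Inter>i\<in>{..<n}. ((\<lambda>x. x i) -` (Inr ` A i) \<inter> space words))"
    using sets.sets_into_space[OF codes_measurable] by auto
  moreover have "word_rng -` B \<inter> space words \<in> sets words" using measurable_sets[OF word_rng_measurable B] .
  moreover have comp: "(\<lambda>x. x i) -` (Inr ` A i) \<inter> space words \<in> sets words" for i
    unfolding letters_def using A by (intro measurable_sets[OF word_component_measurable[unfolded letters_def]] Inr_image_sets)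
  moreover have "n \<noteq> 0 \<Longrightarrow> (\<Inter>i\<in>{..<n}. ((\<lambda>x. x i) -` (Inr ` A i) \<inter> space words)) \<in> sets words"
    using comp by (intro sets.finite_INT) auto
  ultimately have "decode -` C \<inter> codes \<in> sets words"
    using codes_measurable sets.Int[of codes words "word_rng -` B \<inter> space words"]
    by (cases "n = 0") (simp_all only: lessThan_0 INT_empty Int_UNIV_right sets.Int not_False_eq_True)
  then show "decode -` C \<inter> space (restrict_space words codes) \<in> sets (restrict_space words codes)"
    unfolding sp using codes_measurable by (simp add: sets_restrict_space_iff sets.Int_space_eq2)
qed

lemma decode_grow:
  assumes x: "x \<in> codes" "x \<in> extendable j"
  shows "decode (grow j x) = prepend (branch j (word_rng x)) (decode x)"
proof (rule decodes_unique[OF decode])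
  show "grow j x \<in> codes" using grow_codes x by simp
  let ?e = "branch j (word_rng x)"
  have w: "word_rng x \<in> src E ` piece j" using x(2) by (simp add: extendable_def)
  have e: "?e \<in> Et" "src E ?e = path_range E (decode x)"
    using branch_in[OF w] piece_in s_branch[OF w] decode_range[OF x(1)] by auto
  note pre = prepend_boundary[OF decode_bp[OF x(1)] e]
  have "(enat i < eSuc (path_length (decode x)) \<longleftrightarrow> \<not> isl (grow j x i)) \<and>
      (enat i < eSuc (path_length (decode x)) \<longrightarrow> grow j x i = Inr (path_edge (prepend ?e (decode x)) i))" for i
  proof (cases i)
    case 0
    then show ?thesis using pre(5) by (simp add: zero_enat_def[symmetric])
  next
    case (Suc m)
    have "enat (Suc m) < eSuc (path_length (decode x)) \<longleftrightarrow> enat m < path_length (decode x)"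
      by (simp add: eSuc_enat[symmetric])
    then show ?thesis
      using decode_length[OF x(1), of m] decode_edge[OF x(1), of m] pre(6)[of m] Suc by (auto simp: not_le)
  qed
  then show "decodes (grow j x) (prepend ?e (decode x))"
    using pre(1,3,4) by (simp add: decodes_def word_rng_def)
qed

text \<open>Let \<open>A\<close> consist of paths whose first edge lies in the \<open>j\<close>-th piece. Its codes are the sequences
  \<open>grow j x\<close> where \<open>x\<close> codes a path in the shift of \<open>A\<close>. Neither constant sequences nor edges from other
  pieces contribute, so that the fixed point equation says that \<open>A\<close> and its shift have the same
  measure.\<close>

theorem push_surj:
  assumes \<mu>: "\<mu> \<in> vertex_invariant_measures E"
  shows "\<exists>\<nu>\<in>invariant_measures E. push \<nu> = \<mu>"
proof -
  have reg: "\<mu> \<in> regular_borel_measures (vertices E)" using \<mu> by (simp add: vertex_invariant_measures_def)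
  have sets\<mu>: "sets \<mu> = sets (borel_of (vertices E))" using reg by (rule regular_borel_measures_sets)
  obtain \<Lambda> where \<Lambda>: "sets \<Lambda> = sets (borel_of (vertices E))"
    "\<And>B. B \<in> sets (borel_of (vertices E)) \<Longrightarrow> emeasure \<mu> B = emeasure \<Lambda> B + emeasure (edge_push \<mu>) B"
    "emeasure \<Lambda> (regular_vertices E) = 0"
    using defect_exists[OF \<mu>] by metis
  obtain N where N: "sets N = sets words" "range_law N = \<mu>" "step \<Lambda> N = N"
    using stationary_measure_exists[OF reg \<Lambda>(1,2)] by metis
  have spN: "space N = space words" using N(1) by (rule sets_eq_imp_space_eq)
  have null: "space words - codes \<in> null_sets N"
  proof -
    have "space words - valid_at i \<in> null_sets N" for i
      using stationary_valid[OF \<Lambda>(1,3) N(1,3)] valid_at_measurable N(1) by (auto simp: null_sets_def)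
    then have "(\<Union>i. space words - valid_at i) \<in> null_sets N" by (rule null_sets_UN)
    moreover have "space words - codes = (\<Union>i. space words - valid_at i)" by (auto simp: codes_def)
    ultimately show ?thesis by simp
  qed
  have cN: "codes \<in> sets N" using codes_measurable N(1) by simp
  have dm: "decode \<in> restrict_space N codes \<rightarrow>\<^sub>M borel_of bps"
    using decode_measurable N(1) by (simp cong: measurable_cong_sets restrict_space_sets_cong)
  define \<nu> where "\<nu> = distr (restrict_space N codes) (borel_of bps) decode"
  have sets\<nu>: "sets \<nu> = sets (borel_of bps)" by (simp add: \<nu>_def)
  have pre_m: "{x \<in> codes. decode x \<in> A} \<in> sets words" if "A \<in> sets (borel_of bps)" for A
  proof -
    have "decode -` A \<inter> codes \<in> sets (restrict_space words codes)"
      using measurable_sets[OF decode_measurable that] unfolding space_restrict_eq[OF codes_measurable] .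
    moreover have "decode -` A \<inter> codes = {x \<in> codes. decode x \<in> A}" by auto
    ultimately show ?thesis using codes_measurable by (simp add: sets_restrict_space_iff sets.Int_space_eq2)
  qed
  have e\<nu>: "emeasure \<nu> A = emeasure N {x \<in> codes. decode x \<in> A}" if "A \<in> sets (borel_of bps)" for A
  proof -
    have "decode -` A \<inter> codes = {x \<in> codes. decode x \<in> A}" by auto
    then show ?thesis
      unfolding \<nu>_def emeasure_distr[OF dm that] space_restrict_eq[OF cN]
      using cN by (simp add: emeasure_restrict_space sets.Int_space_eq2)
  qed
  have law: "push \<nu> = \<mu>"
  proof (rule measure_eqI)
    fix B assume "B \<in> sets (push \<nu>)"
    then have B: "B \<in> sets (borel_of (vertices E))" by simp
    have m: "word_rng \<in> N \<rightarrow>\<^sub>M borel_of (vertices E)"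
      using word_rng_measurable by (simp add: measurable_cong_sets[OF N(1) refl])
    have "emeasure (push \<nu>) B = emeasure \<nu> (cyl 0 B (\<lambda>_. Et))" by (rule emeasure_push[OF sets\<nu> B])
    also have "\<dots> = emeasure N {x \<in> codes. decode x \<in> cyl 0 B (\<lambda>_. Et)}" using B by (intro e\<nu> cyl_borel) auto
    also have "{x \<in> codes. decode x \<in> cyl 0 B (\<lambda>_. Et)} = (word_rng -` B \<inter> space N) - (space words - codes)"
      using decode_bp decode_range sets.sets_into_space[OF codes_measurable] unfolding spN by (auto simp: cyl_0)
    also have "emeasure N \<dots> = emeasure N (word_rng -` B \<inter> space N)"
      using null measurable_sets[OF m B] by (rule emeasure_Diff_null_set)
    also have "\<dots> = emeasure \<mu> B" unfolding N(2)[symmetric] by (rule emeasure_distr[OF m B, symmetric])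
    finally show "emeasure (push \<nu>) B = emeasure \<mu> B" .
  qed (simp add: sets\<mu>)
  have "\<nu> \<in> invariant_measures E"
  proof (rule invariant_measuresI)
    have "emeasure \<nu> K < \<infinity>" if K: "compactin bps K" for K
    proof -
      have rK: "compactin (vertices E) (path_range E ` K)" using image_compactin[OF K path_range_continuous] .
      then have rB: "path_range E ` K \<in> sets (borel_of (vertices E))" by (rule Y.compactin_borel_of)
      have "K \<subseteq> cyl 0 (path_range E ` K) (\<lambda>_. Et)"
        using compactin_subset_topspace[OF K] by (auto simp: cyl_0 topspace_boundary_path_space)
      then have "emeasure \<nu> K \<le> emeasure \<nu> (cyl 0 (path_range E ` K) (\<lambda>_. Et))"
        using rB by (intro emeasure_mono) (auto simp: sets\<nu> intro!: cyl_borel)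
      also have "\<dots> = emeasure \<mu> (path_range E ` K)"
        using emeasure_push[OF sets\<nu> rB, of "\<lambda>_. Et"] law by simp
      also have "\<dots> < \<infinity>" using regular_borel_measures_compact[OF reg rK] .
      finally show ?thesis .
    qed
    then show "\<nu> \<in> regular_borel_measures bps" using sets\<nu> by (simp add: regular_borel_measures_def)
  next
    fix A j assume A: "A \<in> sets (borel_of bps)" "A \<subseteq> first_in j"
    let ?X = "{x \<in> codes. decode x \<in> A}"
    have shA: "shift E ` A \<in> sets (borel_of bps)"
      using shift_image_borel_first_in[OF A(1), of j] A(2) by (simp add: inf_absorb1)
    \<comment> \<open>Constant sequences code vertices, which have no first edge.\<close>
    have const: "{v \<in> Vt. const_word v \<in> ?X} = {}"
    proof -
      have "decode (const_word v) \<notin> A" if "const_word v \<in> codes" for v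
      proof
        assume "decode (const_word v) \<in> A"
        then have "enat 0 < path_length (decode (const_word v))"
          using A(2) by (auto simp: first_in_def zero_enat_def)
        then show False using decode_length[OF that, of 0] by (simp add: const_word_def)
      qed
      then show ?thesis by auto
    qed
    \<comment> \<open>The first edge of the decoded path reveals the piece it was taken from.\<close>
    have first: "k = j" if x: "x \<in> extendable k" "grow k x \<in> ?X" for x k
    proof -
      have xc: "x \<in> codes" using x grow_codes by auto
      have w: "word_rng x \<in> src E ` piece k" using x(1) by (simp add: extendable_def)
      have g: "grow k x \<in> codes" "decode (grow k x) \<in> first_in j" using x(2) A(2) by auto
      then have "path_edge (decode (grow k x)) 0 \<in> piece j" "enat 0 < path_length (decode (grow k x))"
        by (auto simp: first_in_def zero_enat_def)
      then have "branch k (word_rng x) \<in> piece j" using decode_edge[OF g(1), of 0] by simp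
      then show "k = j" using branch_in[OF w] piece_unique by blast
    qed
    have main: "{x \<in> extendable j. grow j x \<in> ?X} = {x \<in> codes. decode x \<in> shift E ` A}"
    proof (intro equalityI subsetI)
      fix x assume x: "x \<in> {x \<in> extendable j. grow j x \<in> ?X}"
      then have xc: "x \<in> codes" "x \<in> extendable j" using grow_codes by auto
      have w: "word_rng x \<in> src E ` piece j" using xc(2) by (simp add: extendable_def)
      have "prepend (branch j (word_rng x)) (decode x) \<in> A" using x decode_grow[OF xc] by simp
      moreover have "shift E (prepend (branch j (word_rng x)) (decode x)) = decode x"
        using branch_in[OF w] piece_in s_branch[OF w] decode_range[OF xc(1)] decode_bp[OF xc(1)]
        by (intro prepend_boundary(2)) auto
      ultimately show "x \<in> {x \<in> codes. decode x \<in> shift E ` A}" using xc(1) by (metis (mono_tags, lifting) image_eqI mem_Collect_eq)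
    next
      fix x assume "x \<in> {x \<in> codes. decode x \<in> shift E ` A}"
      then obtain \<alpha> where \<alpha>: "x \<in> codes" "\<alpha> \<in> A" "decode x = shift E \<alpha>" by auto
      then have \<alpha>': "\<alpha> \<in> bp" "0 < path_length \<alpha>" "path_edge \<alpha> 0 \<in> piece j" using A(2) by (auto simp: first_in_def)
      note sh = shift_boundary[OF \<alpha>'(1,2)]
      have w: "word_rng x = src E (path_edge \<alpha> 0)" using decode_range[OF \<alpha>(1)] sh(2) \<alpha>(3) by simp
      have xs: "x \<in> space words" using sets.sets_into_space[OF codes_measurable] \<alpha>(1) by blast
      then have xe: "x \<in> extendable j" using w \<alpha>'(3) by (simp add: extendable_def)
      have "decode (grow j x) = \<alpha>"
        using decode_grow[OF \<alpha>(1) xe] sh(3) \<alpha>(3) branch_s[OF \<alpha>'(3)] w by simp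
      then show "x \<in> {x \<in> extendable j. grow j x \<in> ?X}" using xe \<alpha>(1,2) grow_codes[OF xe] by simp
    qed
    have "emeasure \<nu> A = emeasure N ?X" by (rule e\<nu>[OF A(1)])
    also have "\<dots> = emeasure (step \<Lambda> N) ?X" by (simp only: N(3))
    also have "\<dots> = (\<Sum>k. emeasure N {x \<in> extendable k. grow k x \<in> ?X})"
      unfolding emeasure_step[OF \<Lambda>(1) N(1) pre_m[OF A(1)]] const by simp
    also have "\<dots> = (\<Sum>k\<in>{j}. emeasure N {x \<in> extendable k. grow k x \<in> ?X})"
    proof (rule suminf_finite)
      show "emeasure N {x \<in> extendable k. grow k x \<in> ?X} = 0" if "k \<notin> {j}" for k
      proof -
        have "{x \<in> extendable k. grow k x \<in> ?X} = {}" using first that by blast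
        then show ?thesis by (simp only: emeasure_empty)
      qed
    qed simp
    also have "\<dots> = emeasure N {x \<in> codes. decode x \<in> shift E ` A}" using main by simp
    also have "\<dots> = emeasure \<nu> (shift E ` A)" by (rule e\<nu>[OF shA, symmetric])
    finally show "emeasure \<nu> (shift E ` A) = emeasure \<nu> A" by simp
  qed
  then show ?thesis using law by blast
qed

theorem push_affine_bijection: "affine_bijection push (invariant_measures E) (vertex_invariant_measures E)"
  unfolding affine_bijection_def bij_betw_def
proof (intro conjI ballI)
  show "inj_on push (invariant_measures E)" by (rule push_inj_on)
  show "push ` invariant_measures E = vertex_invariant_measures E"
    using push_vertex_invariant push_surj by (auto simp: image_iff)
qed (simp_all add: convex_comb_invariant push_convex_comb)

end

theorem proposition2p6:
  fixes E :: "('v, 'e) topgraph"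
  assumes "topological_graph E" and "second_countable_graph E"
  shows "affine_bijection (\<lambda>\<nu>. distr \<nu> (borel_of (vertices E)) (path_range E))
           (invariant_measures E) (vertex_invariant_measures E)"
proof -
  interpret sc_graph E using assms by unfold_locales
  show ?thesis by (rule push_affine_bijection)
qed

end
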